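(* Let $D$ be a strongly connected digraph of order $n\geq 4$ satisfying condition $A_0$. Then $D$ contains a Hamiltonian bypass, unless $D$ is isomorphic to the tournament $T(5)$.
   Context: Digraphs are finite, without loops and without multiple arcs (a pair of opposite arcs $xy$, $yx$ is allowed). For a vertex $x$, $d^+(x)$ is the number of out-neighbours, $d^-(x)$ the number of in-neighbours, and $d(x)=d^+(x)+d^-(x)$. Two distinct vertices are adjacent if at least one of the arcs $xy$, $yx$ is present. A digraph $D$ of order $n$ satisfies condition $A_0$ if for every triple of distinct vertices $x,y,z$ such that $x$ and $y$ are non-adjacent: if there is no arc from $x$ to $z$, then $d(x)+d(y)+d^+(x)+d^-(z)\geq 3n-2$; and if there is no arc from $z$ to $x$, then $d(x)+d(y)+d^-(x)+d^+(z)\geq 3n-2$. A Hamiltonian bypass in $D$ is a subdigraph obtained from a Hamiltonian cycle of $D$ (a directed cycle through all vertices) by reversing exactly one arc; equivalently, vertices $x_1,\dots,x_n$ (all vertices of $D$) with arcs $x_ix_{i+1}$ for $i\in[1,n-1]$ and the arc $x_1x_n$ present in $D$. $T(5)$ is the tournament with vertex set $\{x_1,x_2,x_3,x_4,y\}$ and arc set $\{x_1x_2,x_2x_3,x_3x_4,x_4x_1,x_1y,x_3y,yx_2,yx_4,x_1x_3,x_2x_4\}$. *)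

theory Defs
  imports Main
begin

definition digraph :: "'a set \<Rightarrow> ('a \<Rightarrow> 'a \<Rightarrow> bool) \<Rightarrow> bool" where
  "digraph V A \<longleftrightarrow> finite V \<and> (\<forall>x y. A x y \<longrightarrow> x \<in> V \<and> y \<in> V) \<and> (\<forall>x. \<not> A x x)"

definition outdeg :: "'a set \<Rightarrow> ('a \<Rightarrow> 'a \<Rightarrow> bool) \<Rightarrow> 'a \<Rightarrow> nat" where
  "outdeg V A x = card {y \<in> V. A x y}"

definition indeg :: "'a set \<Rightarrow> ('a \<Rightarrow> 'a \<Rightarrow> bool) \<Rightarrow> 'a \<Rightarrow> nat" where
  "indeg V A x = card {y \<in> V. A y x}"

definition deg :: "'a set \<Rightarrow> ('a \<Rightarrow> 'a \<Rightarrow> bool) \<Rightarrow> 'a \<Rightarrow> nat" where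
  "deg V A x = outdeg V A x + indeg V A x"

definition adjacent :: "('a \<Rightarrow> 'a \<Rightarrow> bool) \<Rightarrow> 'a \<Rightarrow> 'a \<Rightarrow> bool" where
  "adjacent A x y \<longleftrightarrow> A x y \<or> A y x"

text \<open>Strongly connected: every vertex reaches every other by a directed path
  (paths automatically stay in V since arcs lie within V).\<close>
definition strongly_connected :: "'a set \<Rightarrow> ('a \<Rightarrow> 'a \<Rightarrow> bool) \<Rightarrow> bool" where
  "strongly_connected V A \<longleftrightarrow> (\<forall>x\<in>V. \<forall>y\<in>V. A\<^sup>*\<^sup>* x y)"

definition cond_A0 :: "'a set \<Rightarrow> ('a \<Rightarrow> 'a \<Rightarrow> bool) \<Rightarrow> bool" where
  "cond_A0 V A \<longleftrightarrow>
    (\<forall>x\<in>V. \<forall>y\<in>V. \<forall>z\<in>V. x \<noteq> y \<and> x \<noteq> z \<and> y \<noteq> z \<and> \<not> adjacent A x y \<longrightarrow>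
       (\<not> A x z \<longrightarrow> deg V A x + deg V A y + outdeg V A x + indeg V A z \<ge> 3 * card V - 2) \<and>
       (\<not> A z x \<longrightarrow> deg V A x + deg V A y + indeg V A x + outdeg V A z \<ge> 3 * card V - 2))"

definition has_hamiltonian_bypass :: "'a set \<Rightarrow> ('a \<Rightarrow> 'a \<Rightarrow> bool) \<Rightarrow> bool" where
  "has_hamiltonian_bypass V A \<longleftrightarrow>
    (\<exists>xs. distinct xs \<and> set xs = V \<and> length xs \<ge> 2 \<and>
          (\<forall>i. Suc i < length xs \<longrightarrow> A (xs ! i) (xs ! Suc i)) \<and>
          A (hd xs) (last xs))"

text \<open>The tournament T(5) on vertices 1,2,3,4 (= x_1..x_4) and 0 (= y).\<close>
definition T5_arc :: "nat \<Rightarrow> nat \<Rightarrow> bool" where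
  "T5_arc u v \<longleftrightarrow> (u, v) \<in> {(1,2),(2,3),(3,4),(4,1),(1,0),(3,0),(0,2),(0,4),(1,3),(2,4)}"

definition T5_vertices :: "nat set" where
  "T5_vertices = {0,1,2,3,4}"

definition digraph_iso :: "'a set \<Rightarrow> ('a \<Rightarrow> 'a \<Rightarrow> bool) \<Rightarrow> 'b set \<Rightarrow> ('b \<Rightarrow> 'b \<Rightarrow> bool) \<Rightarrow> bool" where
  "digraph_iso V A W B \<longleftrightarrow>
    (\<exists>f. bij_betw f V W \<and> (\<forall>x\<in>V. \<forall>y\<in>V. A x y \<longleftrightarrow> B (f x) (f y)))"

end

theory Submission
  imports Defs
begin

text \<open>Suppose there is no Hamiltonian bypass. A vertex \<open>y\<close> omitted by a cycle \<open>C\<close> of length \<open>n - 1\<close> neither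
  dominates nor is dominated by two consecutive vertices of \<open>C\<close>, hence has degree less than \<open>n\<close>.
  Condition \<open>A0\<close> makes the non-adjacent pairs of degree sum at most \<open>2n - 2\<close>, called mates here, a matching;
  in every other non-adjacent pair one vertex has so large a degree that it can be inserted greedily into paths.
  Applied to a longest cycle and a shortest detour around a piece of it, this yields a Hamiltonian cycle.
  On a Hamiltonian cycle, a maximal run of vertices of degree at least \<open>n\<close> would be flanked by two mates,
  and inserting the run into the rest of the cycle produces a bypass; so every degree is less than \<open>n\<close>
  and all non-adjacent vertices are mates.
  Now \<open>A0\<close> makes the out-degree increase along every arc without an opposite arc that has a mated end. As it cannot
  increase all around a Hamiltonian cycle, some cycle of length \<open>n - 1\<close> omits a vertex \<open>y\<close> without a mate.
  The arcs at \<open>y\<close> alternate along this cycle, which contradicts the uniqueness of mates unless \<open>n\<close> is small,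
  and then only \<open>T(5)\<close> is left.\<close>

section \<open>Paths, cycles and insertion\<close>

text \<open>The number 2n-2 in the definition of mates is chosen from two sides. If d(x)+d(y) <=
  2n-2, then A0 leaves at least n for d^+(x)+d^-(z), or for d^-(x)+d^+(z), whenever the arc
  concerned is absent, and its two halves together rule out a second mate. If instead d(x)+d(y) >=
  2n-1 and the neighbours of x are confined to few vertices, then d(y) reaches exactly the bound
  that insertion asks for: a vertex that fits between no two consecutive vertices of a path Q has at
  most |Q|+1 arcs with Q, so Q absorbs a set S once each vertex of S has |Q|+2|S| arcs inside their
  union. Insertion never changes the ends of a path; hence a path whose first vertex dominates its
  last one stays such a path until it covers V and is a bypass. The obstacle is the mates, for which
  A0 promises no large degree; therefore cycles are cut at a mate and much effort goes into locating
  it. Reversing all arcs swaps the two halves of A0, so symmetric claims come from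
  \<open>dual\<close>.\<close>

definition cyc :: "('a \<Rightarrow> 'a \<Rightarrow> bool) \<Rightarrow> 'a list \<Rightarrow> bool" where
  "cyc A xs \<longleftrightarrow> xs \<noteq> [] \<and> distinct xs \<and> successively A xs \<and> A (last xs) (hd xs)"

definition arcs_in :: "('a \<Rightarrow> 'a \<Rightarrow> bool) \<Rightarrow> 'a \<Rightarrow> 'a set \<Rightarrow> nat" where
  "arcs_in A u X = card {x \<in> X. A x u}"

definition arcs_out :: "('a \<Rightarrow> 'a \<Rightarrow> bool) \<Rightarrow> 'a \<Rightarrow> 'a set \<Rightarrow> nat" where
  "arcs_out A u X = card {x \<in> X. A u x}"

text \<open>Only interior positions count, so that an insertion keeps both ends of the path.\<close>

definition slot :: "('a \<Rightarrow> 'a \<Rightarrow> bool) \<Rightarrow> 'a \<Rightarrow> 'a list \<Rightarrow> bool" where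
  "slot A u Q \<longleftrightarrow> (\<exists>xs c d ys. Q = xs @ c # d # ys \<and> A c u \<and> A u d)"

lemma cyc_rotate:
  assumes "cyc A (xs @ ys)"
  shows "cyc A (ys @ xs)"
proof (cases "xs = [] \<or> ys = []")
  case True
  then show ?thesis using assms by auto
next
  case False
  then show ?thesis
    using assms by (auto simp: cyc_def successively_append_iff)
qed

text \<open>Each of the |Q|-1 consecutive pairs contributes at most one to [P c] + [R d], and these
  contributions miss only \<open>P\<close> at the last and \<open>R\<close> at the first vertex. Two
  predicates are used because \<open>P\<close> = \<open>R\<close> (no two consecutive
  out-neighbours) and the arcs at the two ends of an inserted path are counted in the same
  way.\<close>

lemma slot_bound:
  assumes "distinct Q" "Q \<noteq> []"
    and "\<And>xs c d ys. Q = xs @ c # d # ys \<Longrightarrow> \<not> (P c \<and> R d)"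
  shows "card {x \<in> set Q. P x} + card {x \<in> set Q. R x} + 1
    \<le> length Q + of_bool (P (last Q)) + of_bool (R (hd Q))"
  using assms
proof (induction Q rule: induct_list012)
  case (2 x)
  have "{y. y = x \<and> S y} = (if S x then {x} else {})" for S by auto
  then show ?case by auto
next
  case (3 x y zs)
  have IH: "card {a \<in> set (y # zs). P a} + card {a \<in> set (y # zs). R a} + 1
    \<le> length (y # zs) + of_bool (P (last (y # zs))) + of_bool (R y)"
  proof -
    have "\<not> (P c \<and> R d)" if "y # zs = xs @ c # d # ys" for xs c d ys
      using 3(5)[of "x # xs" c d ys] that by simp
    from 3(2)[OF _ _ this] 3(3) show ?thesis by simp
  qed
  have ex: "card {a \<in> set (x # y # zs). S a} = card {a \<in> set (y # zs). S a} + of_bool (S x)" for S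
  proof -
    have "{a \<in> set (x # y # zs). S a} = {a \<in> set (y # zs). S a} \<union> (if S x then {x} else {})"
      by auto
    moreover have "x \<notin> set (y # zs)" using 3(3) by auto
    ultimately show ?thesis by (cases "S x") auto
  qed
  have "\<not> (P x \<and> R y)" using 3(5)[of "[]" x y zs] by simp
  then show ?case using IH unfolding ex by (cases "P x"; cases "R y"; cases "R x") auto
qed simp

text \<open>The closing pair of last and first vertex absorbs the two boundary terms.\<close>

lemma cyclic_slot_bound:
  assumes "distinct C" "C \<noteq> []"
    and "\<And>xs c d ys. C = xs @ c # d # ys \<Longrightarrow> \<not> (P c \<and> R d)"
    and "\<not> (P (last C) \<and> R (hd C))"
  shows "card {x \<in> set C. P x} + card {x \<in> set C. R x} \<le> length C"
proof -
  have "card {x \<in> set C. P x} + card {x \<in> set C. R x} + 1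
    \<le> length C + of_bool (P (last C)) + of_bool (R (hd C))"
    by (rule slot_bound) (use assms in auto)
  then show ?thesis using assms(4) by (cases "P (last C)"; cases "R (hd C)") auto
qed

lemma no_slot_bound:
  assumes "distinct Q" "Q \<noteq> []" "\<not> slot A u Q"
  shows "arcs_in A u (set Q) + arcs_out A u (set Q) + 1
    \<le> length Q + of_bool (A (last Q) u) + of_bool (A u (hd Q))"
  unfolding arcs_in_def arcs_out_def
  by (rule slot_bound) (use assms in \<open>auto simp: slot_def\<close>)

lemma successively_insert:
  assumes "successively A (xs @ c # d # ys)" "A c u" "A u d"
  shows "successively A (xs @ c # u # d # ys)"
  using assms by (auto simp: successively_append_iff)

lemma slot_insert:
  assumes "slot A u Q" "distinct Q" "successively A Q" "u \<notin> set Q"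
  obtains Q' where "distinct Q'" "successively A Q'" "Q' \<noteq> []" "hd Q' = hd Q" "last Q' = last Q"
    "set Q' = insert u (set Q)" "length Q' = Suc (length Q)"
proof -
  obtain xs c d ys where Q: "Q = xs @ c # d # ys" "A c u" "A u d"
    using assms(1) by (auto simp: slot_def)
  show ?thesis
    by (rule that[of "xs @ c # u # d # ys"])
      (use assms Q successively_insert[of A xs c d ys u] in \<open>auto simp: hd_append\<close>)
qed

text \<open>Vertices with a slot are inserted one at a time until none is left. The leftover
  \<open>S'\<close> is stuck with respect to the final path \<open>Q'\<close>, not just
  \<open>Q\<close>; this is what later degree bounds use.\<close>

lemma greedy_insert:
  assumes "finite S" "Q \<noteq> []" "distinct Q" "successively A Q" "set Q \<inter> S = {}"
  shows "\<exists>Q' S'. S' \<subseteq> S \<and> Q' \<noteq> [] \<and> distinct Q' \<and> successively A Q' \<and> hd Q' = hd Q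
    \<and> last Q' = last Q \<and> set Q' = set Q \<union> (S - S') \<and> (\<forall>u\<in>S'. \<not> slot A u Q')"
  using assms
proof (induction "card S" arbitrary: S Q)
  case 0
  then show ?case by (intro exI[of _ Q] exI[of _ "{}"]) auto
next
  case (Suc k)
  show ?case
  proof (cases "\<exists>u\<in>S. slot A u Q")
    case True
    then obtain u where u: "u \<in> S" "slot A u Q" by auto
    obtain Q1 where Q1: "distinct Q1" "successively A Q1" "Q1 \<noteq> []" "hd Q1 = hd Q"
      "last Q1 = last Q" "set Q1 = insert u (set Q)"
      using slot_insert[OF u(2) Suc(5,6)] Suc(7) u(1) by (metis disjoint_iff)
    have "k = card (S - {u})" using Suc(2,3) u(1) by simp
    from Suc(1)[OF this _ Q1(3,1,2)] Suc(3,7) Q1(6) u(1)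
    obtain Q' S' where "S' \<subseteq> S - {u}" "Q' \<noteq> []" "distinct Q'" "successively A Q'" "hd Q' = hd Q"
      "last Q' = last Q" "set Q' = set Q1 \<union> ((S - {u}) - S')" "\<forall>v\<in>S'. \<not> slot A v Q'"
      using Q1(4,5) by (auto simp: disjoint_iff)
    then show ?thesis using u(1) Q1(6) by (intro exI[of _ Q'] exI[of _ S']) auto
  next
    case False
    then show ?thesis using Suc by (intro exI[of _ Q] exI[of _ S]) auto
  qed
qed

text \<open>A vertex of the gap satisfying \<open>P\<close> can replace \<open>p\<close>, one
  satisfying \<open>R\<close> can replace \<open>q\<close>. Applied to the neighbours of a vertex,
  it produces a gap of non-neighbours, or an empty one.\<close>

lemma closest_pair:
  assumes "L = L1 @ p # B @ q # L2" "P p" "R q"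
  shows "\<exists>L1' p' B' q' L2'. L = L1' @ p' # B' @ q' # L2' \<and> P p' \<and> R q' \<and> (\<forall>x\<in>set B'. \<not> P x \<and> \<not> R x)"
  using assms
proof (induction "length B" arbitrary: L1 p B q L2 rule: less_induct)
  case less
  show ?case
  proof (cases "\<exists>x\<in>set B. P x \<or> R x")
    case True
    then obtain x B1 B2 where B: "B = B1 @ x # B2" "P x \<or> R x" by (metis split_list)
    show ?thesis
    proof (cases "P x")
      case True
      show ?thesis
        by (rule less(1)[where B = B2 and ?L1.0 = "L1 @ p # B1" and p = x and q = q and ?L2.0 = L2])
          (use less B True in \<open>auto\<close>)
    next
      case False
      show ?thesis
        by (rule less(1)[where B = B1 and ?L1.0 = L1 and p = p and q = x and ?L2.0 = "B2 @ q # L2"])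
          (use less B False in \<open>auto\<close>)
    qed
  next
    case False
    then show ?thesis using less(2-4) by blast
  qed
qed

lemma two_in_list:
  assumes "x \<in> set L" "y \<in> set L" "x \<noteq> y"
  shows "(\<exists>L1 B L2. L = L1 @ x # B @ y # L2) \<or> (\<exists>L1 B L2. L = L1 @ y # B @ x # L2)"
proof -
  obtain L1 L2 where L: "L = L1 @ x # L2" using assms(1) by (metis split_list)
  consider "y \<in> set L1" | "y \<in> set L2" using assms(2,3) L by auto
  then show ?thesis
  proof cases
    case 1
    then obtain M N where "L1 = M @ y # N" by (metis split_list)
    then have "L = M @ y # N @ x # L2" using L by simp
    then show ?thesis by blast
  next
    case 2
    then obtain M N where "L2 = M @ y # N" by (metis split_list)
    then have "L = L1 @ x # M @ y # N" using L by simp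
    then show ?thesis by blast
  qed
qed

lemma card_le_1I:
  assumes "finite X" "\<And>x y. x \<in> X \<Longrightarrow> y \<in> X \<Longrightarrow> x = y"
  shows "card X \<le> 1"
  using assms by (metis One_nat_def card_le_Suc0_iff_eq)

section \<open>Counting the arcs between a vertex and a set\<close>

definition arcs :: "('a \<Rightarrow> 'a \<Rightarrow> bool) \<Rightarrow> 'a \<Rightarrow> 'a set \<Rightarrow> nat" where
  "arcs A u X = arcs_in A u X + arcs_out A u X"

lemma arcs_in_Un: "finite X \<Longrightarrow> finite Y \<Longrightarrow> X \<inter> Y = {} \<Longrightarrow> arcs_in A u (X \<union> Y) = arcs_in A u X + arcs_in A u Y"
  unfolding arcs_in_def by (subst card_Un_disjoint[symmetric]) (auto intro: arg_cong[of _ _ card])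

lemma arcs_out_Un: "finite X \<Longrightarrow> finite Y \<Longrightarrow> X \<inter> Y = {} \<Longrightarrow> arcs_out A u (X \<union> Y) = arcs_out A u X + arcs_out A u Y"
  unfolding arcs_out_def by (subst card_Un_disjoint[symmetric]) (auto intro: arg_cong[of _ _ card])

lemma arcs_Un: "finite X \<Longrightarrow> finite Y \<Longrightarrow> X \<inter> Y = {} \<Longrightarrow> arcs A u (X \<union> Y) = arcs A u X + arcs A u Y"
  by (simp add: arcs_def arcs_in_Un arcs_out_Un)

lemma arcs_in_insert: "finite X \<Longrightarrow> x \<notin> X \<Longrightarrow> arcs_in A u (insert x X) = of_bool (A x u) + arcs_in A u X"
proof -
  have "{y \<in> {x}. A y u} = (if A x u then {x} else {})" by auto
  then show "finite X \<Longrightarrow> x \<notin> X \<Longrightarrow> ?thesis"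
    using arcs_in_Un[of "{x}" X A u] by (simp add: arcs_in_def)
qed

lemma arcs_out_insert: "finite X \<Longrightarrow> x \<notin> X \<Longrightarrow> arcs_out A u (insert x X) = of_bool (A u x) + arcs_out A u X"
proof -
  have "{y \<in> {x}. A u y} = (if A u x then {x} else {})" by auto
  then show "finite X \<Longrightarrow> x \<notin> X \<Longrightarrow> ?thesis"
    using arcs_out_Un[of "{x}" X A u] by (simp add: arcs_out_def)
qed

lemma arcs_insert: "finite X \<Longrightarrow> x \<notin> X \<Longrightarrow>
    arcs A u (insert x X) = of_bool (A x u) + of_bool (A u x) + arcs A u X"
  by (simp add: arcs_def arcs_in_insert arcs_out_insert)

lemma arcs_empty [simp]: "arcs A u {} = 0" "arcs_in A u {} = 0" "arcs_out A u {} = 0"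
  by (auto simp: arcs_def arcs_in_def arcs_out_def)

lemma arcs_in_le: "finite X \<Longrightarrow> arcs_in A u X \<le> card X"
  unfolding arcs_in_def by (rule card_mono) auto

lemma arcs_out_le: "finite X \<Longrightarrow> arcs_out A u X \<le> card X"
  unfolding arcs_out_def by (rule card_mono) auto

lemma arcs_le: "finite X \<Longrightarrow> arcs A u X \<le> 2 * card X"
  using arcs_in_le[of X A u] arcs_out_le[of X A u] by (simp add: arcs_def)

lemma arcs_le_minus: "finite X \<Longrightarrow> u \<in> X \<Longrightarrow> \<not> A u u \<Longrightarrow> arcs A u X + 2 \<le> 2 * card X"
proof -
  assume *: "finite X" "u \<in> X" "\<not> A u u"
  then have "arcs A u X = arcs A u (X - {u})"
    using arcs_insert[of "X - {u}" u A u] by (simp add: insert_absorb)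
  moreover have "card X = Suc (card (X - {u}))" using * by (metis card.remove)
  ultimately show ?thesis using arcs_le[of "X - {u}" A u] * by simp
qed

lemma arcs_0I: "(\<And>x. x \<in> X \<Longrightarrow> \<not> A x u \<and> \<not> A u x) \<Longrightarrow> arcs A u X = 0"
proof -
  assume "\<And>x. x \<in> X \<Longrightarrow> \<not> A x u \<and> \<not> A u x"
  then have "{x \<in> X. A x u} = {}" "{x \<in> X. A u x} = {}" by blast+
  then show ?thesis by (simp only: arcs_def arcs_in_def arcs_out_def card.empty)
qed

lemma no_slot_arcs:
  assumes "distinct Q" "Q \<noteq> []" "\<not> slot A u Q"
  shows "arcs A u (set Q) + 1 \<le> length Q + of_bool (A (last Q) u) + of_bool (A u (hd Q))"
  using no_slot_bound[OF assms] by (simp add: arcs_def)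

lemma no_slot_arcs_le:
  assumes "distinct Q" "Q \<noteq> []" "\<not> slot A u Q"
  shows "arcs A u (set Q) \<le> length Q + 1"
    "\<not> A u (hd Q) \<Longrightarrow> arcs A u (set Q) \<le> length Q"
    "\<not> A (last Q) u \<Longrightarrow> arcs A u (set Q) \<le> length Q"
  using no_slot_arcs[OF assms] by (cases "A u (hd Q)"; cases "A (last Q) u"; simp)+

text \<open>A vertex left over with \<open>S'\<close> would have at most |Q'|+1 arcs with the path
  and 2|S'|-2 with \<open>S'\<close>. As |Q'|+|S'| = |Q|+|S|, this is less than |Q|+2|S|.\<close>

lemma insert_block:
  assumes "finite S" "Q \<noteq> []" "distinct Q" "successively A Q" "set Q \<inter> S = {}"
    and irr: "\<And>x. \<not> A x x"
    and large: "\<And>u. u \<in> S \<Longrightarrow> length Q + 2 * card S \<le> arcs A u (set Q \<union> S)"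
  obtains Q' where "Q' \<noteq> []" "distinct Q'" "successively A Q'" "hd Q' = hd Q" "last Q' = last Q"
    "set Q' = set Q \<union> S"
proof -
  obtain Q' S' where Q': "S' \<subseteq> S" "Q' \<noteq> []" "distinct Q'" "successively A Q'" "hd Q' = hd Q"
    "last Q' = last Q" "set Q' = set Q \<union> (S - S')" "\<forall>u\<in>S'. \<not> slot A u Q'"
    using greedy_insert[OF assms(1-5)] by blast
  have "S' = {}"
  proof (rule ccontr)
    assume "S' \<noteq> {}"
    then obtain u where u: "u \<in> S'" by auto
    have fin: "finite S'" using Q'(1) assms(1) finite_subset by auto
    have "arcs A u (set Q \<union> S) = arcs A u (set Q') + arcs A u S'"
    proof -
      have "set Q \<union> S = set Q' \<union> S'" using Q' by auto
      moreover have "set Q' \<inter> S' = {}" using Q' assms(5) by auto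
      ultimately show ?thesis using arcs_Un[of "set Q'" S' A u] fin by simp
    qed
    moreover have "arcs A u (set Q') \<le> length Q' + 1"
      using no_slot_arcs[OF Q'(3,2)] Q'(8) u
      by (cases "A (last Q') u"; cases "A u (hd Q')") force+
    moreover have "arcs A u S' + 2 \<le> 2 * card S'" by (rule arcs_le_minus[of _ _ A]) (use fin u irr in auto)
    moreover have "length Q' + card S' = length Q + card S"
    proof -
      have "length Q' = card (set Q')" using Q'(3) distinct_card by metis
      also have "\<dots> = length Q + card (S - S')"
        unfolding Q'(7) using assms(1,3,5) by (subst card_Un_disjoint) (auto simp: distinct_card)
      finally show ?thesis
        using Q'(1) fin assms(1) card_mono[OF assms(1) Q'(1)] by (simp add: card_Diff_subset)
    qed
    moreover have "card S' \<le> card S" using Q'(1) assms(1) card_mono by blast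
    ultimately show False using large[of u] u Q'(1) by auto
  qed
  then show ?thesis using that Q' by auto
qed

section \<open>Digraphs without a bypass\<close>

locale bypass_free =
  fixes V :: "'a set" and A :: "'a \<Rightarrow> 'a \<Rightarrow> bool"
  assumes dg: "digraph V A"
    and n4: "card V \<ge> 4"
    and strong: "strongly_connected V A"
    and A0: "cond_A0 V A"
    and nb: "\<not> has_hamiltonian_bypass V A"
begin

lemma fin [simp]: "finite V" and irr [simp]: "\<not> A x x"
  using dg by (auto simp: digraph_def)

lemma arcV: "A x y \<Longrightarrow> x \<in> V \<and> y \<in> V"
  using dg by (auto simp: digraph_def)

lemma indeg_conv: "indeg V A x = arcs_in A x V" and outdeg_conv: "outdeg V A x = arcs_out A x V"
  by (auto simp: indeg_def outdeg_def arcs_in_def arcs_out_def)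

lemma deg_conv: "deg V A x = arcs A x V"
  by (simp add: deg_def arcs_def indeg_conv outdeg_conv)

lemma dual: "bypass_free V (\<lambda>x y. A y x)"
proof
  show "digraph V (\<lambda>x y. A y x)" using dg by (auto simp: digraph_def)
  show "card V \<ge> 4" by (rule n4)
  show "strongly_connected V (\<lambda>x y. A y x)"
  proof -
    have "(\<lambda>x y. A y x)\<^sup>*\<^sup>* = (A\<^sup>*\<^sup>*)\<inverse>\<inverse>" using rtranclp_conversep[of A] by (simp add: conversep_iff[abs_def])
    then show ?thesis using strong by (auto simp: strongly_connected_def)
  qed
  have o: "outdeg V (\<lambda>x y. A y x) = indeg V A" "indeg V (\<lambda>x y. A y x) = outdeg V A"
    by (auto simp: outdeg_def indeg_def)
  have d: "deg V (\<lambda>x y. A y x) = deg V A" by (auto simp: deg_def o)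
  show "cond_A0 V (\<lambda>x y. A y x)"
    using A0 unfolding cond_A0_def o d adjacent_def by blast
  show "\<not> has_hamiltonian_bypass V (\<lambda>x y. A y x)"
  proof
    assume "has_hamiltonian_bypass V (\<lambda>x y. A y x)"
    then obtain xs where xs: "distinct xs" "set xs = V" "length xs \<ge> 2"
      "successively (\<lambda>x y. A y x) xs" "A (last xs) (hd xs)"
      by (auto simp: has_hamiltonian_bypass_def successively_conv_nth)
    then have "distinct (rev xs)" "set (rev xs) = V" "length (rev xs) \<ge> 2"
      "successively A (rev xs)" "A (hd (rev xs)) (last (rev xs))"
      by (auto simp: successively_rev hd_rev last_rev)
    then show False using nb unfolding has_hamiltonian_bypass_def successively_conv_nth by blast
  qed
qed

lemma no_bypass:
  assumes "distinct xs" "set xs = V" "successively A xs" "A (hd xs) (last xs)"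
  shows False
proof -
  have "length xs \<ge> 2" using assms(1,2) n4 distinct_card by fastforce
  then show ?thesis using nb assms unfolding has_hamiltonian_bypass_def successively_conv_nth by blast
qed

lemma A0_out: "x \<in> V \<Longrightarrow> y \<in> V \<Longrightarrow> z \<in> V \<Longrightarrow> x \<noteq> y \<Longrightarrow> x \<noteq> z \<Longrightarrow> y \<noteq> z \<Longrightarrow> \<not> adjacent A x y
    \<Longrightarrow> \<not> A x z \<Longrightarrow> 3 * card V \<le> deg V A x + deg V A y + outdeg V A x + indeg V A z + 2"
  using A0 unfolding cond_A0_def by fastforce

lemma A0_in: "x \<in> V \<Longrightarrow> y \<in> V \<Longrightarrow> z \<in> V \<Longrightarrow> x \<noteq> y \<Longrightarrow> x \<noteq> z \<Longrightarrow> y \<noteq> z \<Longrightarrow> \<not> adjacent A x y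
    \<Longrightarrow> \<not> A z x \<Longrightarrow> 3 * card V \<le> deg V A x + deg V A y + indeg V A x + outdeg V A z + 2"
  using A0 unfolding cond_A0_def by fastforce

lemma adjacent_sym: "adjacent A x y \<longleftrightarrow> adjacent A y x"
  by (auto simp: adjacent_def)

text \<open>Since \<open>x\<close> and \<open>z\<close> are non-adjacent, both halves of A0 apply to
  the triple, and this is their sum. Two degree sums of at most 2n-2 would make the right side at
  most 6n-2, so mates are unique.\<close>

lemma matching:
  assumes "x \<in> V" "y \<in> V" "z \<in> V" "x \<noteq> y" "x \<noteq> z" "y \<noteq> z" "\<not> adjacent A x y" "\<not> adjacent A x z"
  shows "6 * card V \<le> 2 * (deg V A x + deg V A y) + (deg V A x + deg V A z) + 4"
  using A0_out[of x y z] A0_in[of x y z] assms by (auto simp: adjacent_def deg_def)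

definition mate :: "'a \<Rightarrow> 'a \<Rightarrow> bool" where
  "mate x y \<longleftrightarrow> x \<in> V \<and> y \<in> V \<and> x \<noteq> y \<and> \<not> adjacent A x y \<and> deg V A x + deg V A y + 2 \<le> 2 * card V"

lemma mate_sym: "mate x y \<longleftrightarrow> mate y x"
  by (auto simp: mate_def adjacent_def)

lemma mate_unique: "mate x y \<Longrightarrow> mate x z \<Longrightarrow> y = z"
  using matching[of x y z] by (auto simp: mate_def)

lemma not_mate: "x \<in> V \<Longrightarrow> y \<in> V \<Longrightarrow> x \<noteq> y \<Longrightarrow> \<not> adjacent A x y \<Longrightarrow> \<not> mate x y
    \<Longrightarrow> 2 * card V \<le> deg V A x + deg V A y + 1"
  by (auto simp: mate_def)

lemma mate_out: "mate x y \<Longrightarrow> z \<in> V \<Longrightarrow> z \<noteq> x \<Longrightarrow> z \<noteq> y \<Longrightarrow> \<not> A x z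
    \<Longrightarrow> card V \<le> outdeg V A x + indeg V A z"
  using A0_out[of x y z] by (auto simp: mate_def)

lemma mate_in: "mate x y \<Longrightarrow> z \<in> V \<Longrightarrow> z \<noteq> x \<Longrightarrow> z \<noteq> y \<Longrightarrow> \<not> A z x
    \<Longrightarrow> card V \<le> indeg V A x + outdeg V A z"
  using A0_in[of x y z] by (auto simp: mate_def)

lemma deg_split: "X \<subseteq> V \<Longrightarrow> deg V A u = arcs A u X + arcs A u (V - X)"
proof -
  assume X: "X \<subseteq> V"
  then have "arcs A u (X \<union> (V - X)) = arcs A u X + arcs A u (V - X)"
    by (intro arcs_Un) (auto intro: finite_subset)
  moreover have "X \<union> (V - X) = V" using X by auto
  ultimately show ?thesis by (simp add: deg_conv)
qed

lemma deg_V_minus: "u \<in> V \<Longrightarrow> deg V A u = arcs A u (V - {u})"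
proof -
  have "arcs A u {u} = 0" by (rule arcs_0I) auto
  then show "u \<in> V \<Longrightarrow> ?thesis" using deg_split[of "{u}" u] by simp
qed

lemma outdeg_pos: "x \<in> V \<Longrightarrow> outdeg V A x \<ge> 1"
proof -
  assume x: "x \<in> V"
  have "\<not> V \<subseteq> {x}" using n4 card_mono[of "{x}" V] by auto
  then obtain y where y: "y \<in> V" "y \<noteq> x" by auto
  then have "A\<^sup>*\<^sup>* x y" using strong x by (auto simp: strongly_connected_def)
  then obtain z where "A x z" using y by (metis converse_rtranclpE)
  then have "{y \<in> V. A x y} \<noteq> {}" using arcV by blast
  then show ?thesis by (simp add: outdeg_def Suc_leI card_gt_0_iff)
qed

lemma indeg_pos: "x \<in> V \<Longrightarrow> indeg V A x \<ge> 1"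
proof -
  interpret d: bypass_free V "\<lambda>x y. A y x" by (rule dual)
  show "x \<in> V \<Longrightarrow> ?thesis" using d.outdeg_pos[of x] by (simp add: outdeg_def indeg_def)
qed

lemma outdeg_le2: "x \<in> V \<Longrightarrow> z \<in> V \<Longrightarrow> z \<noteq> x \<Longrightarrow> \<not> A x z \<Longrightarrow> outdeg V A x + 2 \<le> card V"
proof -
  assume x: "x \<in> V" "z \<in> V" "z \<noteq> x" "\<not> A x z"
  have "outdeg V A x \<le> card (V - {x, z})" unfolding outdeg_def using x by (intro card_mono) auto
  also have "\<dots> = card V - 2" using x by (subst card_Diff_subset) auto
  finally show ?thesis using n4 by simp
qed

lemma indeg_le2: "x \<in> V \<Longrightarrow> z \<in> V \<Longrightarrow> z \<noteq> x \<Longrightarrow> \<not> A z x \<Longrightarrow> indeg V A x + 2 \<le> card V"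
proof -
  interpret d: bypass_free V "\<lambda>x y. A y x" by (rule dual)
  show "x \<in> V \<Longrightarrow> z \<in> V \<Longrightarrow> z \<noteq> x \<Longrightarrow> \<not> A z x \<Longrightarrow> ?thesis"
    using d.outdeg_le2[of x z] by (simp add: outdeg_def indeg_def)
qed

lemma card_cyc: "cyc A C \<Longrightarrow> set C = V - {y} \<Longrightarrow> y \<in> V \<Longrightarrow> length C + 1 = card V"
  using distinct_card[of C] n4 by (auto simp: cyc_def)

text \<open>Otherwise \<open>y\<close> put in front of \<open>P\<close>, or behind it, would
  complete a bypass.\<close>

lemma omitted_path_ends:
  assumes "distinct P" "P \<noteq> []" "successively A P" "set P = V - {y}" "y \<in> V"
  shows "\<not> (A y (hd P) \<and> A y (last P))" "\<not> (A (hd P) y \<and> A (last P) y)"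
proof -
  have s: "set (y # P) = V" "set (P @ [y]) = V" using assms(4,5) by auto
  have d: "distinct (y # P)" "distinct (P @ [y])" using assms(1,4) by auto
  show "\<not> (A y (hd P) \<and> A y (last P))"
    using no_bypass[OF d(1) s(1)] assms(2,3) by (auto simp: successively_Cons)
  show "\<not> (A (hd P) y \<and> A (last P) y)"
    using no_bypass[OF d(2) s(2)] assms(2,3) by (auto simp: successively_append_iff)
qed

lemma omitted_cycle_ends:
  assumes "cyc A C" "set C = V - {y}" "y \<in> V"
  shows "\<not> (A y (last C) \<and> A y (hd C))" "\<not> (A (last C) y \<and> A (hd C) y)"
  using omitted_path_ends[of C y] assms by (auto simp: cyc_def)

lemma omitted_consecutive:
  assumes "cyc A C" "set C = V - {y}" "y \<in> V" "C = xs @ c # d # ys"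
  shows "\<not> (A y c \<and> A y d)" "\<not> (A c y \<and> A d y)"
proof -
  have cy: "cyc A ((d # ys) @ xs @ [c])" using cyc_rotate[of A "xs @ [c]" "d # ys"] assms(1,4) by simp
  have S: "set ((d # ys) @ xs @ [c]) = V - {y}"
    unfolding assms(2)[symmetric] assms(4) by auto
  from omitted_cycle_ends[OF cy S assms(3)] show "\<not> (A y c \<and> A y d)" "\<not> (A c y \<and> A d y)"
    by simp_all
qed

text \<open>No two cyclically consecutive vertices are both out-neighbours or both in-neighbours of
  \<open>y\<close>, so each kind makes up at most half of the n-1 vertices.\<close>

lemma omitted_degree:
  assumes "cyc A C" "set C = V - {y}" "y \<in> V"
  shows "2 * outdeg V A y + 1 \<le> card V" "2 * indeg V A y + 1 \<le> card V" "deg V A y + 1 \<le> card V"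
proof -
  have C: "distinct C" "C \<noteq> []" using assms(1) by (auto simp: cyc_def)
  have "card {x \<in> set C. A y x} + card {x \<in> set C. A y x} \<le> length C"
  proof (rule cyclic_slot_bound[OF C])
    show "\<not> (A y c \<and> A y d)" if "C = xs @ c # d # ys" for xs c d ys
      by (rule omitted_consecutive(1)[OF assms that])
  qed (rule omitted_cycle_ends[OF assms])
  moreover have "card {x \<in> set C. A x y} + card {x \<in> set C. A x y} \<le> length C"
  proof (rule cyclic_slot_bound[OF C])
    show "\<not> (A c y \<and> A d y)" if "C = xs @ c # d # ys" for xs c d ys
      by (rule omitted_consecutive(2)[OF assms that])
  qed (rule omitted_cycle_ends[OF assms])
  moreover have "{x \<in> set C. A y x} = {x \<in> V. A y x}" "{x \<in> set C. A x y} = {x \<in> V. A x y}"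
    unfolding assms(2) using irr[of y] by blast+
  ultimately show "2 * outdeg V A y + 1 \<le> card V" "2 * indeg V A y + 1 \<le> card V" "deg V A y + 1 \<le> card V"
    using card_cyc[OF assms] by (auto simp: deg_def outdeg_def indeg_def)
qed

end

section \<open>Lengthening cycles by paths\<close>

lemma cyc_append_path:
  assumes "cyc A C" "us \<noteq> []" "distinct us" "successively A us" "set us \<inter> set C = {}"
    "A (last C) (hd us)" "A (last us) (hd C)"
  shows "cyc A (C @ us)"
  using assms by (auto simp: cyc_def successively_append_iff)

lemma cyc_insert_path:
  assumes "cyc A (xs @ c # d # ys)" "us \<noteq> []" "distinct us" "successively A us"
    "set us \<inter> set (xs @ c # d # ys) = {}" "A c (hd us)" "A (last us) d"
  shows "cyc A (xs @ c # us @ d # ys)"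
proof -
  have "cyc A ((d # ys) @ (xs @ [c]))" using cyc_rotate[of A "xs @ [c]" "d # ys"] assms(1) by simp
  from cyc_append_path[OF this assms(2-4)] assms(5-7)
  have "cyc A ((d # ys) @ (xs @ [c] @ us))" by auto
  from cyc_rotate[OF this] show ?thesis by simp
qed

lemma cyc_insert:
  assumes "cyc A (xs @ c # d # ys)" "A c u" "A u d" "u \<notin> set (xs @ c # d # ys)"
  shows "cyc A (xs @ c # u # d # ys)"
  using cyc_insert_path[of A xs c d ys "[u]"] assms by auto

lemma path_into_set:
  assumes "A\<^sup>*\<^sup>* y v" "y \<notin> S" "v \<in> S"
  shows "\<exists>ys x. ys \<noteq> [] \<and> hd ys = y \<and> distinct ys \<and> successively A ys \<and> set ys \<inter> S = {} \<and> x \<in> S \<and> A (last ys) x"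
  using assms(1,2)
proof (induction rule: converse_rtranclp_induct)
  case base
  then show ?case using assms(3) by auto
next
  case (step y y')
  show ?case
  proof (cases "y' \<in> S")
    case True
    then show ?thesis using step by (intro exI[of _ "[y]"] exI[of _ y']) auto
  next
    case False
    then obtain ys x where ys: "ys \<noteq> []" "hd ys = y'" "distinct ys" "successively A ys"
      "set ys \<inter> S = {}" "x \<in> S" "A (last ys) x" using step by blast
    show ?thesis
    proof (cases "y \<in> set ys")
      case True
      then obtain a b where ab: "ys = a @ y # b" by (metis split_list)
      show ?thesis using ys step(4) unfolding ab
        by (intro exI[of _ "y # b"] exI[of _ x]) (auto simp: successively_append_iff)
    next
      case False
      then show ?thesis using ys step(1,4)
        by (intro exI[of _ "y # ys"] exI[of _ x]) (auto simp: successively_Cons)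
    qed
  qed
qed

context bypass_free
begin

section \<open>The arcs of a vertex omitted by a cycle of length n-1\<close>

lemma V_split: "X \<subseteq> V \<Longrightarrow> card V = card X + card (V - X)"
  by (metis card_Diff_subset card_mono fin finite_subset le_add_diff_inverse)

text \<open>All neighbours of \<open>y\<close> lie on \<open>Q\<close>, so d(y) <= |Q|+1. The
  vertices of \<open>B\<close> are not mates of \<open>y\<close>, so their degrees are at least
  n+|B|-1 = |Q|+2|B|, just enough for \<open>insert_block\<close>. The resulting path has the ends
  of \<open>Q\<close> and covers V - {y}, which settles the first two claims. For the third, one
  vertex of \<open>B\<close> is left out and \<open>y\<close> closes the path to a cycle; then this
  vertex and \<open>y\<close> are both omitted by cycles, have degree less than n, and would be
  mates.\<close>

lemma nonadjacent_block:
  assumes C: "cyc A (B @ Q)" "set (B @ Q) = V - {y}" "y \<in> V" "length Q \<ge> 2"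
    and good: "\<forall>u\<in>set B. \<not> adjacent A y u \<and> \<not> mate y u"
  shows "\<not> (A y (hd Q) \<and> A y (last Q))" "\<not> (A (hd Q) y \<and> A (last Q) y)"
    "A (last Q) y \<Longrightarrow> A y (hd Q) \<Longrightarrow> B = []"
proof -
  have Q: "Q \<noteq> []" "distinct Q" "successively A Q" "set Q \<inter> set B = {}" "distinct B"
    using C(1,4) by (auto simp: cyc_def successively_append_iff)
  have n: "length B + length Q + 1 = card V" using card_cyc[OF C(1-3)] by simp
  have BQ: "set Q \<union> set B = V - {y}" using C(2) by (metis set_append Un_commute)
  have BV: "set B \<subseteq> V" using BQ by blast
  have o: "outdeg V A y = card {x \<in> set Q. A y x}" "indeg V A y = card {x \<in> set Q. A x y}"
  proof -
    have "x \<in> set Q" if "x \<in> V" "A y x \<or> A x y" for x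
      using that good BQ irr[of y] unfolding adjacent_def by blast
    moreover have "set Q \<subseteq> V" using BQ by blast
    ultimately have "{x \<in> V. A y x} = {x \<in> set Q. A y x}" "{x \<in> V. A x y} = {x \<in> set Q. A x y}"
      by blast+
    then show "outdeg V A y = card {x \<in> set Q. A y x}" "indeg V A y = card {x \<in> set Q. A x y}"
      by (simp_all only: outdeg_def indeg_def)
  qed
  have "card {x \<in> set Q. A y x} + card {x \<in> set Q. A y x} + 1 \<le> length Q + of_bool (A y (last Q)) + of_bool (A y (hd Q))"
  proof (rule slot_bound[OF Q(2,1)])
    fix xs c d ys assume "Q = xs @ c # d # ys"
    then show "\<not> (A y c \<and> A y d)" by (intro omitted_consecutive(1)[OF C(1-3), of "B @ xs"]) simp
  qed
  moreover have "card {x \<in> set Q. A x y} + card {x \<in> set Q. A x y} + 1 \<le> length Q + of_bool (A (last Q) y) + of_bool (A (hd Q) y)"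
  proof (rule slot_bound[OF Q(2,1)])
    fix xs c d ys assume "Q = xs @ c # d # ys"
    then show "\<not> (A c y \<and> A d y)" by (intro omitted_consecutive(2)[OF C(1-3), of "B @ xs"]) simp
  qed
  moreover have ob: "of_bool b \<le> (1::nat)" for b by auto
  ultimately have dy: "deg V A y \<le> length Q + 1"
    using ob[of "A y (last Q)"] ob[of "A y (hd Q)"] ob[of "A (last Q) y"] ob[of "A (hd Q) y"]
    unfolding deg_def o by linarith
  have du: "length B + card V \<le> deg V A u + 1" if "u \<in> set B" for u
  proof -
    have "u \<in> V" "u \<noteq> y" using that BQ by blast+
    then show ?thesis using not_mate[of y u] good that C(3) dy n by fastforce
  qed
  have au: "deg V A u = arcs A u (set Q \<union> set B)" if "u \<in> set B" for u
  proof -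
    have "arcs A u {y} = 0" by (rule arcs_0I) (use good that in \<open>auto simp: adjacent_def\<close>)
    then show ?thesis unfolding BQ using deg_split[of "{y}" u] C(3) by simp
  qed
  obtain Q' where Q': "Q' \<noteq> []" "distinct Q'" "successively A Q'" "hd Q' = hd Q" "last Q' = last Q"
    "set Q' = set Q \<union> set B"
  proof (rule insert_block[of "set B" Q A])
    show "length Q + 2 * card (set B) \<le> arcs A u (set Q \<union> set B)" if "u \<in> set B" for u
      using du[OF that] au[OF that] n distinct_card[OF Q(5)] by simp
  qed (use Q in auto)
  show "\<not> (A y (hd Q) \<and> A y (last Q))" "\<not> (A (hd Q) y \<and> A (last Q) y)"
    using omitted_path_ends[OF Q'(2,1,3) _ C(3)] Q'(4-6) BQ by simp_all
  show "B = []" if yy: "A (last Q) y" "A y (hd Q)"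
  proof (rule ccontr)
    assume "B \<noteq> []"
    then obtain u B' where B: "B = u # B'" by (cases B) auto
    have B'Q: "set Q \<union> set B' = V - {y, u}" "u \<in> V" "u \<noteq> y" using BQ Q(4,5) unfolding B by auto
    obtain Q'' where Q'': "Q'' \<noteq> []" "distinct Q''" "successively A Q''" "hd Q'' = hd Q" "last Q'' = last Q"
      "set Q'' = set Q \<union> set B'"
    proof (rule insert_block[of "set B'" Q A])
      show "length Q + 2 * card (set B') \<le> arcs A v (set Q \<union> set B')" if "v \<in> set B'" for v
      proof -
        have v: "v \<in> set B" using that B by simp
        have "set Q \<union> set B = insert u (set Q \<union> set B')" "u \<notin> set Q \<union> set B'" using Q(4,5) B by auto
        \<comment> \<open>Leaving out \<open>u\<close> costs at most two arcs and lowers the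
          requirement of \<open>insert_block\<close> by two.\<close>
        then have "arcs A v (set Q \<union> set B) \<le> 2 + arcs A v (set Q \<union> set B')"
          by (simp add: arcs_insert)
        moreover have "card (set B') + 1 = length B" using Q(5) B by (simp add: distinct_card)
        ultimately show ?thesis using du[OF v] au[OF v] n by simp
      qed
    qed (use Q B in auto)
    have "cyc A (Q'' @ [y])"
      using Q'' B'Q yy by (auto simp: cyc_def successively_append_iff)
    moreover have "set (Q'' @ [y]) = V - {u}" using Q''(6) B'Q C(3) by auto
    ultimately have "deg V A u + 1 \<le> card V" using omitted_degree(3) B'Q(2) by blast
    moreover have "deg V A y + 1 \<le> card V" using omitted_degree(3)[OF C(1-3)] .
    ultimately show False using not_mate[of y u] good B B'Q C(3) by auto
  qed
qed

lemma nonadjacent_segment: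
  assumes C: "cyc A (L @ E)" "set (L @ E) = V - {y}" "y \<in> V"
    and good: "\<forall>u\<in>set L. \<not> mate y u"
    and L: "L = L1 @ p # B @ q # L2" "\<forall>u\<in>set B. \<not> A y u \<and> \<not> A u y"
  shows "\<not> (A y p \<and> A y q)" "\<not> (A p y \<and> A q y)" "A p y \<Longrightarrow> A y q \<Longrightarrow> B = []"
proof -
  have cy: "cyc A (B @ (q # L2 @ E @ L1 @ [p]))"
    using cyc_rotate[of A "L1 @ [p]" "B @ q # L2 @ E"] C(1) L by simp
  have s: "set (B @ (q # L2 @ E @ L1 @ [p])) = V - {y}" unfolding C(2)[symmetric] L by auto
  have g: "\<forall>u\<in>set B. \<not> adjacent A y u \<and> \<not> mate y u"
    using L good by (auto simp: adjacent_def)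
  from nonadjacent_block[OF cy s C(3) _ g]
  show "\<not> (A y p \<and> A y q)" "\<not> (A p y \<and> A q y)" "A p y \<Longrightarrow> A y q \<Longrightarrow> B = []" by auto
qed

text \<open>For a closest such pair the vertices in between are non-neighbours of \<open>y\<close>;
  \<open>nonadjacent_segment\<close> then says that there are none, and the pair is a slot.\<close>

lemma no_in_before_out:
  assumes C: "cyc A (L @ E)" "set (L @ E) = V - {y}" "y \<in> V"
    and good: "\<forall>u\<in>set L. \<not> mate y u"
    and free: "\<forall>L1 p q L2. L = L1 @ p # q # L2 \<longrightarrow> \<not> (A p y \<and> A y q)"
    and L: "L = L1 @ p # B @ q # L2"
  shows "\<not> (A p y \<and> A y q)"
proof
  assume pq: "A p y \<and> A y q"
  obtain L1' p' B' q' L2' where 1: "L = L1' @ p' # B' @ q' # L2'" "A p' y" "A y q'"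
    "\<forall>x\<in>set B'. \<not> A x y \<and> \<not> A y x"
    using closest_pair[OF L, where P = "\<lambda>x. A x y" and R = "A y"] pq by blast
  have "B' = []" using nonadjacent_segment(3)[OF C good 1(1)] 1 by blast
  then have "L = L1' @ p' # q' # L2'" using 1(1) by simp
  then show False using free 1(2,3) by blast
qed

text \<open>By \<open>no_in_before_out\<close> no in-neighbour lies between two out-neighbours. So
  between two closest out-neighbours there is no neighbour of \<open>y\<close> at all, which
  \<open>nonadjacent_segment\<close> forbids; likewise for in-neighbours.\<close>

lemma slotless_segment:
  assumes C: "cyc A (L @ E)" "set (L @ E) = V - {y}" "y \<in> V"
    and good: "\<forall>u\<in>set L. \<not> mate y u"
    and free: "\<forall>L1 p q L2. L = L1 @ p # q # L2 \<longrightarrow> \<not> (A p y \<and> A y q)"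
  shows "card {x \<in> set L. A y x} \<le> 1" "card {x \<in> set L. A x y} \<le> 1"
proof -
  have no_OO: False if L: "L = L1 @ p # B @ q # L2" "A y p" "A y q" for L1 p B q L2
  proof -
    obtain L1' p' B' q' L2' where 1: "L = L1' @ p' # B' @ q' # L2'" "A y p'" "A y q'"
      "\<forall>x\<in>set B'. \<not> A y x \<and> \<not> A y x"
      using closest_pair[OF L(1), where P = "A y" and R = "A y"] L(2,3) by blast
    have "\<not> A x y" if xB: "x \<in> set B'" for x
    proof -
      obtain M N where "B' = M @ x # N" using split_list[OF xB] by blast
      then have "L = (L1' @ p' # M) @ x # N @ q' # L2'" using 1 by simp
      then show ?thesis using no_in_before_out[OF C good free] 1(3) by blast
    qed
    then show False using nonadjacent_segment(1)[OF C good 1(1)] 1 by blast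
  qed
  have no_II: False if L: "L = L1 @ p # B @ q # L2" "A p y" "A q y" for L1 p B q L2
  proof -
    obtain L1' p' B' q' L2' where 1: "L = L1' @ p' # B' @ q' # L2'" "A p' y" "A q' y"
      "\<forall>x\<in>set B'. \<not> A x y \<and> \<not> A x y"
      using closest_pair[OF L(1), where P = "\<lambda>x. A x y" and R = "\<lambda>x. A x y"] L(2,3) by blast
    have "\<not> A y x" if xB: "x \<in> set B'" for x
    proof -
      obtain M N where "B' = M @ x # N" using split_list[OF xB] by blast
      then have "L = L1' @ p' # M @ x # (N @ q' # L2')" using 1 by simp
      then show ?thesis using no_in_before_out[OF C good free] 1(2) by blast
    qed
    then show False using nonadjacent_segment(2)[OF C good 1(1)] 1 by blast
  qed
  show "card {x \<in> set L. A y x} \<le> 1"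
    by (rule card_le_1I) (use two_in_list[of _ L] no_OO in \<open>auto, metis\<close>)
  show "card {x \<in> set L. A x y} \<le> 1"
    by (rule card_le_1I) (use two_in_list[of _ L] no_II in \<open>auto, metis\<close>)
qed

text \<open>Without a Hamiltonian cycle \<open>y\<close> has no slot on \<open>C\<close>, so
  \<open>slotless_segment\<close> leaves it hardly any arcs. If \<open>y\<close> has a mate, then
  d^+(y) <= 1, and A0 fails for some vertex that \<open>y\<close> does not dominate. If not,
  \<open>y\<close> has a single neighbour, so d(y) <= 2, and any other vertex would be a
  mate.\<close>

lemma omitting_cycle_hamiltonian:
  assumes nh: "\<And>C. cyc A C \<Longrightarrow> set C \<noteq> V"
    and C: "cyc A C" "set C = V - {y}" "y \<in> V"
  shows False
proof -
  have free: "\<not> (A p y \<and> A y q)" if "cyc A (L1 @ p # q # L2)" "set (L1 @ p # q # L2) = V - {y}" for L1 p q L2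
  proof
    assume "A p y \<and> A y q"
    then have cy: "cyc A (L1 @ p # y # q # L2)"
      by (intro cyc_insert[OF that(1)]) (simp_all only: that(2) DiffD2 singletonI Diff_iff not_False_eq_True simp_thms)
    have "set (L1 @ p # y # q # L2) = insert y (set (L1 @ p # q # L2))" by auto
    also have "\<dots> = V" unfolding that(2) using C(3) by (rule insert_Diff)
    finally show False using nh cy by blast
  qed
  show False
  proof (cases "\<exists>z. mate y z")
    case True
    then obtain z where z: "mate y z" by auto
    then have "z \<in> set C" unfolding C(2) by (auto simp: mate_def)
    then obtain X Y where XY: "C = X @ z # Y" by (metis split_list)
    have C1: "cyc A ((Y @ X) @ [z])" using cyc_rotate[of A "X @ [z]" Y] C(1) XY by simp
    have S1: "set ((Y @ X) @ [z]) = V - {y}" unfolding C(2)[symmetric] XY by auto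
    have d: "z \<notin> set (Y @ X)" using C1 by (auto simp: cyc_def)
    have good: "\<forall>u\<in>set (Y @ X). \<not> mate y u" using d mate_unique z by blast
    have fr: "\<forall>L1 p q L2. Y @ X = L1 @ p # q # L2 \<longrightarrow> \<not> (A p y \<and> A y q)"
    proof (intro allI impI)
      fix L1 p q L2 assume "Y @ X = L1 @ p # q # L2"
      then have "L1 @ p # q # (L2 @ [z]) = (Y @ X) @ [z]" by simp
      then show "\<not> (A p y \<and> A y q)" using free C1 S1 by metis
    qed
    note f = slotless_segment[OF C1 S1 C(3) good fr]
    have nz: "\<not> A y z" "\<not> A z y" using z by (auto simp: mate_def adjacent_def)
    have in_L: "x \<in> set (Y @ X)" if "x \<in> V" "A y x \<or> A x y" for x
    proof -
      have "x \<in> set ((Y @ X) @ [z])" unfolding S1 using that irr[of y] by blast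
      then show ?thesis using nz that by auto
    qed
    have "card {x \<in> V. A y x} \<le> card {x \<in> set (Y @ X). A y x}"
      by (rule card_mono, simp, use in_L in blast)
    then have o: "outdeg V A y \<le> 1" using f(1) unfolding outdeg_def by simp
    have "card {y, z} = 2" using z by (simp add: mate_def)
    then have "card ({y, z} \<union> {x \<in> V. A y x}) \<le> 3"
      using o card_Un_le[of "{y, z}" "{x \<in> V. A y x}"] unfolding outdeg_def by linarith
    moreover have "finite ({y, z} \<union> {x \<in> V. A y x})" by simp
    ultimately have "\<not> V \<subseteq> {y, z} \<union> {x \<in> V. A y x}"
      using n4 card_mono[of "{y, z} \<union> {x \<in> V. A y x}" V] by linarith
    then obtain w where w: "w \<in> V" "w \<noteq> y" "w \<noteq> z" "\<not> A y w" by blast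
    show False using mate_out[OF z w] indeg_le2[OF w(1) C(3)] w o by auto
  next
    case False
    obtain a where a: "A a y" using indeg_pos[OF C(3)] unfolding indeg_def
      by (metis (mono_tags, lifting) Collect_empty_eq card.empty not_one_le_zero)
    then have "a \<in> set C" unfolding C(2) using arcV[OF a] irr[of y] by blast
    then obtain X Y where XY: "C = X @ a # Y" by (metis split_list)
    \<comment> \<open>Starting at the in-neighbour \<open>a\<close> puts every other vertex behind
      it, so none of them can be an out-neighbour of \<open>y\<close>.\<close>
    define L where "L = a # Y @ X"
    have C1: "cyc A (L @ [])" using cyc_rotate[of A X "a # Y"] C(1) XY L_def by simp
    have S1: "set (L @ []) = V - {y}" unfolding C(2)[symmetric] XY L_def by auto
    have good: "\<forall>u\<in>set L. \<not> mate y u" using False by blast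
    have fr: "\<forall>L1 p q L2. L = L1 @ p # q # L2 \<longrightarrow> \<not> (A p y \<and> A y q)"
      using free C1 S1 by (metis append_Nil2)
    note f = slotless_segment[OF C1 S1 C(3) good fr]
    have only: "x = a" if "A y x \<or> A x y" for x
    proof (rule ccontr)
      assume "x \<noteq> a"
      have "x \<in> set (L @ [])" unfolding S1 using that arcV irr[of y] by blast
      with \<open>x \<noteq> a\<close> have "x \<in> set (Y @ X)" by (simp add: L_def)
      then obtain M N where MN: "Y @ X = M @ x # N" by (metis split_list)
      then have "L = [] @ a # M @ x # N" by (simp add: L_def)
      then have nyx: "\<not> A y x" using no_in_before_out[OF C1 S1 C(3) good fr] a by blast
      then have "{a, x} \<subseteq> {x \<in> set L. A x y}" using a that MN by (auto simp: L_def)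
      then have "card {a, x} \<le> 1" using f(2) card_mono[of "{x \<in> set L. A x y}" "{a, x}"] by simp
      then show False using \<open>x \<noteq> a\<close> by simp
    qed
    have "card {y, a} \<le> 2" by (cases "y = a") auto
    then have "\<not> V \<subseteq> {y, a}" using n4 card_mono[of "{y, a}" V] by auto
    then obtain u where u: "u \<in> V" "u \<noteq> y" "u \<noteq> a" by blast
    have nyu: "\<not> adjacent A y u" using only u by (auto simp: adjacent_def)
    have "arcs A y (V - {a, y}) = 0" by (rule arcs_0I) (use only in blast)
    moreover have "arcs A y {y} = 0" by (rule arcs_0I) simp
    moreover have "arcs A y {a, y} \<le> 2 + arcs A y {y}" by (cases "a = y") (auto simp: arcs_insert)
    moreover have "deg V A y = arcs A y {a, y} + arcs A y (V - {a, y})"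
      using arcV[OF a] by (intro deg_split) auto
    ultimately have dy: "deg V A y \<le> 2" by simp
    have "arcs A u {y} = 0" using nyu by (auto intro!: arcs_0I simp: adjacent_def)
    then have "deg V A u = arcs A u (V - {y})" using deg_split[of "{y}" u] C(3) by simp
    moreover have "arcs A u (V - {y}) + 2 \<le> 2 * card (V - {y})" using u by (intro arcs_le_minus) auto
    ultimately have "deg V A u + 4 \<le> 2 * card V" using C(3) n4 by (simp add: card_Diff_singleton)
    then show False using not_mate[OF C(3) u(1) _ nyu] False u dy by auto
  qed
qed

section \<open>Hamiltonicity\<close>

lemma cyc_subset_V: "cyc A C \<Longrightarrow> set C \<subseteq> V"
proof
  fix x assume C: "cyc A C" and "x \<in> set C"
  then obtain xs ys where "C = xs @ x # ys" by (metis split_list)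
  then have "cyc A ((x # ys) @ xs)" using cyc_rotate[of A xs "x # ys"] C by simp
  then have "A (last ((x # ys) @ xs)) x" by (simp add: cyc_def)
  then show "x \<in> V" using arcV by blast
qed

lemma ex_cyc: "\<exists>C. cyc A C"
proof -
  obtain x where x: "x \<in> V" using n4 by fastforce
  obtain y where y: "A x y" using outdeg_pos[OF x] unfolding outdeg_def
    by (metis (mono_tags, lifting) Collect_empty_eq card.empty not_one_le_zero)
  have "A\<^sup>*\<^sup>* y x" "y \<noteq> x" using strong x y arcV irr by (auto simp: strongly_connected_def)
  then obtain ys where "ys \<noteq> []" "hd ys = y" "distinct ys" "successively A ys" "set ys \<inter> {x} = {}" "A (last ys) x"
    using path_into_set[of A y x "{x}"] by auto
  then have "cyc A (ys @ [x])" using y by (auto simp: cyc_def successively_append_iff)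
  then show ?thesis by blast
qed

text \<open>If an in-neighbour of the first vertex of \<open>us\<close> were followed on
  \<open>D\<close> by an out-neighbour of the last one, the whole path would fit between them and
  lengthen \<open>D\<close>.\<close>

lemma cyc_insert_pred_bound:
  assumes D: "cyc A D" and max: "\<forall>D'. cyc A D' \<longrightarrow> length D' \<le> length D"
    and us: "us \<noteq> []" "distinct us" "successively A us" "set us \<inter> set D = {}"
  shows "arcs_in A (hd us) (set D) + arcs_out A (last us) (set D) \<le> length D"
  unfolding arcs_in_def arcs_out_def
proof (rule cyclic_slot_bound)
  show "distinct D" "D \<noteq> []" using D by (auto simp: cyc_def)
  show "\<not> (A c (hd us) \<and> A (last us) d)" if Deq: "D = xs @ c # d # ys" for xs c d ys
  proof
    assume a: "A c (hd us) \<and> A (last us) d"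
    have "cyc A (xs @ c # us @ d # ys)"
      by (rule cyc_insert_path) (use D us a Deq in simp_all)
    then have "length (xs @ c # us @ d # ys) \<le> length D" using max by blast
    then show False using us(1) Deq by simp
  qed
  show "\<not> (A (last D) (hd us) \<and> A (last us) (hd D))"
  proof
    assume "A (last D) (hd us) \<and> A (last us) (hd D)"
    then have "cyc A (D @ us)" by (intro cyc_append_path D us) auto
    then have "length (D @ us) \<le> length D" using max by blast
    then show False using us(1) by simp
  qed
qed

lemma longest_arcs:
  assumes "cyc A D" "\<forall>D'. cyc A D' \<longrightarrow> length D' \<le> length D" "u \<notin> set D"
  shows "arcs A u (set D) \<le> length D"
  using cyc_insert_pred_bound[OF assms(1,2), of "[u]"] assms(3) by (simp add: arcs_def)

section \<open>Two mates that can be exchanged on a longest cycle\<close>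

lemma card_disjoint_le:
  assumes "finite W" "\<forall>x\<in>W. \<not> (P x \<and> Q x)"
  shows "card {x \<in> W. P x} + card {x \<in> W. Q x} \<le> card W"
proof -
  have "card {x \<in> W. P x} + card {x \<in> W. Q x} = card ({x \<in> W. P x} \<union> {x \<in> W. Q x})"
    using assms by (intro card_Un_disjoint[symmetric]) auto
  also have "\<dots> \<le> card W" using assms by (intro card_mono) auto
  finally show ?thesis .
qed

text \<open>Inserting the path \<open>z, w\<close> into a longest cycle on \<open>D0 \<union> {y}\<close> bounds the in-degree of \<open>z\<close> plus the
  out-degree of \<open>w\<close> from above, while the condition on the pair \<open>y, w\<close> gives a lower bound for \<open>y\<close>.\<close>

lemma twin_step:
  assumes C': "cyc A C'" "\<forall>D'. cyc A D' \<longrightarrow> length D' \<le> length C'" "set C' = insert y D0"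
    and yz: "y \<notin> D0" "z \<notin> D0" "mate y z"
    and W: "W = V - D0 - {y, z}" "w \<in> W" "A z w"
    and F: "\<not> A w y" "\<forall>w'\<in>W. \<not> (A w w' \<and> A w' y)"
  shows "arcs_in A z D0 + 1 \<le> arcs_in A y D0"
proof -
  have yzV: "y \<in> V" "z \<in> V" "y \<noteq> z" and nyz: "\<not> A y z" "\<not> A z y"
    using yz(3) by (auto simp: mate_def adjacent_def)
  have D0V: "D0 \<subseteq> V" using cyc_subset_V[OF C'(1)] C'(3) by blast
  then have fD0: "finite D0" using finite_subset fin by blast
  have fW: "finite W" using W(1) by simp
  have Veq: "V = insert y (insert z (D0 \<union> W))" using W(1) D0V yzV by blast
  have disj: "D0 \<inter> W = {}" "y \<notin> insert z (D0 \<union> W)" "z \<notin> D0 \<union> W" using W(1) yz yzV by auto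
  have "card V = card D0 + card W + 2"
    using Veq disj fD0 fW by (simp add: card_Un_disjoint)
  moreover have "length C' = card D0 + 1"
    using C'(1,3) yz(1) fD0 distinct_card[of C'] by (auto simp: cyc_def)
  moreover have "indeg V A y = arcs_in A y D0 + arcs_in A y W"
    unfolding indeg_conv by (subst Veq) (use disj fD0 fW nyz in \<open>simp add: arcs_in_insert arcs_in_Un\<close>)
  moreover have "outdeg V A w = arcs_out A w D0 + of_bool (A w z) + arcs_out A w W"
    unfolding outdeg_conv by (subst Veq) (use disj fD0 fW F in \<open>simp add: arcs_out_insert arcs_out_Un\<close>)
  moreover have "arcs_in A y W + arcs_out A w W + 1 \<le> card W"
  proof -
    have "arcs_in A y W = arcs_in A y (W - {w})" "arcs_out A w W = arcs_out A w (W - {w})"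
      using F(1) irr[of w] unfolding arcs_in_def arcs_out_def by (metis (no_types, lifting) DiffD1 DiffI singletonD)+
    moreover have "arcs_in A y (W - {w}) + arcs_out A w (W - {w}) \<le> card (W - {w})"
      unfolding arcs_in_def arcs_out_def by (rule card_disjoint_le) (use fW F(2) in auto)
    moreover have "card W = Suc (card (W - {w}))" using W(2) fW by (metis card.remove)
    ultimately show ?thesis by simp
  qed
  moreover have "arcs_in A z D0 + arcs_out A w D0 \<le> length C'"
  proof -
    have zw: "z \<noteq> w" using W(3) irr by auto
    have "arcs_in A (hd [z, w]) (set C') + arcs_out A (last [z, w]) (set C') \<le> length C'"
      by (rule cyc_insert_pred_bound[OF C'(1,2)]) (use W yz yzV zw in \<open>auto simp: C'(3)\<close>)
    then show ?thesis unfolding C'(3) using yz(1) fD0 nyz F(1) by (simp add: arcs_in_insert arcs_out_insert)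
  qed
  moreover have "card V \<le> indeg V A y + outdeg V A w"
    by (rule mate_in[OF yz(3)]) (use W F(1) in auto)
  ultimately show ?thesis by (auto simp: of_bool_def split: if_splits)
qed

text \<open>Since \<open>C'\<close> is also a longest cycle and misses \<open>z\<close>, d(z) is at
  most |C|, while \<open>w\<close> has degree at most |C|+2r-2 with r = n-|C|. Now \<open>z\<close>
  has the two non-neighbours \<open>y\<close> and \<open>w\<close>, and the inequality of
  \<open>matching\<close> falls short by two.\<close>

lemma twin_no_arcs:
  assumes C: "cyc A C" "\<forall>D'. cyc A D' \<longrightarrow> length D' \<le> length C" "y \<notin> set C" "z \<in> set C"
    and C': "cyc A C'" "length C' = length C" "set C' = insert y (set C - {z})"
    and yz: "mate y z"
    and W: "W = V - set C - {y}" "w \<in> W" "\<forall>w\<in>W. \<not> A z w \<and> \<not> A w z"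
  shows False
proof -
  define r where "r = card (V - set C)"
  have yzV: "y \<in> V" "z \<in> V" "y \<noteq> z" "mate z y" using yz mate_sym by (auto simp: mate_def)
  have n: "card V = length C + r"
    unfolding r_def using V_split[OF cyc_subset_V[OF C(1)]] C(1) by (simp add: cyc_def distinct_card)
  have w: "w \<in> V" "w \<noteq> y" "w \<notin> set C" "w \<noteq> z" using W C by auto
  have "deg V A z = arcs A z (set C') + arcs A z (V - set C')"
    by (rule deg_split[OF cyc_subset_V[OF C'(1)]])
  moreover have "V - set C' = insert z W" using C'(3) W(1) C(3,4) yzV by auto
  moreover have "arcs A z (insert z W) = 0" by (rule arcs_0I) (use W(3) in auto)
  moreover have "arcs A z (set C') \<le> length C'"
    by (rule longest_arcs[OF C'(1)]) (use C' C(2) yzV in auto)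
  ultimately have dz: "deg V A z \<le> length C" using C'(2) by simp
  have "deg V A w = arcs A w (set C) + arcs A w (V - set C)"
    by (rule deg_split[OF cyc_subset_V[OF C(1)]])
  moreover have "arcs A w (set C) \<le> length C" by (rule longest_arcs[OF C(1,2) w(3)])
  moreover have "arcs A w (V - set C) + 2 \<le> 2 * r"
    unfolding r_def by (rule arcs_le_minus) (use w in auto)
  ultimately have "deg V A w + 2 \<le> length C + 2 * r" by simp
  moreover have "6 * card V \<le> 2 * (deg V A z + deg V A y) + (deg V A z + deg V A w) + 4"
    by (rule matching) (use yzV w W(2,3) yz in \<open>auto simp: mate_def adjacent_def\<close>)
  moreover have "deg V A z + deg V A y + 2 \<le> 2 * card V" using yz by (simp add: mate_def)
  ultimately show False using dz n by simp
qed

text \<open>Within \<open>W\<close>, \<open>y\<close> only sends arcs and \<open>z\<close> only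
  receives them, and they share no vertex there, so d(y)+d(z) <= 2|C|+|W|. The out-neighbour
  \<open>w\<close> of \<open>y\<close> is a second non-neighbour of \<open>z\<close>, and
  \<open>matching\<close> fails.\<close>

lemma twin_cross:
  assumes C: "cyc A C" "\<forall>D'. cyc A D' \<longrightarrow> length D' \<le> length C" "y \<notin> set C" "z \<in> set C"
    and C': "cyc A C'" "length C' = length C" "set C' = insert y (set C - {z})"
    and yz: "mate y z"
    and W: "W = V - set C - {y}" "w \<in> W" "A y w" "\<forall>w\<in>W. \<not> A w y" "\<forall>w\<in>W. \<not> A z w"
    and F: "\<forall>w\<in>W. \<not> (A y w \<and> A w z)"
  shows False
proof -
  define r where "r = card (V - set C)"
  have yzV: "y \<in> V" "z \<in> V" "y \<noteq> z" "mate z y" and nyz: "\<not> A y z" "\<not> A z y"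
    using yz mate_sym by (auto simp: mate_def adjacent_def)
  have n: "card V = length C + r"
    unfolding r_def using V_split[OF cyc_subset_V[OF C(1)]] C(1) by (simp add: cyc_def distinct_card)
  have cW: "card W + 1 = r" unfolding r_def W(1) using C(3) yzV
    by (metis Diff_iff Suc_eq_plus1 card_Suc_Diff1 fin finite_Diff)
  have w: "w \<in> V" "w \<noteq> y" "w \<notin> set C" "w \<noteq> z" using W C by auto
  have fW: "finite W" using W(1) by simp
  have "deg V A z = arcs A z (set C') + arcs A z (V - set C')"
    by (rule deg_split[OF cyc_subset_V[OF C'(1)]])
  moreover have "V - set C' = insert z W" "z \<notin> W" using C'(3) W(1) C(3,4) yzV by auto
  moreover have "{x \<in> W. A z x} = {}" using W(5) by blast
  then have "arcs A z W = arcs_in A z W" by (simp only: arcs_def arcs_out_def) simp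
  moreover have "arcs A z (set C') \<le> length C'"
    by (rule longest_arcs[OF C'(1)]) (use C' C(2) yzV in auto)
  ultimately have dz: "deg V A z \<le> length C + arcs_in A z W" using C'(2) fW by (simp add: arcs_insert)
  have "deg V A y = arcs A y (set C) + arcs A y (V - set C)"
    by (rule deg_split[OF cyc_subset_V[OF C(1)]])
  moreover have "V - set C = insert y W" "y \<notin> W" using W(1) C(3,4) yzV by auto
  moreover have "{x \<in> W. A x y} = {}" using W(4) by blast
  then have "arcs A y W = arcs_out A y W" by (simp only: arcs_def arcs_in_def) simp
  moreover have "arcs A y (set C) \<le> length C" by (rule longest_arcs[OF C(1-3)])
  ultimately have dy: "deg V A y \<le> length C + arcs_out A y W" using fW by (simp add: arcs_insert)
  have sum: "arcs_out A y W + arcs_in A z W \<le> card W"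
    unfolding arcs_out_def arcs_in_def by (rule card_disjoint_le[OF fW F])
  have "deg V A w = arcs A w (set C) + arcs A w (V - set C)"
    by (rule deg_split[OF cyc_subset_V[OF C(1)]])
  moreover have "arcs A w (set C) \<le> length C" by (rule longest_arcs[OF C(1,2) w(3)])
  moreover have "arcs A w (V - set C) + 2 \<le> 2 * r"
    unfolding r_def by (rule arcs_le_minus) (use w in auto)
  ultimately have "deg V A w + 2 \<le> length C + 2 * r" by simp
  moreover have "6 * card V \<le> 2 * (deg V A z + deg V A y) + (deg V A z + deg V A w) + 4"
    by (rule matching) (use yzV w W F nyz in \<open>auto simp: adjacent_def\<close>)
  ultimately show False using dz dy sum n cW by simp
qed

text \<open>If both sent arcs into \<open>W\<close>, \<open>twin_step\<close> would apply in both
  directions, with \<open>C\<close> and \<open>C'\<close> exchanged; each would have fewer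
  in-neighbours than the other on the common part \<open>D0\<close>.\<close>

lemma twin_not_both:
  assumes C: "cyc A C" "\<forall>D'. cyc A D' \<longrightarrow> length D' \<le> length C" "y \<notin> set C" "z \<in> set C"
    and C': "cyc A C'" "length C' = length C" "set C' = insert y (set C - {z})"
    and yz: "mate y z"
    and W: "W = V - set C - {y}"
    and F: "\<forall>w\<in>W. \<not> (A y w \<and> A w z)" "\<forall>w\<in>W. \<not> (A z w \<and> A w y)"
    and F2: "\<forall>w\<in>W. \<forall>w'\<in>W. \<not> (A y w \<and> A w w' \<and> A w' z)" "\<forall>w\<in>W. \<forall>w'\<in>W. \<not> (A z w \<and> A w w' \<and> A w' y)"
  shows "\<not> ((\<exists>w\<in>W. A y w) \<and> (\<exists>w\<in>W. A z w))"
proof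
  assume "(\<exists>w\<in>W. A y w) \<and> (\<exists>w\<in>W. A z w)"
  then obtain w1 w2 where w: "w1 \<in> W" "A y w1" "w2 \<in> W" "A z w2" by blast
  define D0 where "D0 = set C - {z}"
  have "y \<noteq> z" using yz by (simp add: mate_def)
  have W': "W = V - D0 - {y, z}" "W = V - D0 - {z, y}" unfolding W D0_def using C(4) by auto
  have nD: "y \<notin> D0" "z \<notin> D0" "set C = insert z D0" using C(3,4) by (auto simp: D0_def)
  have "arcs_in A z D0 + 1 \<le> arcs_in A y D0"
    by (rule twin_step[OF C'(1) _ _ nD(1,2) yz W'(1) w(3,4)])
      (use C' C(2) D0_def F F2 w in auto)
  moreover have "arcs_in A y D0 + 1 \<le> arcs_in A z D0"
    by (rule twin_step[OF C(1,2) nD(3) nD(2,1) _ W'(2) w(1,2)])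
      (use yz mate_sym F F2 w in auto)
  ultimately show False by simp
qed

text \<open>By \<open>twin_not_both\<close> and its mirror image at most one of \<open>y\<close>,
  \<open>z\<close> sends arcs into \<open>W\<close> and at most one receives arcs from it, whereas
  \<open>twin_no_arcs\<close> gives each of them some arc with \<open>W\<close>. So one only sends
  and the other only receives, which is the case of \<open>twin_cross\<close>. A detour skipping as
  little as possible will guarantee the forbidden short paths through \<open>W\<close>.\<close>

lemma twin:
  assumes C: "cyc A C" "\<forall>D'. cyc A D' \<longrightarrow> length D' \<le> length C" "y \<notin> set C" "z \<in> set C"
    and C': "cyc A C'" "length C' = length C" "set C' = insert y (set C - {z})"
    and yz: "mate y z"
    and W: "W = V - set C - {y}" "W \<noteq> {}"
    and F: "\<forall>w\<in>W. \<not> (A y w \<and> A w z)" "\<forall>w\<in>W. \<not> (A z w \<and> A w y)"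
    and F2: "\<forall>w\<in>W. \<forall>w'\<in>W. \<not> (A y w \<and> A w w' \<and> A w' z)" "\<forall>w\<in>W. \<forall>w'\<in>W. \<not> (A z w \<and> A w w' \<and> A w' y)"
  shows False
proof -
  have yzn: "y \<noteq> z" "y \<in> V" "z \<in> V" "mate z y" using yz mate_sym by (auto simp: mate_def)
  have max': "\<forall>D'. cyc A D' \<longrightarrow> length D' \<le> length C'" using C(2) C'(2) by simp
  have CC: "z \<notin> set C'" "y \<in> set C'" "length C = length C'" "set C = insert z (set C' - {y})"
    "W = V - set C' - {z}"
    using C C' W(1) yzn by auto
  obtain w where w: "w \<in> W" using W(2) by blast
  interpret d: bypass_free V "\<lambda>x y. A y x" by (rule dual)
  have dcyc: "cyc (\<lambda>x y. A y x) D \<longleftrightarrow> cyc A (rev D)" for D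
    by (auto simp: cyc_def successively_rev hd_rev last_rev)
  have dmate: "d.mate y z"
  proof -
    have "deg V (\<lambda>x y. A y x) = deg V A" by (auto simp: deg_def outdeg_def indeg_def)
    then show ?thesis using yz by (auto simp: d.mate_def mate_def adjacent_def)
  qed
  have out: "\<not> ((\<exists>w\<in>W. A y w) \<and> (\<exists>w\<in>W. A z w))"
    by (rule twin_not_both[OF C C' yz W(1) F F2])
  have inn: "\<not> ((\<exists>w\<in>W. A w y) \<and> (\<exists>w\<in>W. A w z))"
  proof (rule d.twin_not_both[of "rev C" y z "rev C'"])
    show "\<forall>D'. cyc (\<lambda>x y. A y x) D' \<longrightarrow> length D' \<le> length (rev C)"
      using C(2) by (metis dcyc length_rev)
  qed (use C C' dmate W(1) F F2 in \<open>auto simp: dcyc\<close>)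
  have z: "\<exists>w\<in>W. A z w \<or> A w z"
    using twin_no_arcs[OF C C' yz W(1) w] by blast
  have y: "\<exists>w\<in>W. A y w \<or> A w y"
    using twin_no_arcs[OF C'(1) max' CC(1,2) C(1) CC(3,4) yzn(4) CC(5) w] by blast
  consider "\<exists>w\<in>W. A y w" "\<forall>w\<in>W. \<not> A w y" "\<forall>w\<in>W. \<not> A z w"
    | "\<exists>w\<in>W. A z w" "\<forall>w\<in>W. \<not> A w z" "\<forall>w\<in>W. \<not> A y w"
    using out inn y z by blast
  then show False
  proof cases
    case 1
    then obtain w' where w': "w' \<in> W" "A y w'" by blast
    show False by (rule twin_cross[OF C C' yz W(1) w' 1(2,3) F(1)])
  next
    case 2
    then obtain w' where w': "w' \<in> W" "A z w'" by blast
    show False by (rule twin_cross[OF C'(1) max' CC(1,2) C(1) CC(3,4) yzn(4) CC(5) w' 2(2,3) F(2)])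
  qed
qed

section \<open>Longest cycles and shortest detours\<close>

lemma longest_cycle:
  obtains C where "cyc A C" "\<forall>D. cyc A D \<longrightarrow> length D \<le> length C"
proof -
  obtain C0 where C0: "cyc A C0" using ex_cyc by blast
  have "\<exists>C. cyc A C \<and> (\<forall>D. cyc A D \<longrightarrow> length D \<le> length C)"
  proof (rule ex_has_greatest_nat[of "cyc A" C0 length "card V + 1"])
    show "\<forall>D. cyc A D \<longrightarrow> length D < card V + 1"
    proof (intro allI impI)
      fix D assume D: "cyc A D"
      then have "length D = card (set D)" by (simp add: cyc_def distinct_card)
      also have "\<dots> \<le> card V" by (rule card_mono[OF fin cyc_subset_V[OF D]])
      finally show "length D < card V + 1" by simp
    qed
  qed (rule C0)
  then show ?thesis using that by blast
qed

text \<open>A longest cycle \<open>Q @ G\<close> together with a detour \<open>ys\<close> off the cycle that skips \<open>G\<close>;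
  \<open>Q\<close> may be a single vertex.\<close>

definition detour :: "'a list \<Rightarrow> 'a list \<Rightarrow> 'a list \<Rightarrow> bool" where
  "detour Q G ys \<longleftrightarrow> cyc A (Q @ G) \<and> (\<forall>D. cyc A D \<longrightarrow> length D \<le> length (Q @ G)) \<and> Q \<noteq> [] \<and> ys \<noteq> []
    \<and> distinct ys \<and> set ys \<inter> set (Q @ G) = {} \<and> successively A ys \<and> A (last Q) (hd ys) \<and> A (last ys) (hd Q)"

lemma ex_detour:
  assumes nh: "\<forall>C. cyc A C \<longrightarrow> set C \<noteq> V"
  shows "\<exists>Q G ys. detour Q G ys"
proof -
  obtain C where C: "cyc A C" "\<forall>D. cyc A D \<longrightarrow> length D \<le> length C" by (rule longest_cycle)
  have CV: "set C \<subseteq> V" "set C \<noteq> V" "C \<noteq> []" using cyc_subset_V[OF C(1)] nh C(1) by (auto simp: cyc_def)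
  then obtain w v where w: "w \<in> V" "w \<notin> set C" and v: "v \<in> set C" "v \<in> V" by (metis hd_in_set subsetD subset_antisym subsetI)
  have "A\<^sup>*\<^sup>* v w" using strong w v by (auto simp: strongly_connected_def)
  then have "(\<lambda>x y. A y x)\<^sup>*\<^sup>* w v"
    using rtranclp_conversep[of A] by (simp add: conversep_iff[abs_def])
  moreover have "w \<notin> set C" "v \<in> set C" by fact+
  ultimately have "\<exists>c y. c \<in> set C \<and> y \<notin> set C \<and> A c y"
    by (induction rule: converse_rtranclp_induct) blast+
  then obtain c y where cy: "c \<in> set C" "y \<notin> set C" "A c y" by blast
  then have "A\<^sup>*\<^sup>* y v" using strong v arcV by (auto simp: strongly_connected_def)
  from path_into_set[OF this cy(2) v(1)]
  obtain ys x where ys: "ys \<noteq> []" "hd ys = y" "distinct ys" "successively A ys" "set ys \<inter> set C = {}"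
    "x \<in> set C" "A (last ys) x" by blast
  obtain X Y where XY: "C = X @ x # Y" using ys(6) by (metis split_list)
  \<comment> \<open>The list starts where the detour returns, so \<open>c\<close>, where it leaves,
    ends the first part and the rest is what it skips.\<close>
  define C1 where "C1 = x # Y @ X"
  have C1: "cyc A C1" "set C1 = set C" "length C1 = length C"
    using cyc_rotate[of A X "x # Y"] C(1) XY by (auto simp: C1_def)
  have "c \<in> set C1" using cy(1) C1(2) by simp
  then obtain M N where MN: "C1 = M @ c # N" by (metis split_list)
  have "hd (M @ [c]) = x" using MN C1_def by (cases M) auto
  then have "detour (M @ [c]) N ys"
    unfolding detour_def using C1 C(2) MN ys cy by auto
  then show ?thesis by blast
qed

text \<open>Leaving at the end of \<open>Q\<close> and returning already at \<open>z\<close> would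
  skip only \<open>G1\<close>.\<close>

lemma detour_short_in:
  assumes D: "detour Q (G1 @ z # G2) ys"
    and min: "\<forall>Q' G' ys'. detour Q' G' ys' \<longrightarrow> length (G1 @ z # G2) \<le> length G'"
    and us: "us \<noteq> []" "distinct us" "set us \<inter> set (Q @ G1 @ z # G2) = {}" "successively A us" "A (last Q) (hd us)"
  shows "\<not> A (last us) z"
proof
  assume a: "A (last us) z"
  have "cyc A ((z # G2 @ Q) @ G1)" using D cyc_rotate[of A "Q @ G1" "z # G2"] by (simp add: detour_def)
  then have "detour (z # G2 @ Q) G1 us"
    using D us a unfolding detour_def by auto
  then show False using min by fastforce
qed

lemma detour_short_out:
  assumes D: "detour Q (G1 @ z # G2) ys"
    and min: "\<forall>Q' G' ys'. detour Q' G' ys' \<longrightarrow> length (G1 @ z # G2) \<le> length G'"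
    and us: "us \<noteq> []" "distinct us" "set us \<inter> set (Q @ G1 @ z # G2) = {}" "successively A us" "A (last us) (hd Q)"
  shows "\<not> A z (hd us)"
proof
  assume a: "A z (hd us)"
  have "detour (Q @ G1 @ [z]) G2 us"
    using D us a unfolding detour_def by auto
  then show False using min by fastforce
qed

text \<open>A detour with shortest \<open>G\<close> has no arcs between \<open>ys\<close> and
  \<open>G\<close>. As many vertices of \<open>G\<close> as possible are moved into
  \<open>Q\<close>; the cycle through the result and \<open>ys\<close> is no longer than
  \<open>C\<close>, so some vertices are stuck, at least as many as \<open>ys\<close> has. All of
  them are mates of the first vertex \<open>y\<close> of \<open>ys\<close>, hence there is only one,
  \<open>z\<close>, and \<open>ys\<close> is \<open>y\<close> alone. Exchanging \<open>z\<close> for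
  \<open>y\<close> gives another longest cycle, and \<open>twin\<close> applies, or
  \<open>omitting_cycle_hamiltonian\<close> if nothing else lies off the cycle.\<close>

theorem hamiltonian: "\<exists>C. cyc A C \<and> set C = V"
proof (rule ccontr)
  assume "\<nexists>C. cyc A C \<and> set C = V"
  then have nh: "\<forall>C. cyc A C \<longrightarrow> set C \<noteq> V" by blast
  let ?P = "\<lambda>(Q, G, ys). detour Q G ys"
  obtain Q0 G0 ys0 where "?P (Q0, G0, ys0)" using ex_detour[OF nh] by auto
  from ex_has_least_nat[of ?P, OF this, of "\<lambda>(Q, G, ys). length G"]
  obtain Q G ys where D: "detour Q G ys" and min: "\<forall>Q' G' ys'. detour Q' G' ys' \<longrightarrow> length G \<le> length G'"
    by auto
  define C where "C = Q @ G"
  have C: "cyc A C" "\<forall>D. cyc A D \<longrightarrow> length D \<le> length C" and Q: "Q \<noteq> []" "distinct Q" "successively A Q"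
    and G: "set Q \<inter> set G = {}" "distinct G"
    and ys: "ys \<noteq> []" "distinct ys" "successively A ys" "set ys \<inter> set C = {}" "A (last Q) (hd ys)" "A (last ys) (hd Q)"
    using D by (auto simp: detour_def C_def cyc_def successively_append_iff)
  have CV: "set C \<subseteq> V" by (rule cyc_subset_V[OF C(1)])
  have short_in: "\<not> A (last us) z" if zz: "z \<in> set G" and us: "us \<noteq> []" "distinct us" "set us \<inter> set C = {}" "successively A us" "A (last Q) (hd us)" for z us
  proof -
    obtain G1 G2 where G12: "G = G1 @ z # G2" using split_list[OF zz] by blast
    show ?thesis by (rule detour_short_in[OF D[unfolded G12] min[unfolded G12]]) (use us G12 C_def in auto)
  qed
  have short_out: "\<not> A z (hd us)" if zz: "z \<in> set G" and us: "us \<noteq> []" "distinct us" "set us \<inter> set C = {}" "successively A us" "A (last us) (hd Q)" for z us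
  proof -
    obtain G1 G2 where G12: "G = G1 @ z # G2" using split_list[OF zz] by blast
    show ?thesis by (rule detour_short_out[OF D[unfolded G12] min[unfolded G12]]) (use us G12 C_def in auto)
  qed
  have nadj: "\<not> A v z" "\<not> A z v" if z: "z \<in> set G" and v: "v \<in> set ys" for z v
  proof -
    obtain y1 y2 where y12: "ys = y1 @ v # y2" using split_list[OF v] by blast
    have "hd (y1 @ [v]) = hd ys" "last (v # y2) = last ys" unfolding y12 by (cases y1) auto
    then show "\<not> A v z" "\<not> A z v"
      using short_in[OF z, of "y1 @ [v]"] short_out[OF z, of "v # y2"] ys y12
      by (auto simp: successively_append_iff)
  qed
  define y where "y = hd ys"
  have y: "y \<in> set ys" "y \<notin> set C" "y \<in> V" "A (last Q) y"
    using ys arcV by (auto simp: y_def disjoint_iff)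
  have tl: "successively A (w # ys)" if "A w y" for w
    using that ys by (simp add: successively_Cons y_def)
  have F1: "\<not> (A y w \<and> A w z)" if z: "z \<in> set G" and w: "w \<notin> set C" for w z
  proof
    assume a: "A y w \<and> A w z"
    then have "w \<notin> set ys" using nadj z by blast
    then have "w \<noteq> y" using y(1) by auto
    then show False using short_in[OF z, of "[y, w]"] a w y by auto
  qed
  have F1': "\<not> (A z w \<and> A w y)" if z: "z \<in> set G" and w: "w \<notin> set C" for w z
  proof
    assume a: "A z w \<and> A w y"
    then have "w \<notin> set ys" using nadj z by blast
    then show False using short_out[OF z, of "w # ys"] a w ys tl[of w] by auto
  qed
  obtain Q' S' where Q': "S' \<subseteq> set G" "Q' \<noteq> []" "distinct Q'" "successively A Q'" "hd Q' = hd Q"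
    "last Q' = last Q" "set Q' = set Q \<union> (set G - S')" "\<forall>u\<in>S'. \<not> slot A u Q'"
    using greedy_insert[OF _ Q G(1)] by auto
  have fS: "finite S'" using Q'(1) finite_subset by blast
  have lQ': "length Q' + card S' = length C"
  proof -
    have "length Q' = card (set Q')" using distinct_card[OF Q'(3)] by simp
    also have "\<dots> = length Q + card (set G - S')"
      unfolding Q'(7) using G(1) Q(2) by (subst card_Un_disjoint) (auto simp: distinct_card)
    finally show ?thesis
      using Q'(1) fS card_mono[OF _ Q'(1)] distinct_card[OF G(2)] by (simp add: card_Diff_subset C_def)
  qed
  have cSG: "card S' \<le> length G" using card_mono[OF _ Q'(1)] distinct_card[OF G(2)] by simp
  have cycQ': "cyc A (Q' @ ys)"
    using Q' ys Q G C_def by (auto simp: cyc_def successively_append_iff)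
  have "length (Q' @ ys) \<le> length C" using C(2) cycQ' by blast
  then have lys: "length ys \<le> card S'" using lQ' by simp
  \<comment> \<open>\<open>y\<close> has at most |Q|+1 arcs with \<open>Q\<close> and none with
    \<open>G\<close>; \<open>z\<close> has at most |Q'|+1 with \<open>Q'\<close> and 2|S'|-2 with
    \<open>S'\<close>; both together have at most 2|R|-2 with the outside \<open>R\<close>. Since
    |S'| <= |G|, the sum is at most 2n-2.\<close>
  have bad: "mate y z" if z: "z \<in> S'" for z
  proof -
    have zG: "z \<in> set G" "z \<in> set C" using z Q'(1) C_def by auto
    define R where "R = V - set C"
    have R: "finite R" "y \<in> R" using y by (auto simp: R_def)
    have n: "card V = length C + card R"
      unfolding R_def using V_split[OF CV] C(1) by (simp add: cyc_def distinct_card)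
    have sC: "set C = set Q \<union> set G" by (simp add: C_def)
    have "deg V A y = arcs A y (set C) + arcs A y R" unfolding R_def by (rule deg_split[OF CV])
    moreover have "arcs A y (set C) = arcs A y (set Q) + arcs A y (set G)"
      unfolding sC by (rule arcs_Un) (use G in auto)
    moreover have "arcs A y (set G) = 0" by (rule arcs_0I) (use nadj y(1) in blast)
    moreover have "arcs A y (set Q) \<le> length Q + 1"
    proof -
      have "\<not> slot A y Q"
      proof
        assume "slot A y Q"
        then obtain xs c d zs where s: "Q = xs @ c # d # zs" "A c y" "A y d" by (auto simp: slot_def)
        have "cyc A (xs @ c # y # d # (zs @ G))"
          by (rule cyc_insert) (use C(1) s y(2) C_def in auto)
        then have "length (xs @ c # y # d # (zs @ G)) \<le> length C" using C(2) by blast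
        then show False using s C_def by simp
      qed
      then show ?thesis using no_slot_arcs[OF Q(2,1), of A y]
        by (cases "A (last Q) y"; cases "A y (hd Q)") auto
    qed
    moreover have "deg V A z = arcs A z (set C) + arcs A z R" unfolding R_def by (rule deg_split[OF CV])
    moreover have "arcs A z (set C) = arcs A z (set Q') + arcs A z S'"
    proof -
      have "set C = set Q' \<union> S'" "set Q' \<inter> S' = {}" using Q'(1,7) G(1) sC by auto
      then show ?thesis using arcs_Un[of "set Q'" S' A z] fS by simp
    qed
    moreover have "arcs A z (set Q') \<le> length Q' + 1"
      using no_slot_arcs[OF Q'(3,2), of A z] Q'(8) z by (cases "A (last Q') z"; cases "A z (hd Q')") auto
    moreover have "arcs A z S' + 2 \<le> 2 * card S'" by (rule arcs_le_minus[OF fS z irr])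
    moreover have "arcs A y R + arcs A z R + 2 \<le> 2 * card R"
    proof -
      have "R = insert y (R - {y})" using R by blast
      then have "arcs A u R = of_bool (A y u) + of_bool (A u y) + arcs A u (R - {y})" for u
        using arcs_insert[of "R - {y}" y A u] R(1) by simp
      then have "arcs A y R = arcs A y (R - {y})" "arcs A z R = arcs A z (R - {y})"
        using nadj[OF zG(1) y(1)] by simp_all
      moreover have "arcs_out A y (R - {y}) + arcs_in A z (R - {y}) \<le> card (R - {y})"
        unfolding arcs_out_def arcs_in_def by (rule card_disjoint_le) (use R F1[OF zG(1)] R_def in auto)
      moreover have "arcs_in A y (R - {y}) + arcs_out A z (R - {y}) \<le> card (R - {y})"
        unfolding arcs_out_def arcs_in_def by (rule card_disjoint_le) (use R F1'[OF zG(1)] R_def in auto)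
      moreover have "card R = Suc (card (R - {y}))" using R by (metis card.remove)
      ultimately show ?thesis by (simp add: arcs_def)
    qed
    ultimately have "deg V A y + deg V A z + 2 \<le> 2 * card V"
      using n lQ' cSG C_def by simp
    then show ?thesis using nadj[OF zG(1) y(1)] y zG CV by (auto simp: mate_def adjacent_def)
  qed
  have "S' \<noteq> {}" using lys ys(1) by auto
  then obtain z where z: "z \<in> S'" by blast
  have S'z: "S' = {z}" using bad z mate_unique by blast
  then have "length ys = 1" using lys ys(1) by (cases ys) auto
  then have ysy: "ys = [y]" using y_def by (cases ys) auto
  have zG: "z \<in> set G" "z \<in> set C" using z Q'(1) C_def by auto
  have C': "cyc A (Q' @ [y])" "length (Q' @ [y]) = length C" "set (Q' @ [y]) = insert y (set C - {z})"
    using cycQ' ysy lQ' S'z Q'(7) G(1) zG C_def by auto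
  define W where "W = V - set C - {y}"
  have yz: "mate y z" by (rule bad[OF z])
  show False
  proof (cases "W = {}")
    case True
    then have "set C = V - {y}" using CV y W_def by blast
    then show False using omitting_cycle_hamiltonian[of C y] nh C(1) y(3) by blast
  next
    case False
    have W: "w \<notin> set C" "w \<noteq> y" if "w \<in> W" for w using that W_def by auto
    show False
    proof (rule twin[OF C y(2) zG(2) C' yz W_def False])
      show "\<forall>w\<in>W. \<not> (A y w \<and> A w z)" using F1[OF zG(1)] W by blast
      show "\<forall>w\<in>W. \<not> (A z w \<and> A w y)" using F1'[OF zG(1)] W by blast
      show "\<forall>w\<in>W. \<forall>w'\<in>W. \<not> (A y w \<and> A w w' \<and> A w' z)"
      proof (intro ballI notI)
        fix w w' assume w: "w \<in> W" "w' \<in> W" and a: "A y w \<and> A w w' \<and> A w' z"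
        then have "w \<noteq> w'" using irr by blast
        then show False using short_in[OF zG(1), of "[y, w, w']"] a w W[of w] W[of w'] y by auto
      qed
      show "\<forall>w\<in>W. \<forall>w'\<in>W. \<not> (A z w \<and> A w w' \<and> A w' y)"
      proof (intro ballI notI)
        fix w w' assume w: "w \<in> W" "w' \<in> W" and a: "A z w \<and> A w w' \<and> A w' y"
        then have "w \<noteq> w'" using irr by blast
        then show False using short_out[OF zG(1), of "[w, w', y]"] a w W[of w] W[of w'] y ysy ys by auto
      qed
    qed
  qed
qed

end

section \<open>Vertices of large degree\<close>

lemma slot_append: "slot A u Q \<Longrightarrow> slot A u (xs @ Q @ ys)"
  unfolding slot_def by (metis append.assoc append_Cons)

lemma arcs_mono: "X \<subseteq> Y \<Longrightarrow> finite Y \<Longrightarrow> arcs A u X \<le> arcs A u Y"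
  unfolding arcs_def arcs_in_def arcs_out_def by (intro add_mono card_mono) auto

context bypass_free
begin

lemma cyc_dual: "cyc (\<lambda>x y. A y x) D \<longleftrightarrow> cyc A (rev D)"
  by (auto simp: cyc_def successively_rev hd_rev last_rev)

lemma deg_dual: "deg V (\<lambda>x y. A y x) = deg V A"
  by (auto simp: deg_def outdeg_def indeg_def)

lemma no_back: "cyc A H \<Longrightarrow> set H = V \<Longrightarrow> \<not> A (hd H) (last H)"
  using no_bypass[of H] by (auto simp: cyc_def)

lemma no_back_consec:
  assumes "cyc A (xs @ c # d # ys)" "set (xs @ c # d # ys) = V"
  shows "\<not> A d c"
proof -
  have "cyc A ((d # ys) @ (xs @ [c]))" using cyc_rotate[of A "xs @ [c]" "d # ys"] assms(1) by simp
  moreover have "set ((d # ys) @ (xs @ [c])) = V" using assms(2) by auto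
  ultimately show ?thesis using no_back by fastforce
qed

lemma high_not_omitted: "cyc A C \<Longrightarrow> set C = V - {u} \<Longrightarrow> u \<in> V \<Longrightarrow> card V \<le> deg V A u \<Longrightarrow> False"
  using omitted_degree(3) by fastforce

text \<open>Let \<open>c\<close> follow and \<open>a\<close> precede \<open>u\<close>. An arc from
  \<open>a\<close> to \<open>c\<close> closes \<open>Q\<close> to a cycle omitting \<open>u\<close>,
  whose degree is too large. If \<open>c\<close> dominates \<open>a\<close>, then \<open>u\<close>
  has no slot on \<open>Q\<close>, since inserting it would give a bypass; degree n then forces
  further arcs at \<open>u\<close>, so that cycles omit \<open>c\<close> and \<open>a\<close>. Hence
  neither has a mate and \<open>c\<close> can be put back elsewhere, after which \<open>p2\<close>
  follows \<open>u\<close>. As \<open>p2\<close> and \<open>a\<close> are non-adjacent,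
  \<open>p2\<close> has degree at least n, and yet some cycle omits it.\<close>

lemma high_neighbours:
  assumes H: "cyc A (u # Q)" "set (u # Q) = V" "card V \<le> deg V A u"
  shows "\<not> adjacent A (hd Q) (last Q)"
proof -
  have u: "u \<in> V" "u \<notin> set Q" "distinct Q" using H(1,2) by (auto simp: cyc_def)
  have sQ: "set Q = V - {u}" using H(2) u by auto
  have lQ: "length Q + 1 = card V"
    using H(1,2) distinct_card[of "u # Q"] by (simp add: cyc_def)
  obtain c L where Q: "Q = c # L" using lQ n4 by (cases Q) auto
  have "length L \<ge> 2" using lQ n4 Q by simp
  then obtain p2 L' where L: "L = p2 # L'" "L' \<noteq> []" by (cases L; cases "tl L") auto
  obtain L'' a where L'': "L' = L'' @ [a]" using L(2) by (metis append_butlast_last_id)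
  define L0 where "L0 = p2 # L''"
  have La: "L = L0 @ [a]" and L0: "L0 \<noteq> []" "hd L0 = p2" using L L'' by (auto simp: L0_def)
  have "A c p2" using H(1) unfolding Q L by (auto simp: cyc_def)
  moreover have "A u c" "A a u" "successively A Q"
    using H(1) Q La by (auto simp: cyc_def successively_Cons)
  ultimately have arcs1: "A u c" "A a u" "successively A Q" "A c p2" by blast+
  have "\<not> A p2 c" by (rule no_back_consec[of "[u]" c p2 L']) (use H(1,2) Q L(1) in auto)
  moreover have "\<not> A c u" by (rule no_back_consec[of "[]" u c L]) (use H(1,2) Q in auto)
  moreover have "\<not> A u a" using no_back[OF H(1,2)] Q La by simp
  ultimately have nback: "\<not> A c u" "\<not> A u a" "\<not> A p2 c" by blast+
  have dist: "c \<noteq> a" "c \<noteq> p2" "a \<noteq> p2" "u \<noteq> c" "u \<noteq> a" "u \<noteq> p2" "c \<notin> set L" "p2 \<notin> set L'" "a \<notin> set L0" "distinct L"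
    using H(1) unfolding Q L L'' L0_def by (auto simp: cyc_def)
  have inV: "c \<in> V" "a \<in> V" "p2 \<in> V" unfolding H(2)[symmetric] Q L L'' by auto
  have "successively A L" using arcs1(3) Q by (auto simp: successively_Cons)
  moreover from this have "successively A L'" using L by (auto simp: successively_Cons)
  moreover have "successively A L0" "A (last L0) a"
    using \<open>successively A L\<close> L0 La by (simp_all add: successively_append_iff)
  ultimately have succL: "successively A L" "successively A L'" "successively A L0" "A (last L0) a"
    by blast+
  have "\<not> A a c"
  proof
    assume "A a c"
    then have "cyc A Q" using arcs1 u Q La by (auto simp: cyc_def)
    then show False using high_not_omitted sQ u H(3) by blast
  qed
  moreover have "\<not> A c a"
  proof
    assume ca: "A c a"
    have ns: "\<not> slot A u Q"
    proof
      assume "slot A u Q"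
      then obtain Q' where Q': "distinct Q'" "successively A Q'" "Q' \<noteq> []" "hd Q' = hd Q" "last Q' = last Q"
        "set Q' = insert u (set Q)" using slot_insert[OF _ u(3) arcs1(3) u(2)] by metis
      have "set Q' = V" using Q'(6) sQ u by auto
      moreover have "A (hd Q') (last Q')" using Q' ca Q La by simp
      ultimately show False using no_bypass Q' by blast
    qed
    have ns': "\<not> slot A u L" "\<not> slot A u L'" "\<not> slot A u (c # L0)"
      using ns slot_append[of A u L "[c]" "[]"] slot_append[of A u L' "[c, p2]" "[]"]
        slot_append[of A u "c # L0" "[]" "[a]"] Q L La by auto
    have dQ: "card V \<le> arcs A u (set Q)"
      using H(3) deg_V_minus[OF u(1)] sQ by simp
    \<comment> \<open>\<open>u\<close> has at least n arcs with \<open>Q\<close>, only one of them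
      with \<open>c\<close>. Without a slot on \<open>L\<close>, it exceeds |L| = n-2 arcs there
      only if it dominates the first vertex of \<open>L\<close>.\<close>
    have up2: "A u p2"
    proof (rule ccontr)
      assume "\<not> A u p2"
      then have "arcs A u (set L) \<le> length L"
        using no_slot_arcs_le(2)[OF dist(10) _ ns'(1)] L by simp
      moreover have "arcs A u (set Q) = 1 + arcs A u (set L)"
        using Q dist(7) arcs1 nback by (simp add: arcs_insert)
      ultimately show False using dQ lQ Q by simp
    qed
    have pu: "A (last L0) u"
    proof (rule ccontr)
      assume "\<not> A (last L0) u"
      then have "arcs A u (set (c # L0)) \<le> length L0 + 1"
        using no_slot_arcs_le(3)[OF _ _ ns'(3)] u Q La L0 by simp
      moreover have "arcs A u (set Q) = 1 + arcs A u (set (c # L0))"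
      proof -
        have "set Q = insert a (set (c # L0))" "a \<notin> set (c # L0)" using Q La u by auto
        then show ?thesis using arcs1 nback by (simp add: arcs_insert del: set_simps)
      qed
      ultimately show False using dQ lQ Q La by simp
    qed
    have "last L = a" using La by simp
    moreover have "L \<noteq> []" "hd L = p2" using L(1) by auto
    moreover have "u \<notin> set L" using u(2) Q by simp
    moreover have "p2 \<in> set L" using L(1) by simp
    moreover have "a \<in> set L" using La by simp
    ultimately have pL: "p2 \<in> set L" "a \<in> set L" and LL: "L \<noteq> []" "last L = a" "hd L = p2" "u \<notin> set L" by blast+
    have cycL: "cyc A (L @ [u])" "set (L @ [u]) = V - {c}"
    proof -
      show "cyc A (L @ [u])"
        using succL(1) arcs1(2) up2 LL dist(10) by (simp add: cyc_def successively_append_iff)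
      show "set (L @ [u]) = V - {c}" unfolding H(2)[symmetric] using Q dist by auto
    qed
    have cyca: "cyc A (u # c # L0)" "set (u # c # L0) = V - {a}"
    proof -
      show "cyc A (u # c # L0)"
        using succL(3) arcs1(1,4) pu L0 dist u(2,3) unfolding Q La
        by (auto simp: cyc_def successively_Cons)
      show "set (u # c # L0) = V - {a}" unfolding H(2)[symmetric] using Q La dist by auto
    qed
    note hc = omitted_degree[OF cycL inV(1)] and ha = omitted_degree[OF cyca inV(2)]
    \<comment> \<open>The cycles omitting \<open>c\<close> and \<open>a\<close> bound d^-(c) and
      d^+(a) by (n-1)/2 each, but with the arc from \<open>a\<close> to \<open>c\<close> missing a
      mate would require their sum to be at least n.\<close>
    have cm: "\<not> mate c y" for y
    proof
      assume m: "mate c y"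
      then have "a \<noteq> y" using ca by (auto simp: mate_def adjacent_def)
      from mate_in[OF m inV(2) _ this \<open>\<not> A a c\<close>] show False using hc(2) ha(1) dist by simp
    qed
    have am: "\<not> mate a y" for y
    proof
      assume m: "mate a y"
      then have "c \<noteq> y" using ca by (auto simp: mate_def adjacent_def)
      from mate_out[OF m inV(1) _ this \<open>\<not> A a c\<close>] show False using hc(2) ha(1) dist by simp
    qed
    \<comment> \<open>Without a slot \<open>c\<close> would have at most one out-neighbour on
      \<open>L\<close>, but it dominates both \<open>p2\<close> and \<open>a\<close>.\<close>
    have "\<exists>L1 p q L2. L = L1 @ p # q # L2 \<and> A p c \<and> A c q"
    proof (rule ccontr)
      assume "\<nexists>L1 p q L2. L = L1 @ p # q # L2 \<and> A p c \<and> A c q"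
      then have fr: "\<forall>L1 p q L2. L = L1 @ p # q # L2 \<longrightarrow> \<not> (A p c \<and> A c q)" by blast
      have "card {x \<in> set L. A c x} \<le> 1"
        by (rule slotless_segment(1)[OF cycL inV(1) _ fr]) (use cm in blast)
      moreover have "{p2, a} \<subseteq> {x \<in> set L. A c x}" using pL arcs1(4) ca by blast
      then have "card {p2, a} \<le> card {x \<in> set L. A c x}" by (intro card_mono) auto
      ultimately show False using dist by simp
    qed
    then obtain L1 p q L2 where pq: "L = L1 @ p # q # L2" "A p c" "A c q" by blast
    have "L1 \<noteq> []"
    proof
      assume "L1 = []"
      then have "p = p2" using pq(1) L(1) by simp
      then show False using pq(2) nback(3) by simp
    qed
    then obtain L1' where L1: "L1 = p2 # L1'" using pq(1) L(1) by (cases L1) auto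
    have L'eq: "L' = L1' @ p # q # L2" using pq(1) L1 L(1) by simp
    have lastpq: "last (q # L2) = a" using pq(1) La by (metis last_append last_snoc list.distinct(1) append_is_Nil_conv last_ConsR)
    have H'': "cyc A (L1 @ p # c # q # L2 @ [u])"
      using cyc_insert[of A L1 p q "L2 @ [u]" c] cycL(1) pq dist by auto
    have sH: "set (L1 @ p # c # q # L2 @ [u]) = V"
    proof -
      have "set (L1 @ p # c # q # L2 @ [u]) = insert c (set (L @ [u]))" using pq(1) by auto
      then show ?thesis using cycL(2) inV by auto
    qed
    define M' where "M' = L1' @ p # c # q # L2"
    have M'M: "L1 @ p # c # q # L2 = p2 # M'" by (simp add: M'_def L1)
    have H3: "cyc A ((p2 # M') @ [u])" using H'' by (simp add: M'_def L1)
    have M'ne: "M' \<noteq> []" "hd M' = hd L'" "last M' = a"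
      using lastpq L'eq by (auto simp: M'_def hd_append)
    have M: "distinct (L1 @ p # c # q # L2)" "successively A (L1 @ p # c # q # L2)"
      "hd (L1 @ p # c # q # L2) = p2" "last (L1 @ p # c # q # L2) = a" "L1 @ p # c # q # L2 \<noteq> []"
      unfolding M'M using H3 M'ne by (auto simp: cyc_def successively_append_iff successively_Cons)
    have np2u: "\<not> A p2 u" using no_back[OF H'' sH] L1 by simp
    have "\<not> A a p2"
    proof
      assume ap2: "A a p2"
      have "cyc A (L1 @ p # c # q # L2)"
        using M ap2 by (auto simp: cyc_def)
      moreover have "set (L1 @ p # c # q # L2) = V - {u}"
      proof -
        have "set (L1 @ p # c # q # L2) = set Q" using pq(1) Q by auto
        then show ?thesis using sQ by simp
      qed
      ultimately show False using high_not_omitted u H(3) by blast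
    qed
    moreover have "\<not> A p2 a"
    proof
      assume "A p2 a"
      moreover have "successively A (L0 @ [u, c, a])"
        using succL pu arcs1 ca L0 by (auto simp: successively_append_iff)
      moreover have "distinct (L0 @ [u, c, a])" using dist u Q La by auto
      moreover have "set (L0 @ [u, c, a]) = V" using sQ Q La u by auto
      ultimately show False using no_bypass[of "L0 @ [u, c, a]"] L0 by auto
    qed
    ultimately have "2 * card V \<le> deg V A a + deg V A p2 + 1"
      using not_mate[OF inV(2,3) dist(3)] am by (auto simp: adjacent_def)
    then have dp2: "card V \<le> deg V A p2" using ha(3) by simp
    have up3: "A u (hd L')"
    proof (rule ccontr)
      assume "\<not> A u (hd L')"
      then have "arcs A u (set L') \<le> length L'"
        using no_slot_arcs_le(2)[OF _ L(2) ns'(2)] dist(10) L by simp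
      moreover have "arcs A u (set Q) \<le> 2 + arcs A u (set L')"
        using Q L dist arcs1 nback np2u by (simp add: arcs_insert)
      ultimately show False using dQ lQ Q L by simp
    qed
    have "cyc A (M' @ [u])"
      using H3 up3 M'ne by (auto simp: cyc_def successively_Cons successively_append_iff)
    moreover have "set (M' @ [u]) = V - {p2}"
    proof -
      have "p2 \<notin> set (M' @ [u])" using H3 by (auto simp: cyc_def)
      moreover have "set (L1 @ p # c # q # L2 @ [u]) = insert p2 (set (M' @ [u]))" by (auto simp: M'_def L1)
      ultimately show ?thesis unfolding sH[symmetric] by simp
    qed
    ultimately show False using high_not_omitted inV(3) dp2 by blast
  qed
  ultimately show ?thesis using Q La L by (auto simp: adjacent_def)
qed

text \<open>Induction on the length of the run: by the shorter runs, vertices of \<open>S\<close> at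
  distance at least two are non-adjacent, and so are a vertex of \<open>S\<close> and a flank that
  is not next to it. A vertex of \<open>S\<close> that resists insertion into \<open>Q\<close> would
  thus have too small a degree. Inserting all of \<open>S\<close> turns an arc from
  \<open>hd Q\<close> to \<open>last Q\<close> into a bypass; inserting all but the last vertex of
  \<open>S\<close> turns the opposite arc into a cycle omitting a vertex of degree at least
  n.\<close>

lemma high_run:
  assumes "cyc A (S @ Q)" "set (S @ Q) = V" "S \<noteq> []" "length Q \<ge> 2" "\<forall>u\<in>set S. card V \<le> deg V A u"
  shows "\<not> adjacent A (hd Q) (last Q)"
  using assms
proof (induction "length S" arbitrary: S Q rule: less_induct)
  case less
  note H = less(2,3) and Sne = less(4) and lQ = less(5) and high = less(6)
  show ?case
  proof (cases "length S = 1")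
    case True
    then obtain u where "S = [u]" by (cases S) auto
    then show ?thesis using high_neighbours[of u Q] H high by simp
  next
    case False
    then have lS: "length S \<ge> 2" using Sne by (cases S; cases "tl S") auto
    have Q: "Q \<noteq> []" "distinct Q" "successively A Q" "set Q \<inter> set S = {}" "distinct S"
      using H(1) lQ by (auto simp: cyc_def successively_append_iff)
    have r1: "\<not> adjacent A x y" if "S = S1 @ x # S2 @ y # S3" "S2 \<noteq> []" for S1 x S2 y S3
    proof -
      have "cyc A (S2 @ (y # S3 @ Q @ S1 @ [x]))"
        using cyc_rotate[of A "S1 @ [x]" "S2 @ y # S3 @ Q"] H(1) that by simp
      moreover have "set (S2 @ (y # S3 @ Q @ S1 @ [x])) = V" using H(2) that by auto
      ultimately have "\<not> adjacent A (hd (y # S3 @ Q @ S1 @ [x])) (last (y # S3 @ Q @ S1 @ [x]))"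
        using that high by (intro less(1)[of S2]) auto
      then show ?thesis using adjacent_sym by simp
    qed
    have r2: "\<not> adjacent A x (last Q)" if "S = S1 @ x # S2" "S1 \<noteq> []" for S1 x S2
    proof -
      have "\<not> adjacent A (hd (x # S2 @ Q)) (last (x # S2 @ Q))"
        using that high H lQ by (intro less(1)[of S1]) auto
      then show ?thesis using Q(1) by simp
    qed
    have r3: "\<not> adjacent A x (hd Q)" if "S = S1 @ x # S2" "S2 \<noteq> []" for S1 x S2
    proof -
      have "cyc A (S2 @ (Q @ S1 @ [x]))" using cyc_rotate[of A "S1 @ [x]" "S2 @ Q"] H(1) that by simp
      moreover have "set (S2 @ (Q @ S1 @ [x])) = V" using H(2) that by auto
      ultimately have "\<not> adjacent A (hd (Q @ S1 @ [x])) (last (Q @ S1 @ [x]))"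
        using that high lQ by (intro less(1)[of S2]) auto
      then show ?thesis using adjacent_sym Q(1) by simp
    qed
    have ins: "\<exists>Q'. Q' \<noteq> [] \<and> distinct Q' \<and> successively A Q' \<and> hd Q' = hd Q \<and> last Q' = last Q \<and> set Q' = set Q \<union> T"
      if T: "T = set S \<or> T = set (butlast S)" for T
    proof -
      have TS: "T \<subseteq> set S" using T by (auto dest: in_set_butlastD)
      then have fT: "finite T" using finite_subset by blast
      have QT: "set Q \<inter> T = {}" using TS Q(4) by blast
      obtain Q' S' where Q': "S' \<subseteq> T" "Q' \<noteq> []" "distinct Q'" "successively A Q'" "hd Q' = hd Q"
        "last Q' = last Q" "set Q' = set Q \<union> (T - S')" "\<forall>u\<in>S'. \<not> slot A u Q'"
        using greedy_insert[OF fT Q(1-3) QT] by auto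
      have "S' = {}"
      proof (rule ccontr)
        assume "S' \<noteq> {}"
        then have "\<exists>x\<in>set S. x \<in> S'" using Q'(1) TS by blast
        \<comment> \<open>Everything in \<open>S\<close> before the first leftover \<open>u\<close>
          is on the path, so the only possible arc between \<open>u\<close> and a vertex off the
          path is the one to its successor in \<open>S\<close>.\<close>
        then obtain S1 u S2 where S: "S = S1 @ u # S2" "u \<in> S'" "\<forall>x\<in>set S1. x \<notin> S'"
          by (rule split_list_first_propE)
        have u: "u \<in> V" "u \<notin> set Q'" using S H(2) Q'(1,7) QT by auto
        have "set S1 \<subseteq> T" using T by (auto simp: S(1) butlast_append)
        then have S1Q: "set S1 \<subseteq> set Q'" using S(3) Q'(7) by blast
        define X where "X = V - set Q'"
        have "set Q' \<subseteq> V" using Q'(7) TS H(2) by auto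
        have X: "u \<in> X" "X \<subseteq> set (u # S2)" "finite X"
          using u S1Q Q'(7) H(2) by (auto simp: X_def S(1))
        have "arcs A u (set (u # S2)) \<le> 1"
        proof -
          have 1: "arcs A u (set (u # S2)) = arcs A u (set S2)"
            using Q(5) S(1) by (simp add: arcs_insert)
          show ?thesis
          proof (cases S2)
            case (Cons h S3)
            have "\<not> A h u" by (rule no_back_consec[of S1 u h "S3 @ Q"]) (use H S(1) Cons in auto)
            moreover have "arcs A u (set S3) = 0"
            proof (rule arcs_0I)
              fix x assume "x \<in> set S3"
              then obtain M N where "S3 = M @ x # N" by (metis split_list)
              then have "S = S1 @ u # (h # M) @ x # N" using S(1) Cons by simp
              then show "\<not> A x u \<and> \<not> A u x" using r1[of S1 u "h # M" x N] by (auto simp: adjacent_def)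
            qed
            ultimately show ?thesis using 1 Cons Q(5) S(1) by (simp add: arcs_insert)
          qed (use 1 in simp)
        qed
        then have aX: "arcs A u X \<le> 1" using arcs_mono[OF X(2), of A u] by simp
        have aX0: "arcs A u X = 0" if "X = {u}" using that by (auto intro: arcs_0I)
        have "length Q' = card (set Q')" using Q'(3) by (simp add: distinct_card)
        then have n: "card V = length Q' + card X"
          unfolding X_def using V_split[OF \<open>set Q' \<subseteq> V\<close>] by simp
        have "\<not> (A (last Q) u \<and> A u (hd Q))"
        proof (cases "S2 = []")
          case True
          then have "S1 \<noteq> []" using S(1) lS by auto
          then show ?thesis using r2[OF S(1)] by (auto simp: adjacent_def)
        next
          case False
          then show ?thesis using r3[OF S(1)] by (auto simp: adjacent_def)
        qed
        then have "arcs A u (set Q') \<le> length Q'"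
          using no_slot_arcs[OF Q'(3,2), of A u] Q'(5,6,8) S(2)
          by (cases "A (last Q) u"; cases "A u (hd Q)") auto
        moreover have "deg V A u = arcs A u (set Q') + arcs A u X"
          unfolding X_def by (rule deg_split) fact
        moreover have "card V \<le> deg V A u" using high S(1) by simp
        moreover have "card X \<ge> 1" using X(1,3) by (metis One_nat_def Suc_leI card_gt_0_iff empty_iff)
        ultimately have "card X = 1" using n aX by linarith
        then have "X = {u}" using X(1) by (metis card_1_singletonE singletonD)
        then show False using aX0 n \<open>card X = 1\<close> \<open>card V \<le> deg V A u\<close>
            \<open>deg V A u = arcs A u (set Q') + arcs A u X\<close> \<open>arcs A u (set Q') \<le> length Q'\<close> by linarith
      qed
      then show ?thesis using Q' by auto
    qed
    have "\<not> A (hd Q) (last Q)"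
    proof
      assume a: "A (hd Q) (last Q)"
      obtain Q' where Q': "Q' \<noteq> []" "distinct Q'" "successively A Q'" "hd Q' = hd Q" "last Q' = last Q"
        "set Q' = set Q \<union> set S" using ins by blast
      have "set Q' = V" using Q'(6) H(2) by auto
      then show False using no_bypass[of Q'] Q' a by simp
    qed
    moreover have "\<not> A (last Q) (hd Q)"
    proof
      assume a: "A (last Q) (hd Q)"
      obtain Q' where Q': "Q' \<noteq> []" "distinct Q'" "successively A Q'" "hd Q' = hd Q" "last Q' = last Q"
        "set Q' = set Q \<union> set (butlast S)" using ins by blast
      have "S = butlast S @ [last S]" using Sne by simp
      then have "set S = insert (last S) (set (butlast S))" "last S \<notin> set (butlast S)"
        using Q(5) by (metis Un_insert_right list.set(1) list.set(2) set_append sup_bot_right,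
            metis distinct_append disjoint_iff list.set_intros(1))
      moreover have "last S \<notin> set Q" "last S \<in> set S" using Q(4) Sne by auto
      ultimately have "set Q' = V - {last S}" "last S \<in> V" using Q'(6) H(2) by auto
      moreover have "cyc A Q'" using Q' a by (simp add: cyc_def)
      ultimately show False using high_not_omitted high \<open>last S \<in> set S\<close> by blast
    qed
    ultimately show ?thesis by (simp add: adjacent_def)
  qed
qed

text \<open>A maximal run \<open>S\<close> of vertices of degree at least \<open>n\<close> on a Hamiltonian cycle, with its two flanks.\<close>

definition run :: "'a list \<Rightarrow> 'a \<Rightarrow> 'a list \<Rightarrow> 'a \<Rightarrow> bool" where
  "run S z2 Q z1 \<longleftrightarrow> cyc A (S @ z2 # Q @ [z1]) \<and> set (S @ z2 # Q @ [z1]) = V \<and> S \<noteq> [] \<and> Q \<noteq> []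
    \<and> (\<forall>u\<in>set S. card V \<le> deg V A u) \<and> deg V A z1 < card V \<and> deg V A z2 < card V"

section \<open>Maximal runs and their two mated flanks\<close>

lemma low_mate: "x \<in> V \<Longrightarrow> y \<in> V \<Longrightarrow> x \<noteq> y \<Longrightarrow> deg V A x < card V \<Longrightarrow> deg V A y < card V \<Longrightarrow> \<not> adjacent A x y \<Longrightarrow> mate x y"
  by (auto simp: mate_def)

lemma run_basic:
  assumes "run S z2 Q z1"
  shows "distinct S" "distinct Q" "set S \<inter> set Q = {}" "z1 \<notin> set S \<union> set Q" "z2 \<notin> set S \<union> set Q" "z1 \<noteq> z2"
    "successively A Q" "successively A S" "A (last S) z2" "A z2 (hd Q)" "A (last Q) z1" "A z1 (hd S)"
    "set S \<union> set Q \<union> {z1, z2} = V" "card V = length S + length Q + 2"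
    "\<not> A z2 (last S)" "\<not> A (hd Q) z2" "\<not> A z1 (last Q)" "\<not> A (hd S) z1"
    "mate z1 z2" "mate z2 z1"
proof -
  have H: "cyc A (S @ z2 # Q @ [z1])" "set (S @ z2 # Q @ [z1]) = V" "S \<noteq> []" "Q \<noteq> []" "\<forall>u\<in>set S. card V \<le> deg V A u"
    "deg V A z1 < card V" "deg V A z2 < card V"
    using assms by (auto simp: run_def)
  show 1: "distinct S" "distinct Q" "set S \<inter> set Q = {}" "z1 \<notin> set S \<union> set Q" "z2 \<notin> set S \<union> set Q" "z1 \<noteq> z2"
    "successively A Q" "successively A S" "A (last S) z2" "A z2 (hd Q)" "A (last Q) z1" "A z1 (hd S)"
    using H(1,3,4) by (auto simp: cyc_def successively_append_iff successively_Cons)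
  show V: "set S \<union> set Q \<union> {z1, z2} = V" unfolding H(2)[symmetric] by auto
  have "length (S @ z2 # Q @ [z1]) = card V" using H(1,2) distinct_card[of "S @ z2 # Q @ [z1]"] by (simp add: cyc_def)
  then show "card V = length S + length Q + 2" by simp
  obtain S0 v where S0: "S = S0 @ [v]" using H(3) by (metis append_butlast_last_id)
  obtain b Q0 where Q0: "Q = b # Q0" using H(4) by (cases Q) auto
  obtain Q1 a where Q1: "Q = Q1 @ [a]" using H(4) by (metis append_butlast_last_id)
  show "\<not> A z2 (last S)" using no_back_consec[of S0 v z2 "Q @ [z1]"] H S0 by simp
  show "\<not> A (hd Q) z2" using no_back_consec[of S z2 b "Q0 @ [z1]"] H Q0 by simp
  show "\<not> A z1 (last Q)" using no_back_consec[of "S @ z2 # Q1" a z1 "[]"] H Q1 by simp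
  show "\<not> A (hd S) z1" using no_back[OF H(1,2)] H(3) by simp
  have "\<not> adjacent A z2 z1" using high_run[OF H(1-3) _ H(5)] by simp
  moreover have "z1 \<in> V" "z2 \<in> V" using V by auto
  ultimately show "mate z1 z2" "mate z2 z1"
    using low_mate H(6,7) 1(6) mate_sym adjacent_sym by blast+
qed

text \<open>The part of \<open>S\<close> before or after \<open>x\<close> is itself a run with
  \<open>x\<close> as one flank, so \<open>high_run\<close> applies to it.\<close>

lemma run_nonadj:
  assumes "run S z2 Q z1" "S = S1 @ x # S2"
  shows "S1 \<noteq> [] \<Longrightarrow> \<not> adjacent A x z1" "S2 \<noteq> [] \<Longrightarrow> \<not> adjacent A x z2"
    "arcs A x (set (x # S2)) \<le> 1"
proof -
  have H: "cyc A (S @ z2 # Q @ [z1])" "set (S @ z2 # Q @ [z1]) = V" "\<forall>u\<in>set S. card V \<le> deg V A u"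
    using assms(1) by (auto simp: run_def)
  show "\<not> adjacent A x z1" if "S1 \<noteq> []"
  proof -
    have "\<not> adjacent A (hd (x # S2 @ z2 # Q @ [z1])) (last (x # S2 @ z2 # Q @ [z1]))"
      by (rule high_run[of S1]) (use H assms(2) that in auto)
    then show ?thesis by simp
  qed
  show "\<not> adjacent A x z2" if "S2 \<noteq> []"
  proof -
    have "cyc A (S2 @ (z2 # Q @ [z1] @ S1 @ [x]))"
      using cyc_rotate[of A "S1 @ [x]" "S2 @ z2 # Q @ [z1]"] H(1) assms(2) by simp
    moreover have "set (S2 @ (z2 # Q @ [z1] @ S1 @ [x])) = V" unfolding H(2)[symmetric] assms(2) by auto
    ultimately have "\<not> adjacent A (hd (z2 # Q @ [z1] @ S1 @ [x])) (last (z2 # Q @ [z1] @ S1 @ [x]))"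
      by (rule high_run) (use H(3) assms(2) that in auto)
    then show ?thesis using adjacent_sym by simp
  qed
  have ds: "distinct S" by (rule run_basic(1)[OF assms(1)])
  have 1: "arcs A x (set (x # S2)) = arcs A x (set S2)" using ds assms(2) by (simp add: arcs_insert)
  show "arcs A x (set (x # S2)) \<le> 1"
  proof (cases S2)
    case (Cons h S3)
    have "\<not> A h x" by (rule no_back_consec[of S1 x h "S3 @ z2 # Q @ [z1]"]) (use H assms(2) Cons in auto)
    moreover have "arcs A x (set S3) = 0"
    proof (rule arcs_0I)
      fix y assume "y \<in> set S3"
      then obtain M N where MN: "S3 = M @ y # N" by (metis split_list)
      have "cyc A ((h # M) @ (y # N @ (z2 # Q @ [z1]) @ S1 @ [x]))"
        using cyc_rotate[of A "S1 @ [x]" "(h # M) @ y # N @ z2 # Q @ [z1]"] H(1) assms(2) Cons MN by simp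
      moreover have "set ((h # M) @ (y # N @ (z2 # Q @ [z1]) @ S1 @ [x])) = V"
        unfolding H(2)[symmetric] assms(2) Cons MN by auto
      ultimately have "\<not> adjacent A (hd (y # N @ (z2 # Q @ [z1]) @ S1 @ [x])) (last (y # N @ (z2 # Q @ [z1]) @ S1 @ [x]))"
        by (rule high_run) (use H(3) assms(2) Cons MN in auto)
      then show "\<not> A y x \<and> \<not> A x y" by (simp add: adjacent_def)
    qed
    ultimately show ?thesis using 1 Cons ds assms(2) by (simp add: arcs_insert)
  qed (use 1 in simp)
qed

lemma run_dual:
  assumes "run S z2 Q z1"
  shows "bypass_free.run V (\<lambda>x y. A y x) (rev S) z1 (rev Q) z2"
proof -
  interpret d: bypass_free V "\<lambda>x y. A y x" by (rule dual)
  have H: "cyc A (S @ z2 # Q @ [z1])" "set (S @ z2 # Q @ [z1]) = V" using assms by (auto simp: run_def)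
  have "cyc A (z2 # Q @ [z1] @ S)" using cyc_rotate[of A S "z2 # Q @ [z1]"] H(1) by simp
  moreover have "set (rev S @ z1 # rev Q @ [z2]) = V" unfolding H(2)[symmetric] by auto
  ultimately show ?thesis using assms unfolding d.run_def run_def deg_dual cyc_dual by auto
qed

text \<open>Otherwise a second run starts right behind \<open>z2\<close>. Its far flank is a mate of
  \<open>z2\<close>, hence \<open>z1\<close>, so the cycle is two runs separated by
  \<open>z1\<close> and \<open>z2\<close>. Then \<open>z1\<close> is adjacent only to its two
  neighbours on the cycle, and A0 fails for \<open>z1\<close> and \<open>z2\<close>.\<close>

lemma run_first_low:
  assumes r: "run S z2 Q z1"
  shows "deg V A (hd Q) < card V"
proof (rule ccontr)
  assume "\<not> deg V A (hd Q) < card V"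
  then have hi: "card V \<le> deg V A (hd Q)" by simp
  have H: "cyc A (S @ z2 # Q @ [z1])" "set (S @ z2 # Q @ [z1]) = V" "S \<noteq> []" "Q \<noteq> []"
    "deg V A z1 < card V" "deg V A z2 < card V"
    using r by (auto simp: run_def)
  note b = run_basic[OF r]
  have "\<exists>x\<in>set (Q @ [z1]). deg V A x < card V" using H(5) by auto
  then obtain S2 z3 R3 where S2: "Q @ [z1] = S2 @ z3 # R3" "deg V A z3 < card V" "\<forall>y\<in>set S2. \<not> deg V A y < card V"
    by (rule split_list_first_propE)
  have hi2: "\<forall>y\<in>set S2. card V \<le> deg V A y" using S2(3) by (simp add: not_less)
  have "S2 \<noteq> []"
  proof
    assume "S2 = []"
    then have "hd (Q @ [z1]) = z3" using S2(1) by simp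
    then show False using H(4) hi S2(2) by simp
  qed
  have "cyc A (S2 @ (z3 # R3 @ S @ [z2]))"
    using cyc_rotate[of A "S @ [z2]" "Q @ [z1]"] H(1) S2(1) by simp
  moreover have "set (S2 @ (z3 # R3 @ S @ [z2])) = V"
  proof -
    have "set (S2 @ (z3 # R3 @ S @ [z2])) = set (Q @ [z1]) \<union> set (S @ [z2])" unfolding S2(1) by auto
    then show ?thesis unfolding H(2)[symmetric] by auto
  qed
  ultimately have "\<not> adjacent A (hd (z3 # R3 @ S @ [z2])) (last (z3 # R3 @ S @ [z2]))"
    by (rule high_run) (use hi2 \<open>S2 \<noteq> []\<close> in auto)
  then have na: "\<not> adjacent A z2 z3" using adjacent_sym by simp
  have "z3 \<in> set (Q @ [z1])" unfolding S2(1) by simp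
  then have "z3 \<in> V" "z3 \<noteq> z2" "z2 \<in> V" using b(5,6) H(2) by auto
  then have "mate z2 z3" using low_mate na H(6) S2(2) by metis
  then have "z3 = z1" using mate_unique b(20) by blast
  moreover have "distinct (Q @ [z1])" using b(2,4) by simp
  ultimately have "R3 = []" using S2(1) by (cases R3 rule: rev_cases) auto
  then have QS: "Q = S2" using S2(1) \<open>z3 = z1\<close> by simp
  have nq: "\<not> adjacent A x z1" if x: "x \<in> set Q" "x \<noteq> last Q" for x
  proof -
    obtain M N where MN: "Q = M @ x # N" using split_list[OF x(1)] by blast
    then have "N \<noteq> []" using x(2) by auto
    have "cyc A (N @ ([z1] @ S @ z2 # M @ [x]))"
      using cyc_rotate[of A "S @ z2 # M @ [x]" "N @ [z1]"] H(1) MN by simp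
    moreover have "set (N @ ([z1] @ S @ z2 # M @ [x])) = V" unfolding H(2)[symmetric] MN by auto
    ultimately have "\<not> adjacent A (hd ([z1] @ S @ z2 # M @ [x])) (last ([z1] @ S @ z2 # M @ [x]))"
      by (rule high_run) (use hi2 \<open>N \<noteq> []\<close> QS MN in auto)
    then show ?thesis using adjacent_sym by simp
  qed
  have nS: "\<not> adjacent A x z1" if x: "x \<in> set S" "x \<noteq> hd S" for x
  proof -
    obtain M N where MN: "S = M @ x # N" using split_list[OF x(1)] by blast
    then have "M \<noteq> []" using x(2) by auto
    then show ?thesis using run_nonadj(1)[OF r MN] by simp
  qed
  have o: "x = hd S" if "A z1 x" for x
  proof -
    have "x \<in> set S \<union> set Q \<union> {z1, z2}" unfolding b(13) using arcV that by blast
    moreover have "\<not> A z1 z2" using b(19) by (simp add: mate_def adjacent_def)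
    ultimately show ?thesis using that nS nq b(17) irr by (auto simp: adjacent_def)
  qed
  have i: "x = last Q" if "A x z1" for x
  proof -
    have "x \<in> set S \<union> set Q \<union> {z1, z2}" unfolding b(13) using arcV that by blast
    moreover have "\<not> A z2 z1" using b(19) by (simp add: mate_def adjacent_def)
    ultimately show ?thesis using that nS nq b(18) irr by (auto simp: adjacent_def)
  qed
  have "outdeg V A z1 \<le> card {hd S}" unfolding outdeg_def by (rule card_mono) (use o in auto)
  moreover have "indeg V A z1 \<le> card {last Q}" unfolding indeg_def by (rule card_mono) (use i in auto)
  moreover have lq: "last Q \<in> V" "last Q \<noteq> z1" "last Q \<noteq> z2" "z1 \<in> V" "z2 \<in> V"
    using H(4) b(4,5,13) by auto
  moreover have "3 * card V \<le> deg V A z1 + deg V A z2 + outdeg V A z1 + indeg V A (last Q) + 2"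
    by (rule A0_out) (use lq b(17,19,6) in \<open>auto simp: mate_def\<close>)
  moreover have "indeg V A (last Q) + 2 \<le> card V" using indeg_le2 lq b(17) by metis
  ultimately show False using H(6) n4 by (simp add: deg_def)
qed

lemma run_last_low:
  assumes "run S z2 Q z1"
  shows "deg V A (last Q) < card V"
proof -
  interpret d: bypass_free V "\<lambda>x y. A y x" by (rule dual)
  show ?thesis using d.run_first_low[OF run_dual[OF assms]] assms by (simp add: deg_dual run_def hd_rev)
qed

text \<open>The last vertex of \<open>S\<close> is kept apart, with a slot waiting for it, because
  it is later used both inserted and left out. For longer runs the vertices of \<open>S\<close> have
  so few arcs with each other and with \<open>z1\<close>, \<open>z2\<close> that their degrees force
  the slots. For a single vertex this count is short by one, and \<open>singleton_run_slot\<close>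
  supplies the assumption.\<close>

lemma run_insert:
  assumes r: "run S z2 Q z1" and sl: "\<forall>u. S = [u] \<longrightarrow> slot A u Q"
  obtains xs c d ys where "distinct (xs @ c # d # ys)" "successively A (xs @ c # d # ys)" "hd (xs @ c # d # ys) = hd Q"
    "last (xs @ c # d # ys) = last Q" "set (xs @ c # d # ys) = set Q \<union> set (butlast S)" "A c (last S)" "A (last S) d"
proof -
  note b = run_basic[OF r]
  have H: "S \<noteq> []" "Q \<noteq> []" "\<forall>u\<in>set S. card V \<le> deg V A u" using r by (auto simp: run_def)
  obtain S0 v where S0: "S = S0 @ [v]" using H(1) by (metis append_butlast_last_id)
  have dS: "distinct (S0 @ [v])" using b(1) S0 by simp
  have QS: "set Q \<inter> set S0 = {}" "v \<notin> set Q" using b(3) S0 by auto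
  have "\<exists>Q1. Q1 \<noteq> [] \<and> distinct Q1 \<and> successively A Q1 \<and> hd Q1 = hd Q \<and> last Q1 = last Q \<and> set Q1 = set Q \<union> set S0 \<and> slot A v Q1"
  proof (cases "S0 = []")
    case True
    then show ?thesis using sl S0 b H by (intro exI[of _ Q]) auto
  next
    case False
    obtain Q1 S' where Q1: "S' \<subseteq> set S0" "Q1 \<noteq> []" "distinct Q1" "successively A Q1" "hd Q1 = hd Q"
      "last Q1 = last Q" "set Q1 = set Q \<union> (set S0 - S')" "\<forall>u\<in>S'. \<not> slot A u Q1"
      using greedy_insert[OF _ H(2) b(2,7) QS(1)] by auto
    define X where "X = V - set Q1"
    have Q1V: "set Q1 \<subseteq> V" using Q1(7) b(13) S0 by auto
    have Xeq: "X = S' \<union> {v, z1, z2}"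
      unfolding X_def b(13)[symmetric] using Q1(1,7) S0 b(4,5) QS dS by auto
    have "length Q1 = card (set Q1)" using Q1(3) by (simp add: distinct_card)
    then have n: "card V = length Q1 + card X" unfolding X_def using V_split[OF Q1V] by simp
    have fX: "finite X" by (simp add: X_def)
    have vz: "v \<notin> S'" "z1 \<notin> S'" "z2 \<notin> S'" "v \<noteq> z1" "v \<noteq> z2" using Q1(1) dS b(4,5) S0 by auto
    have "S' = {}"
    proof (rule ccontr)
      assume "S' \<noteq> {}"
      then have "\<exists>x\<in>set S0. x \<in> S'" using Q1(1) by blast
      then obtain S1 u S2 where S: "S0 = S1 @ u # S2" "u \<in> S'" "\<forall>x\<in>set S1. x \<notin> S'"
        by (rule split_list_first_propE)
      have Su: "S = S1 @ u # (S2 @ [v])" using S(1) S0 by simp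
      have uz: "u \<noteq> v" "u \<noteq> z1" "u \<noteq> z2" using vz S(2) by auto
      have "{u, v, z1, z2} \<subseteq> X" using S(2) Xeq by auto
      then have "card {u, v, z1, z2} \<le> card X" using fX card_mono by blast
      then have cX: "4 \<le> card X" using uz vz b(6) by simp
      have nz2: "\<not> adjacent A u z2" using run_nonadj(2)[OF r Su] by simp
      have nz1: "\<not> A u z1"
        using run_nonadj(1)[OF r Su] b(18) Su by (cases S1) (auto simp: adjacent_def)
      have "X \<subseteq> insert z1 (insert z2 (set (u # S2 @ [v])))" using Xeq Q1(1) S(1,3) by auto
      then have "arcs A u X \<le> arcs A u (insert z1 (insert z2 (set (u # S2 @ [v]))))" by (rule arcs_mono) simp
      also have "\<dots> \<le> 1 + arcs A u (set (u # S2 @ [v]))"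
      proof -
        have "set (u # S2 @ [v]) \<subseteq> set S" using Su by auto
        then have "z2 \<notin> set (u # S2 @ [v])" "z1 \<notin> insert z2 (set (u # S2 @ [v]))" using b(4-6) by blast+
        then show ?thesis using nz1 nz2 by (simp add: arcs_insert adjacent_def del: set_simps set_append)
      qed
      also have "\<dots> \<le> 2" using run_nonadj(3)[OF r Su] by simp
      finally have "arcs A u X \<le> 2" .
      moreover have "arcs A u (set Q1) \<le> length Q1 + 1" using no_slot_arcs_le(1)[OF Q1(3,2)] Q1(8) S(2) by blast
      moreover have "deg V A u = arcs A u (set Q1) + arcs A u X" unfolding X_def by (rule deg_split[OF Q1V])
      moreover have "card V \<le> deg V A u" using H(3) Su by simp
      ultimately show False using n cX by simp
    qed
    have "slot A v Q1"
    proof (rule ccontr)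
      assume "\<not> slot A v Q1"
      then have "arcs A v (set Q1) \<le> length Q1 + 1" using no_slot_arcs_le(1)[OF Q1(3,2)] by blast
      moreover have "deg V A v = arcs A v (set Q1) + arcs A v X" unfolding X_def by (rule deg_split[OF Q1V])
      moreover have "card V \<le> deg V A v" using H(3) S0 by simp
      moreover have X3: "X = {z1, z2, v}" using Xeq \<open>S' = {}\<close> by auto
      moreover have "card X = 3" using X3 vz b(6) by simp
      moreover have "arcs A v {z1, z2, v} \<le> 1"
      proof -
        have "\<not> adjacent A v z1" using run_nonadj(1)[OF r, of S0 v "[]"] S0 False by simp
        moreover have "\<not> A z2 v" using b(15) S0 by simp
        ultimately show ?thesis using vz b(6) by (simp add: arcs_insert adjacent_def)
      qed
      ultimately show False using n by simp
    qed
    then show ?thesis using Q1 \<open>S' = {}\<close> by auto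
  qed
  then obtain Q1 where Q1: "distinct Q1" "successively A Q1" "hd Q1 = hd Q" "last Q1 = last Q" "set Q1 = set Q \<union> set S0" "slot A v Q1"
    by blast
  then obtain xs c d ys where "Q1 = xs @ c # d # ys" "A c v" "A v d" by (auto simp: slot_def)
  then show ?thesis using that[of xs c d ys] Q1 S0 by simp
qed

end

lemma cyc_snoc:
  "distinct L \<Longrightarrow> successively A L \<Longrightarrow> L \<noteq> [] \<Longrightarrow> z \<notin> set L \<Longrightarrow> A (last L) z \<Longrightarrow> A z (hd L) \<Longrightarrow> cyc A (L @ [z])"
  by (simp add: cyc_def successively_append_iff)

lemma split_last:
  assumes "distinct S" "S \<noteq> []"
  shows "set S = insert (last S) (set (butlast S))" "last S \<notin> set (butlast S)"
  using assms by (induction S rule: rev_induct) auto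

context bypass_free
begin

text \<open>A0 for \<open>z2\<close> and its mate \<open>z1\<close>, as \<open>hd Q\<close> does not
  dominate \<open>z2\<close>, after subtracting d(z1) <= n-1 and d^+(hd Q) <= n-2. It will collide
  with the few arcs that \<open>slotless_segment\<close> leaves to \<open>z2\<close>.\<close>

lemma run_count:
  assumes r: "run S z2 Q z1"
  shows "card V + 1 \<le> outdeg V A z2 + 2 * indeg V A z2"
proof -
  note b = run_basic[OF r]
  have Q: "Q \<noteq> []" "deg V A z1 < card V" using r by (auto simp: run_def)
  have hq: "hd Q \<in> V" "hd Q \<noteq> z1" "hd Q \<noteq> z2" "z1 \<in> V" "z2 \<in> V" using Q b(4,5,13) by auto
  have "3 * card V \<le> deg V A z2 + deg V A z1 + indeg V A z2 + outdeg V A (hd Q) + 2"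
    by (rule A0_in) (use hq b(16,20,6) in \<open>auto simp: mate_def\<close>)
  moreover have "outdeg V A (hd Q) + 2 \<le> card V" by (rule outdeg_le2[OF hq(1,5)]) (use hq b(16) in auto)
  ultimately show ?thesis using Q(2) by (simp add: deg_def)
qed

text \<open>Without a slot the degree of \<open>u\<close> forces the arcs from \<open>last Q\<close>
  to \<open>u\<close> and from \<open>u\<close> to \<open>hd Q\<close>, so \<open>Q\<close>,
  \<open>z1\<close>, \<open>u\<close> form a cycle omitting \<open>z2\<close>. A slot for
  \<open>z2\<close> on \<open>Q\<close> would make \<open>hd Q\<close> a second mate of
  \<open>z1\<close> by \<open>high_neighbours\<close>; without one, \<open>z2\<close> has at most
  one out- and two in-neighbours, against \<open>run_count\<close>.\<close>

lemma singleton_run_slot: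
  assumes r: "run [u] z2 Q z1"
  shows "slot A u Q"
proof (rule ccontr)
  assume ns: "\<not> slot A u Q"
  note b = run_basic[OF r]
  have Q: "Q \<noteq> []" "deg V A z1 < card V" "card V \<le> deg V A u" using r by (auto simp: run_def)
  have u: "u \<in> V" "u \<notin> set Q" "u \<noteq> z1" "u \<noteq> z2" using b(3,4,5,13) by auto
  have lQ: "card V = length Q + 3" using b(14) by simp
  have "deg V A u = arcs A u (V - {u})" by (rule deg_V_minus[OF u(1)])
  also have "V - {u} = insert z1 (insert z2 (set Q))" unfolding b(13)[symmetric] using u by auto
  also have "arcs A u \<dots> = 2 + arcs A u (set Q)"
    using b(4,5,6,9,12,15,18) by (simp add: arcs_insert)
  finally have "length Q + 1 \<le> arcs A u (set Q)" using Q(3) lQ by simp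
  then have au: "A (last Q) u" "A u (hd Q)"
    using no_slot_arcs_le(2,3)[OF b(2) Q(1) ns] by fastforce+
  have C: "cyc A (Q @ [z1, u])" using b(2,4,6,7,11,12) u Q au by (auto simp: cyc_def successively_append_iff)
  have SC: "set (Q @ [z1, u]) = V - {z2}" unfolding b(13)[symmetric] using b(4-6) u by auto
  have z2: "z2 \<in> V" "z1 \<in> V" using b(13) by auto
  have good: "\<forall>w\<in>set Q. \<not> mate z2 w" using mate_unique b(4,20) by blast
  have fr: "\<forall>L1 p q L2. Q = L1 @ p # q # L2 \<longrightarrow> \<not> (A p z2 \<and> A z2 q)"
  proof (intro allI impI notI)
    fix L1 p q L2 assume L: "Q = L1 @ p # q # L2" and pq: "A p z2 \<and> A z2 q"
    have "cyc A (L1 @ p # z2 # q # (L2 @ [z1, u]))"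
      by (rule cyc_insert) (use C L pq b(5,6) u in auto)
    then have c: "cyc A (u # (L1 @ p # z2 # q # L2 @ [z1]))"
      using cyc_rotate[of A "L1 @ p # z2 # q # L2 @ [z1]" "[u]"] by simp
    have s: "set (u # (L1 @ p # z2 # q # L2 @ [z1])) = V" unfolding b(13)[symmetric] L by auto
    have "hd (L1 @ p # z2 # q # L2 @ [z1]) = hd Q" using L by (cases L1) auto
    then have "\<not> adjacent A (hd Q) z1" using high_neighbours[OF c s Q(3)] by simp
    moreover have "hd Q \<in> V" "hd Q \<noteq> z1" "hd Q \<noteq> z2" using Q(1) b(4,5,13) by auto
    ultimately have "mate z1 (hd Q)"
      using low_mate[of "hd Q" z1] run_first_low[OF r] Q(2) z2 mate_sym by blast
    then show False using mate_unique b(19) \<open>hd Q \<noteq> z2\<close> by blast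
  qed
  note f = slotless_segment[OF C SC z2(1) good fr]
  have nz: "\<not> A z2 z1" "\<not> A z1 z2" using b(19) by (auto simp: mate_def adjacent_def)
  have mem: "x \<in> set Q \<or> x = u" if "A z2 x \<or> A x z2" for x
  proof -
    have "x \<in> V" using that arcV by blast
    then have "x \<in> set [u] \<union> set Q \<union> {z1, z2}" unfolding b(13) .
    then show ?thesis using that nz irr by auto
  qed
  have "{x \<in> V. A z2 x} \<subseteq> {x \<in> set Q. A z2 x}" using mem b(15) by auto
  then have "outdeg V A z2 \<le> card {x \<in> set Q. A z2 x}" unfolding outdeg_def by (rule card_mono[rotated]) simp
  then have o: "outdeg V A z2 \<le> 1" using f(1) by linarith
  have "{x \<in> V. A x z2} \<subseteq> insert u {x \<in> set Q. A x z2}" using mem by auto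
  then have "indeg V A z2 \<le> card (insert u {x \<in> set Q. A x z2})" unfolding indeg_def by (rule card_mono[rotated]) simp
  also have "\<dots> \<le> 1 + card {x \<in> set Q. A x z2}" by (simp add: card_insert_if)
  finally have i: "indeg V A z2 \<le> 1 + card {x \<in> set Q. A x z2}" .
  show False
  proof (cases "{x \<in> set Q. A x z2} = {}")
    case True
    then have "card {x \<in> set Q. A x z2} = 0" by (simp only: card.empty)
    then show False using run_count[OF r] o i n4 by linarith
  next
    case False
    then obtain x where x: "x \<in> set Q" "A x z2" by blast
    \<comment> \<open>With two in-neighbours \<open>run_count\<close> still admits n = 4; an
      in-neighbour on \<open>Q\<close> other than \<open>hd Q\<close> makes n at least 5.\<close>
    then have "x \<noteq> hd Q" using b(16) by auto
    then have "length Q \<ge> 2" using x(1) by (cases Q; cases "tl Q") auto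
    then show False using run_count[OF r] o i f(2) lQ by linarith
  qed
qed

text \<open>The chord closes \<open>Q\<close> with \<open>S\<close> inserted to a cycle
  \<open>L1 @ v # L2 @ [z1]\<close> omitting \<open>z2\<close>, where \<open>v\<close> is the last
  vertex of \<open>S\<close>. A slot for \<open>z2\<close> inside \<open>L1\<close> or
  \<open>L2\<close> would yield a cycle omitting \<open>v\<close>, so
  \<open>slotless_segment\<close> bounds the arcs of \<open>z2\<close> on both parts. Since
  \<open>v\<close> dominates \<open>z2\<close>, an in-neighbour on \<open>L1\<close> is impossible
  as well, and \<open>run_count\<close> fails.\<close>

lemma run_chord:
  assumes r: "run S z2 Q z1" and z1b: "A z1 (hd Q)"
  shows False
proof -
  note b = run_basic[OF r]
  have Q: "Q \<noteq> []" "S \<noteq> []" "deg V A z1 < card V" "\<forall>u\<in>set S. card V \<le> deg V A u" using r by (auto simp: run_def)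
  have "\<forall>u. S = [u] \<longrightarrow> slot A u Q" using singleton_run_slot r by blast
  from run_insert[OF r this] obtain xs c d ys where L: "distinct (xs @ c # d # ys)" "successively A (xs @ c # d # ys)"
    "hd (xs @ c # d # ys) = hd Q" "last (xs @ c # d # ys) = last Q" "set (xs @ c # d # ys) = set Q \<union> set (butlast S)"
    "A c (last S)" "A (last S) d" by blast
  define v where "v = last S"
  have v: "v \<in> set S" "v \<in> V" "card V \<le> deg V A v" "v \<notin> set Q" "v \<noteq> z1" "v \<noteq> z2" "A c v" "A v d"
  proof -
    show v: "v \<in> set S" using Q(2) by (simp add: v_def)
    show "v \<in> V" using v b(13) by blast
    show "card V \<le> deg V A v" using v Q(4) by blast
    show "v \<notin> set Q" "v \<noteq> z1" "v \<noteq> z2" using v b(3-5) by auto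
    show "A c v" "A v d" using L(6,7) by (simp_all add: v_def)
  qed
  have vS: "set S = insert v (set (butlast S))" "v \<notin> set (butlast S)"
    unfolding v_def by (rule split_last[OF b(1) Q(2)])+
  define L1 L2 where "L1 = xs @ [c]" and "L2 = d # ys"
  have LL: "xs @ c # d # ys = L1 @ L2" by (simp add: L1_def L2_def)
  have setL: "set (L1 @ L2) = set Q \<union> set (butlast S)" using L(5) LL by simp
  have bS: "set (butlast S) \<subseteq> set S" using vS by blast
  have notL: "z1 \<notin> set (L1 @ L2)" "z2 \<notin> set (L1 @ L2)" "v \<notin> set (L1 @ L2)"
    unfolding setL using b(4,5) bS vS(2) v(4) by auto
  have setV: "insert v (insert z1 (insert z2 (set (L1 @ L2)))) = V"
    unfolding setL b(13)[symmetric] vS(1) by auto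
  have z12: "z1 \<in> V" "z2 \<in> V" using b(13) by auto
  have "cyc A ((L1 @ L2) @ [z1])"
    by (rule cyc_snoc) (use L(1-4)[unfolded LL] notL(1) z1b b(11) in \<open>simp_all add: L1_def\<close>)
  then have R: "cyc A (L1 @ L2 @ [z1])" by simp
  have C: "cyc A (L1 @ v # L2 @ [z1])"
    using cyc_insert[of A xs c d "ys @ [z1]" v] R v(7,8) notL(3) v(5) by (simp add: L1_def L2_def)
  have SC: "set (L1 @ v # L2 @ [z1]) = V - {z2}" unfolding setV[symmetric] using notL(2) v(6) b(6) by auto
  have good: "\<forall>w\<in>V. w \<noteq> z1 \<longrightarrow> \<not> mate z2 w" using mate_unique b(20) by blast
  have ins: False if M: "L1 @ L2 @ [z1] = M1 @ p # q # M2" "A p z2" "A z2 q" for M1 p q M2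
  proof -
    have "z2 \<notin> set (L1 @ L2 @ [z1])" using notL(2) b(6) by auto
    then have "cyc A (M1 @ p # z2 # q # M2)" using cyc_insert[of A M1 p q M2 z2] R M by simp
    moreover have "set (M1 @ p # z2 # q # M2) = V - {v}"
    proof -
      have "set (M1 @ p # z2 # q # M2) = insert z2 (set (M1 @ p # q # M2))" by auto
      also have "\<dots> = insert z2 (insert z1 (set (L1 @ L2)))" unfolding M(1)[symmetric] by auto
      also have "\<dots> = V - {v}" unfolding setV[symmetric] using notL(3) v(5,6) by auto
      finally show ?thesis .
    qed
    ultimately show False using high_not_omitted v(2,3) by blast
  qed
  have C1: "cyc A (L1 @ (v # L2 @ [z1]))" "set (L1 @ (v # L2 @ [z1])) = V - {z2}" using C SC by simp_all
  have C2: "cyc A (L2 @ ([z1] @ L1 @ [v]))" "set (L2 @ ([z1] @ L1 @ [v])) = V - {z2}"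
    using cyc_rotate[of A "L1 @ [v]" "L2 @ [z1]"] C SC by auto
  have g1: "\<forall>w\<in>set L1. \<not> mate z2 w" and g2: "\<forall>w\<in>set L2. \<not> mate z2 w"
    using good setV notL(1) by auto
  have f1: "\<forall>M1 p q M2. L1 = M1 @ p # q # M2 \<longrightarrow> \<not> (A p z2 \<and> A z2 q)"
  proof (intro allI impI notI)
    fix M1 p q M2 assume "L1 = M1 @ p # q # M2" "A p z2 \<and> A z2 q"
    then show False using ins[of M1 p q "M2 @ L2 @ [z1]"] by simp
  qed
  have f2: "\<forall>M1 p q M2. L2 = M1 @ p # q # M2 \<longrightarrow> \<not> (A p z2 \<and> A z2 q)"
  proof (intro allI impI notI)
    fix M1 p q M2 assume "L2 = M1 @ p # q # M2" "A p z2 \<and> A z2 q"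
    then show False using ins[of "L1 @ M1" p q "M2 @ [z1]"] by simp
  qed
  note i1 = slotless_segment[OF C1 z12(2) g1 f1] and i2 = slotless_segment[OF C2 z12(2) g2 f2]
  have vz2: "A v z2" "\<not> A z2 v" using b(9,15) by (simp_all add: v_def)
  have gv: "\<not> mate z2 v" using good v by blast
  have noI1: "\<not> A p z2" if pL: "p \<in> set L1" for p
  proof
    assume p: "A p z2"
    obtain A1 A2 where A12: "L1 = A1 @ p # A2" using split_list[OF pL] by blast
    have dL: "distinct L1" using L(1) LL by simp
    have "\<not> A z2 w \<and> \<not> A w z2" if w: "w \<in> set A2" for w
    proof -
      obtain N1 N2 where N: "A2 = N1 @ w # N2" using split_list[OF w] by blast
      have "\<not> A z2 w" using no_in_before_out[OF C1 z12(2) g1 f1, of A1 p N1 w N2] A12 N p by simp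
      moreover have "\<not> A w z2"
      proof
        assume "A w z2"
        then have "{p, w} \<subseteq> {x \<in> set L1. A x z2}" using p A12 w by auto
        then have "card {p, w} \<le> card {x \<in> set L1. A x z2}" by (intro card_mono) auto
        moreover have "p \<noteq> w" using dL A12 w by auto
        ultimately show False using i1(2) by simp
      qed
      ultimately show ?thesis by simp
    qed
    then have nA2: "\<forall>w\<in>set A2. \<not> A z2 w \<and> \<not> A w z2" by blast
    have c: "cyc A ((L1 @ [v]) @ (L2 @ [z1]))" and s: "set ((L1 @ [v]) @ (L2 @ [z1])) = V - {z2}" using C SC by simp_all
    have g: "\<forall>w\<in>set (L1 @ [v]). \<not> mate z2 w" using g1 gv by simp
    have e: "L1 @ [v] = A1 @ p # A2 @ v # []" using A12 by simp
    have "\<not> (A p z2 \<and> A v z2)" by (rule nonadjacent_segment(2)[OF c s z12(2) g e nA2])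
    then show False using p vz2 by blast
  qed
  \<comment> \<open>An in-neighbour of \<open>z2\<close> on \<open>L2\<close> cannot come first,
    right behind the in-neighbour \<open>v\<close>; this raises n to 6, where
    \<open>run_count\<close> would need n <= 5.\<close>
  have l2: "2 \<le> length L2" if x: "x \<in> set L2" "A x z2" for x
  proof -
    obtain A1 A2 where A12: "L2 = A1 @ x # A2" using split_list[OF x(1)] by blast
    have dL: "distinct L2" using L(1) LL by simp
    have "A1 \<noteq> []"
    proof
      assume A1: "A1 = []"
      have c: "cyc A ((v # L2) @ ([z1] @ L1))" and s: "set ((v # L2) @ ([z1] @ L1)) = V - {z2}"
        using cyc_rotate[of A L1 "v # L2 @ [z1]"] C SC by auto
      have g: "\<forall>w\<in>set (v # L2). \<not> mate z2 w" using g2 gv by simp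
      have e: "v # L2 = [] @ v # [] @ x # A2" using A12 A1 by simp
      have "\<not> (A v z2 \<and> A x z2)" by (rule nonadjacent_segment(2)[OF c s z12(2) g e]) simp
      then show False using x vz2 by blast
    qed
    then show ?thesis using A12 by (cases A1) auto
  qed
  have nz: "\<not> A z2 z1" "\<not> A z1 z2" using b(19) by (auto simp: mate_def adjacent_def)
  have mem: "x \<in> set L1 \<or> x \<in> set L2 \<or> x = v" if "A z2 x \<or> A x z2" for x
  proof -
    have "x \<in> insert v (insert z1 (insert z2 (set (L1 @ L2))))" unfolding setV using that arcV by blast
    then show ?thesis using that nz irr by auto
  qed
  have "{x \<in> V. A z2 x} \<subseteq> {x \<in> set L1. A z2 x} \<union> {x \<in> set L2. A z2 x}" using mem vz2 by auto
  then have "outdeg V A z2 \<le> card ({x \<in> set L1. A z2 x} \<union> {x \<in> set L2. A z2 x})"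
    unfolding outdeg_def by (rule card_mono[rotated]) simp
  also have "\<dots> \<le> card {x \<in> set L1. A z2 x} + card {x \<in> set L2. A z2 x}" by (rule card_Un_le)
  finally have o: "outdeg V A z2 \<le> 2" using i1(1) i2(1) by linarith
  have "{x \<in> V. A x z2} \<subseteq> insert v {x \<in> set L2. A x z2}" using mem noI1 by auto
  then have "indeg V A z2 \<le> card (insert v {x \<in> set L2. A x z2})" unfolding indeg_def by (rule card_mono[rotated]) simp
  also have "\<dots> \<le> 1 + card {x \<in> set L2. A x z2}" by (simp add: card_insert_if)
  finally have i: "indeg V A z2 \<le> 1 + card {x \<in> set L2. A x z2}" .
  show False
  proof (cases "{x \<in> set L2. A x z2} = {}")
    case True
    then have "card {x \<in> set L2. A x z2} = 0" by (simp only: card.empty)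
    then show False using run_count[OF r] o i n4 by linarith
  next
    case False
    then obtain x where x: "x \<in> set L2" "A x z2" by blast
    have "length (L1 @ v # L2 @ [z1]) + 1 = card V" using card_cyc[OF C SC z12(2)] .
    moreover have "length L1 \<ge> 1" by (simp add: L1_def)
    ultimately have "card V \<ge> 6" using l2[OF x] by simp
    then show False using run_count[OF r] o i i2(2) by linarith
  qed
qed

text \<open>By uniqueness of mates the missing chords are present in the opposite direction. The arc
  from \<open>z2\<close> to \<open>last Q\<close> makes any Hamiltonian path between these two a
  bypass. To find one, \<open>S\<close> is inserted into \<open>Q\<close> and \<open>z1\<close>
  between a closest pair \<open>p\<close>, \<open>q\<close>, dropping the vertices \<open>B\<close>
  in between. They are neither adjacent to \<open>z1\<close> nor mates of it, hence of large degree,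
  and \<open>insert_block\<close> brings them back.\<close>

lemma run_no_chords:
  assumes r: "run S z2 Q z1" and nc: "\<not> A z1 (hd Q)" "\<not> A (last Q) z2"
  shows False
proof -
  note b = run_basic[OF r]
  have Q: "Q \<noteq> []" "S \<noteq> []" "deg V A z1 < card V" "deg V A z2 < card V" using r by (auto simp: run_def)
  have z12: "z1 \<in> V" "z2 \<in> V" using b(13) by auto
  have ends: "hd Q \<in> V" "hd Q \<noteq> z1" "hd Q \<noteq> z2" "last Q \<in> V" "last Q \<noteq> z1" "last Q \<noteq> z2"
    using Q(1) b(4,5,13) by auto
  have bz1: "A (hd Q) z1"
  proof (rule ccontr)
    assume "\<not> A (hd Q) z1"
    then have "mate z1 (hd Q)"
      using low_mate[OF z12(1) ends(1) _ Q(3) run_first_low[OF r]] nc(1) ends by (auto simp: adjacent_def)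
    then show False using mate_unique b(19) ends by blast
  qed
  have z2a: "A z2 (last Q)"
  proof (rule ccontr)
    assume "\<not> A z2 (last Q)"
    then have "mate z2 (last Q)"
      using low_mate[OF z12(2) ends(4) _ Q(4) run_last_low[OF r]] nc(2) ends by (auto simp: adjacent_def)
    then show False using mate_unique b(20) ends by blast
  qed
  have "\<forall>u. S = [u] \<longrightarrow> slot A u Q" using singleton_run_slot r by blast
  from run_insert[OF r this] obtain xs c d ys where L: "distinct (xs @ c # d # ys)" "successively A (xs @ c # d # ys)"
    "hd (xs @ c # d # ys) = hd Q" "last (xs @ c # d # ys) = last Q" "set (xs @ c # d # ys) = set Q \<union> set (butlast S)"
    "A c (last S)" "A (last S) d" by blast
  have vS: "set S = insert (last S) (set (butlast S))" "last S \<notin> set (butlast S)"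
    by (rule split_last[OF b(1) Q(2)])+
  have "slot A (last S) (xs @ c # d # ys)" using L(6,7) by (auto simp: slot_def)
  moreover have "last S \<notin> set (xs @ c # d # ys)" unfolding L(5) using vS b(3) by auto
  ultimately obtain Y where Y: "distinct Y" "successively A Y" "Y \<noteq> []" "hd Y = hd Q" "last Y = last Q"
    "set Y = insert (last S) (set Q \<union> set (butlast S))"
    using slot_insert[OF _ L(1,2)] L(3-5) by metis
  have sY: "set Y = set Q \<union> set S" using Y(6) vS by auto
  have nY: "z1 \<notin> set Y" "z2 \<notin> set Y" using sY b(4,5) by auto
  have VY: "V = insert z1 (insert z2 (set Y))" unfolding b(13)[symmetric] sY by auto
  obtain T where T: "Y = hd Q # T" using Y(3,4) by (cases Y) auto
  have "hd S \<in> set S" "hd Q \<in> set Q" using Q(1,2) by simp_all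
  then have "hd S \<in> set Y" "hd S \<noteq> hd Q" using sY b(3) by auto
  then have "hd S \<in> set T" using T by (metis set_ConsD)
  then obtain M N where "T = M @ hd S # N" by (metis split_list)
  then have "Y = [] @ hd Q # M @ hd S # N" using T by simp
  from closest_pair[OF this, where P = "\<lambda>x. A x z1" and R = "A z1"] bz1 b(12)
  obtain A1 p B q A2 where AB: "Y = A1 @ p # B @ q # A2" "A p z1" "A z1 q" "\<forall>x\<in>set B. \<not> A x z1 \<and> \<not> A z1 x"
    by blast
  have ns: "\<not> slot A z1 Y"
  proof
    assume "slot A z1 Y"
    then obtain Y' where Y': "distinct Y'" "successively A Y'" "Y' \<noteq> []" "hd Y' = hd Y" "last Y' = last Y" "set Y' = insert z1 (set Y)"
      using slot_insert[OF _ Y(1,2) nY(1)] by metis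
    have "distinct (z2 # Y')" "successively A (z2 # Y')" "set (z2 # Y') = V" "A (hd (z2 # Y')) (last (z2 # Y'))"
      using Y' Y(4,5) nY b(6,10) z2a VY by (auto simp: successively_Cons)
    then show False using no_bypass by blast
  qed
  have ns1: "\<not> slot A z1 (A1 @ [p])" using ns slot_append[of A z1 "A1 @ [p]" "[]" "B @ q # A2"] AB(1) by auto
  have ns2: "\<not> slot A z1 (q # A2)" using ns slot_append[of A z1 "q # A2" "A1 @ p # B" "[]"] AB(1) by auto
  have hA: "hd (A1 @ [p]) = hd Q" using AB(1) Y(4) by (cases A1) auto
  have dAB: "distinct (A1 @ [p])" "distinct (q # A2)" "distinct B" using Y(1) AB(1) by auto
  have "arcs A z1 (set (A1 @ [p])) \<le> length A1 + 1"
    using no_slot_arcs_le(2)[OF dAB(1) _ ns1] hA nc(1) by simp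
  moreover have "arcs A z1 (set (q # A2)) \<le> length A2 + 2"
    using no_slot_arcs_le(1)[OF dAB(2) _ ns2] by simp
  moreover have "deg V A z1 = arcs A z1 (set (A1 @ [p])) + arcs A z1 (set (q # A2))"
  proof -
    have "V - {z1} = (set (A1 @ [p]) \<union> set (q # A2)) \<union> insert z2 (set B)" "(set (A1 @ [p]) \<union> set (q # A2)) \<inter> insert z2 (set B) = {}"
      "set (A1 @ [p]) \<inter> set (q # A2) = {}"
      using VY nY AB(1) b(6) Y(1) by auto
    moreover have "arcs A z1 (insert z2 (set B)) = 0"
      by (rule arcs_0I) (use AB(4) b(19) in \<open>auto simp: mate_def adjacent_def\<close>)
    ultimately show ?thesis
      using deg_V_minus[OF z12(1)] arcs_Un[of "set (A1 @ [p]) \<union> set (q # A2)" "insert z2 (set B)" A z1]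
        arcs_Un[of "set (A1 @ [p])" "set (q # A2)" A z1] by (simp del: set_simps set_append)
  qed
  \<comment> \<open>\<open>z1\<close> has no slot on either side of the gap and does not dominate
    \<open>hd Q\<close>. With n = |A1|+|A2|+|B|+4 this bound gives the vertices of \<open>B\<close>
    exactly the degree that \<open>insert_block\<close> needs.\<close>
  ultimately have dz1: "deg V A z1 \<le> length A1 + length A2 + 3" by simp
  have "length (A1 @ p # B @ q # A2) = length S + length Q"
    using distinct_card[OF Y(1)] sY b(1-3) AB(1) by (simp add: card_Un_disjoint distinct_card Int_commute)
  then have n: "card V = length A1 + length A2 + length B + 4" using b(14) by simp
  define P1 where "P1 = z2 # A1 @ p # z1 # q # A2"
  have sP: "set P1 \<union> set B = V" unfolding VY AB(1) P1_def by auto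
  have P1: "P1 \<noteq> []" "distinct P1" "successively A P1" "set P1 \<inter> set B = {}"
  proof -
    show "P1 \<noteq> []" by (simp add: P1_def)
    show "distinct P1" "set P1 \<inter> set B = {}" using Y(1) nY b(6) unfolding AB(1) P1_def by auto
    have "successively A (A1 @ [p])" "successively A (q # A2)"
      using Y(2) unfolding AB(1) by (auto simp: successively_append_iff successively_Cons)
    then have "successively A ((A1 @ [p]) @ [z1] @ (q # A2))" using AB(2,3) by (simp only: successively_append_iff) simp
    moreover have "A z2 (hd ((A1 @ [p]) @ [z1] @ (q # A2)))" using hA b(10) by (cases A1) auto
    ultimately show "successively A P1" unfolding P1_def by (simp add: successively_Cons)
  qed
  obtain Z where Z: "Z \<noteq> []" "distinct Z" "successively A Z" "hd Z = hd P1" "last Z = last P1" "set Z = set P1 \<union> set B"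
  proof (rule insert_block[of "set B" P1 A])
    show "length P1 + 2 * card (set B) \<le> arcs A u (set P1 \<union> set B)" if u: "u \<in> set B" for u
    proof -
      have uV: "u \<in> V" "u \<noteq> z1" "u \<noteq> z2" using u AB(1) VY nY by auto
      have "\<not> adjacent A z1 u" using AB(4) u by (auto simp: adjacent_def)
      moreover have "\<not> mate z1 u" using mate_unique b(19) uV by blast
      ultimately have "2 * card V \<le> deg V A z1 + deg V A u + 1" using not_mate z12(1) uV by blast
      then have "length P1 + 2 * card (set B) \<le> deg V A u"
        using dz1 n distinct_card[OF dAB(3)] by (simp add: P1_def)
      then show ?thesis unfolding sP deg_conv .
    qed
  qed (use P1 in auto)
  have "set Z = V" using Z(6) sP by simp
  moreover have "last P1 = last Q" using Y(5) AB(1) by (simp add: P1_def)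
  then have "A (hd Z) (last Z)" using Z(4,5) z2a by (simp add: P1_def)
  ultimately show False using no_bypass Z by blast
qed

lemma run_False: "\<not> run S z2 Q z1"
proof
  assume r: "run S z2 Q z1"
  interpret d: bypass_free V "\<lambda>x y. A y x" by (rule dual)
  have Q: "Q \<noteq> []" using r by (simp add: run_def)
  have "\<not> A z1 (hd Q)" using run_chord[OF r] by blast
  moreover have "\<not> A (last Q) z2" using d.run_chord[OF run_dual[OF r]] Q by (auto simp: hd_rev)
  ultimately show False by (rule run_no_chords[OF r])
qed

theorem deg_less: "u \<in> V \<Longrightarrow> deg V A u < card V"
proof (rule ccontr)
  assume u: "u \<in> V" and "\<not> deg V A u < card V"
  then have hu: "card V \<le> deg V A u" by simp
  \<comment> \<open>\<open>P\<close> asks for |Q| >= 2 instead of flanks of small degree, so a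
    choice with longest \<open>S\<close> exists even if all degrees are large. As
    \<open>high_run\<close> makes the ends of \<open>Q\<close> non-adjacent, |Q| >= 3, and an end of
    degree at least n could still be moved into \<open>S\<close>.\<close>
  define P where "P = (\<lambda>(S, Q). cyc A (S @ Q) \<and> set (S @ Q) = V \<and> S \<noteq> [] \<and> length Q \<ge> 2 \<and> (\<forall>u\<in>set S. card V \<le> deg V A u))"
  obtain H where H: "cyc A H" "set H = V" using hamiltonian by blast
  obtain X Y where XY: "H = X @ u # Y" using u H(2) by (metis split_list)
  have lH: "length H = card V" using H distinct_card[of H] by (simp add: cyc_def)
  have "P ([u], Y @ X)"
    using cyc_rotate[of A X "u # Y"] H XY hu lH n4 by (auto simp: P_def)
  moreover have "\<forall>y. P y \<longrightarrow> length (fst y) < card V + 1"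
  proof (intro allI impI)
    fix y assume "P y"
    then have y: "cyc A (fst y @ snd y)" "set (fst y @ snd y) = V" by (auto simp: P_def split: prod.splits)
    then have "length (fst y @ snd y) = card V" using distinct_card by (metis cyc_def)
    then show "length (fst y) < card V + 1" by simp
  qed
  ultimately obtain S Q where SQ: "P (S, Q)" and max: "\<forall>S' Q'. P (S', Q') \<longrightarrow> length S' \<le> length S"
    using ex_has_greatest_nat[of P "([u], Y @ X)" "\<lambda>y. length (fst y)" "card V + 1"] by (metis fst_conv surj_pair)
  have S: "cyc A (S @ Q)" "set (S @ Q) = V" "S \<noteq> []" "length Q \<ge> 2" "\<forall>u\<in>set S. card V \<le> deg V A u"
    using SQ by (auto simp: P_def)
  have na: "\<not> adjacent A (hd Q) (last Q)" by (rule high_run[OF S])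
  obtain z2 Q2 where Q2: "Q = z2 # Q2" using S(4) by (cases Q) auto
  have "Q2 \<noteq> []" using Q2 S(4) by auto
  then obtain Q' z1 where Q': "Q = z2 # Q' @ [z1]" using Q2 by (metis append_butlast_last_id)
  have "Q' \<noteq> []"
  proof
    assume "Q' = []"
    then have "A z2 z1" using S(1) Q' by (simp add: cyc_def successively_append_iff)
    then show False using na Q' by (simp add: adjacent_def)
  qed
  then have lQ': "length Q' \<ge> 1" by (cases Q') auto
  have "deg V A z2 < card V"
  proof (rule ccontr)
    assume "\<not> deg V A z2 < card V"
    then have "P (S @ [z2], Q' @ [z1])" using S Q' lQ' by (auto simp: P_def not_less)
    then show False using max by fastforce
  qed
  moreover have "deg V A z1 < card V"
  proof (rule ccontr)
    assume "\<not> deg V A z1 < card V"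
    moreover have "cyc A ([z1] @ S @ z2 # Q')" using cyc_rotate[of A "S @ z2 # Q'" "[z1]"] S(1) Q' by simp
    ultimately have "P (z1 # S, z2 # Q')" using S Q' lQ' by (auto simp: P_def not_less)
    then show False using max by fastforce
  qed
  ultimately have "run S z2 Q' z1" using S Q' \<open>Q' \<noteq> []\<close> by (auto simp: run_def)
  then show False using run_False by blast
qed

section \<open>Vertices without a mate\<close>

lemma nonadjacent_mate: "x \<in> V \<Longrightarrow> y \<in> V \<Longrightarrow> x \<noteq> y \<Longrightarrow> \<not> adjacent A x y \<Longrightarrow> mate x y"
  using low_mate deg_less by blast

text \<open>A0 gives n <= d^+(x)+d^-(w), while d(w) < n.\<close>

lemma mate_outdeg_greater:
  assumes "mate x y" "w \<in> V" "w \<noteq> x" "w \<noteq> y" "\<not> A x w"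
  shows "outdeg V A w < outdeg V A x"
  using mate_out[OF assms] deg_less[OF assms(2)] by (simp add: deg_def)

lemma mate_outdeg_less:
  assumes "mate x y" "w \<in> V" "w \<noteq> x" "w \<noteq> y" "\<not> A w x"
  shows "outdeg V A x < outdeg V A w"
proof -
  have "x \<in> V" using assms(1) by (simp add: mate_def)
  then show ?thesis using mate_in[OF assms] deg_less[of x] by (simp add: deg_def)
qed

lemma one_way_outdeg_less:
  assumes "mate a z \<or> mate b z" "A a b" "\<not> A b a"
  shows "outdeg V A a < outdeg V A b"
proof -
  have "a \<in> V" "b \<in> V" "a \<noteq> b" using assms(2) arcV irr by auto
  moreover have "\<not> mate a b" "\<not> mate b a" using assms(2) by (auto simp: mate_def adjacent_def)
  ultimately show ?thesis using assms mate_outdeg_less[of a z b] mate_outdeg_greater[of b z a] by metis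
qed

definition unmated :: "'a \<Rightarrow> bool" where
  "unmated x \<longleftrightarrow> (\<forall>z. \<not> mate x z)"

lemma unmated_adjacent: "unmated x \<Longrightarrow> x \<in> V \<Longrightarrow> y \<in> V \<Longrightarrow> x \<noteq> y \<Longrightarrow> A x y \<or> A y x"
  using nonadjacent_mate[of x y] by (auto simp: unmated_def adjacent_def)

text \<open>Without a mate \<open>x\<close> is adjacent to all n-1 other vertices and has degree at
  most n-1, so each of them accounts for exactly one arc.\<close>

lemma unmated_single:
  assumes u: "unmated x" "A x y"
  shows "\<not> A y x"
proof
  assume yx: "A y x"
  have xy: "x \<in> V" "y \<in> V" "x \<noteq> y" using u(2) arcV irr by auto
  define X where "X = V - {x, y}"
  have X: "finite X" "y \<notin> X" by (auto simp: X_def)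
  have "card X \<le> arcs A x X"
  proof -
    have "X = {z \<in> X. A z x} \<union> {z \<in> X. A x z}"
      using unmated_adjacent[OF u(1) xy(1)] by (auto simp: X_def)
    then have "card X \<le> card {z \<in> X. A z x} + card {z \<in> X. A x z}" using card_Un_le by metis
    then show ?thesis by (simp add: arcs_def arcs_in_def arcs_out_def)
  qed
  moreover have "V - {x} = insert y X" using xy by (auto simp: X_def)
  then have "deg V A x = 2 + arcs A x X" using deg_V_minus[OF xy(1)] X u(2) yx by (simp add: arcs_insert)
  moreover have "card X + 2 = card V" using xy n4 by (simp add: X_def card_Diff_subset)
  ultimately show False using deg_less[OF xy(1)] by simp
qed

section \<open>Cycles of length n-1 omitting a vertex without a mate\<close>

lemma alternate:
  assumes C: "cyc A (xs @ p # q # ys)" "set (xs @ p # q # ys) = V - {y}" "y \<in> V" "unmated y"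
  shows "A p y \<longleftrightarrow> A y q" "A y p \<longleftrightarrow> A q y"
proof -
  have "p \<in> V - {y}" "q \<in> V - {y}" unfolding C(2)[symmetric] by auto
  then have "A p y \<or> A y p" "A q y \<or> A y q" using unmated_adjacent[OF C(4,3)] by blast+
  moreover note omitted_consecutive[OF C(1-3) refl]
  ultimately show "A p y \<longleftrightarrow> A y q" "A y p \<longleftrightarrow> A q y" using unmated_single[OF C(4)] by metis+
qed

lemma length_ge_6E:
  assumes "length C \<ge> 6"
  obtains x0 x1 x2 x3 x4 x5 T where "C = x0 # x1 # x2 # x3 # x4 # x5 # T"
proof -
  have "6 = Suc (Suc (Suc (Suc (Suc (Suc 0)))))" by simp
  then show ?thesis using assms that by (metis Suc_le_length_iff)
qed

lemma length_ge_6E_tail: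
  assumes "length (a # b # c # D) \<ge> 6"
  obtains x y z T where "D = x # y # z # T"
proof -
  have "Suc (Suc (Suc 0)) \<le> length D" using assms by simp
  then show ?thesis using that by (metis Suc_le_length_iff)
qed

text \<open>After a skip, \<open>y\<close> can replace the skipped vertex on the cycle at several
  positions. Thus several cycles of length n-1 omit the skipped vertex, and together they deprive it
  of two neighbours, against the uniqueness of mates.\<close>

lemma no_skip_aux:
  assumes C: "cyc A (x0 # x1 # x2 # x3 # x4 # x5 # T)" "set (x0 # x1 # x2 # x3 # x4 # x5 # T) = V - {y}"
    and y: "y \<in> V" "unmated y" "A x0 y"
  shows "\<not> A x0 x2" "\<not> A x1 x3"
proof -
  let ?C = "x0 # x1 # x2 # x3 # x4 # x5 # T"
  have arcs01: "A x0 x1" "A x1 x2" "A x2 x3" "A x3 x4" "A x4 x5" "A (last (x5 # T)) x0" "successively A (x5 # T)"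
    using C(1) by (auto simp: cyc_def)
  have dist: "distinct ?C" using C(1) by (simp add: cyc_def)
  have yn: "y \<notin> set ?C" unfolding C(2) by blast
  have yC: "A y x1" "A x2 y" "A y x3" "A x4 y" "A y x5"
    using alternate[of "[]" x0 x1 "x2 # x3 # x4 # x5 # T" y] alternate[of "[x0]" x1 x2 "x3 # x4 # x5 # T" y]
      alternate[of "[x0, x1]" x2 x3 "x4 # x5 # T" y] alternate[of "[x0, x1, x2]" x3 x4 "x5 # T" y]
      alternate[of "[x0, x1, x2, x3]" x4 x5 T y] C y by simp_all
  have inV: "x0 \<in> V" "x1 \<in> V" "x2 \<in> V" "x3 \<in> V" "x4 \<in> V" "x5 \<in> V" using arcV arcs01 by blast+
  have Veq: "V = insert y (set ?C)" using C(2) y(1) by blast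
  have nadj: "mate u v" if "\<not> A u v" "\<not> A v u" "u \<in> V" "v \<in> V" "u \<noteq> v" for u v
    using nonadjacent_mate that by (simp add: adjacent_def)
  show "\<not> A x0 x2"
  proof
    assume a: "A x0 x2"
    \<comment> \<open>\<open>y\<close> goes once between \<open>x2\<close> and \<open>x3\<close>,
      once between \<open>x4\<close> and \<open>x5\<close>. Both cycles together make
      \<open>x3\<close> non-adjacent to \<open>x1\<close>; \<open>E\<close> forbids arcs from
      \<open>x4\<close> and \<open>x5\<close> to \<open>x1\<close>, and \<open>D\<close> forbids
      that \<open>x1\<close> dominates both.\<close>
    let ?D = "x0 # x2 # y # x3 # x4 # x5 # T" and ?E = "x0 # x2 # x3 # x4 # y # x5 # T"
    have D: "cyc A ?D" and E: "cyc A ?E" using a arcs01 dist yn yC by (auto simp: cyc_def)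
    have sD: "set ?D = V - {x1}" and sE: "set ?E = V - {x1}" unfolding Veq using dist yn by auto
    note fD = omitted_consecutive[OF D sD inV(2)] and fE = omitted_consecutive[OF E sE inV(2)]
    have 1: "\<not> A x4 x1" "\<not> A x5 x1" "\<not> A x1 x3"
      using fE(2)[of "[x0, x2, x3]" x4 y] fE(2)[of "[x0, x2, x3, x4]" y x5] fE(1)[of "[x0]" x2 x3] yC arcs01 by auto
    have "\<not> A x3 x1" using fD(2)[of "[x0, x2]" y x3] yC by auto
    then have m: "mate x1 x3" using nadj 1 inV dist by auto
    have "\<not> (A x1 x4 \<and> A x1 x5)" using fD(1)[of "[x0, x2, y, x3]" x4 x5] by auto
    then have "mate x1 x4 \<or> mate x1 x5" using nadj 1 inV dist by auto
    then show False using m mate_unique dist by auto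
  qed
  show "\<not> A x1 x3"
  proof
    assume a: "A x1 x3"
    let ?D = "x0 # y # x1 # x3 # x4 # x5 # T" and ?E = "x0 # x1 # x3 # x4 # y # x5 # T"
    have D: "cyc A ?D" and E: "cyc A ?E" using a arcs01 dist yn yC y(3) by (auto simp: cyc_def)
    have sD: "set ?D = V - {x2}" and sE: "set ?E = V - {x2}" unfolding Veq using dist yn by auto
    note fD = omitted_consecutive[OF D sD inV(3)] and fE = omitted_consecutive[OF E sE inV(3)]
    have 1: "\<not> A x2 x4" "\<not> A x2 x5" "\<not> A x0 x2"
      using fE(1)[of "[x0, x1, x3]" x4 y] fE(1)[of "[x0, x1, x3, x4]" y x5] fE(2)[of "[]" x0 x1] yC arcs01 by auto
    have "\<not> A x2 x0" using fD(1)[of "[]" x0 y] yC by auto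
    then have m: "mate x2 x0" using nadj 1 inV dist by auto
    have "\<not> (A x4 x2 \<and> A x5 x2)" using fD(2)[of "[x0, y, x1, x3]" x4 x5] by auto
    then have "mate x2 x4 \<or> mate x2 x5" using nadj 1 inV dist by auto
    then show False using m mate_unique dist by auto
  qed
qed

text \<open>If \<open>y\<close> dominates \<open>a\<close>, the cycle is started one vertex earlier,
  where the arc at \<open>y\<close> has the other direction, and the second claim of
  \<open>no_skip_aux\<close> applies.\<close>

lemma no_skip:
  assumes C: "cyc A (a # b # c # D)" "set (a # b # c # D) = V - {y}" and y: "y \<in> V" "unmated y"
    and l: "length (a # b # c # D) \<ge> 6"
  shows "\<not> A a c"
proof -
  obtain x3 x4 x5 T where D: "D = x3 # x4 # x5 # T" by (rule length_ge_6E_tail[OF l])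
  have "D \<noteq> []" using D by simp
  then obtain D' f where f: "D = D' @ [f]" by (metis append_butlast_last_id)
  have "length D' \<ge> 2" using l f by simp
  then obtain z1 z2 T' where D': "D' = z1 # z2 # T'" by (metis Suc_le_length_iff numeral_2_eq_2)
  have "a \<in> V - {y}" unfolding C(2)[symmetric] by simp
  then consider "A a y" | "A y a" using unmated_adjacent[OF y(2,1)] by blast
  then show ?thesis
  proof cases
    case 1
    then show ?thesis by (rule no_skip_aux(1)[OF C(1)[unfolded D] C(2)[unfolded D] y])
  next
    case 2
    have C': "cyc A (f # a # b # c # D')" using cyc_rotate[of A "a # b # c # D'" "[f]"] C(1) f by simp
    have S': "set (f # a # b # c # D') = V - {y}" unfolding C(2)[symmetric] f by auto
    have "A f y" using alternate(1)[where xs = "[]", unfolded append_Nil, OF C' S' y] 2 by blast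
    then show ?thesis by (rule no_skip_aux(2)[OF C'[unfolded D'] S'[unfolded D'] y])
  qed
qed

lemma omitting_hamiltonian:
  assumes C: "cyc A (xs @ p # q # ys)" "set (xs @ p # q # ys) = V - {y}" "y \<in> V" "A p y" "A y q"
  shows "cyc A (xs @ p # y # q # ys)" "set (xs @ p # y # q # ys) = V"
proof -
  have "y \<notin> set (xs @ p # q # ys)" unfolding C(2) by blast
  then show "cyc A (xs @ p # y # q # ys)" using cyc_insert C(1,4,5) by metis
  have "set (xs @ p # y # q # ys) = insert y (set (xs @ p # q # ys))" by auto
  also have "\<dots> = V" unfolding C(2) using C(3) by (rule insert_Diff)
  finally show "set (xs @ p # y # q # ys) = V" .
qed

text \<open>By alternation \<open>y\<close> fits right behind \<open>b\<close> or right behind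
  \<open>c\<close>, so the arc from \<open>a\<close> to \<open>b\<close> lies on a Hamiltonian
  cycle.\<close>

lemma omitting_no_back:
  assumes C: "cyc A (a # b # c # D)" "set (a # b # c # D) = V - {y}" and y: "y \<in> V" "unmated y"
    and D: "D \<noteq> []"
  shows "\<not> A b a"
proof -
  obtain d D' where D': "D = d # D'" using D by (cases D) auto
  have "b \<in> V - {y}" unfolding C(2)[symmetric] by simp
  then consider "A b y" | "A y b" using unmated_adjacent[OF y(2,1)] by blast
  then show ?thesis
  proof cases
    case 1
    then have "A y c" using alternate(1)[of "[a]" b c D y] C y by simp
    then have "cyc A ([] @ a # b # (y # c # D))" "set ([] @ a # b # (y # c # D)) = V"
      using omitting_hamiltonian[of "[a]" b c D y] C y 1 by simp_all
    then show ?thesis by (rule no_back_consec)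
  next
    case 2
    then have "A c y" using alternate(2)[of "[a]" b c D y] C y by simp
    moreover have "A y d" using alternate(1)[of "[a, b]" c d D' y] C y D' calculation by simp
    ultimately have "cyc A ([] @ a # b # (c # y # d # D'))" "set ([] @ a # b # (c # y # d # D')) = V"
      using omitting_hamiltonian[of "[a, b]" c d D' y] C y D' by simp_all
    then show ?thesis by (rule no_back_consec)
  qed
qed

text \<open>As \<open>b\<close> is adjacent to everything, a closest pair of an in-neighbour
  followed by an out-neighbour is consecutive; inserting \<open>b\<close> there would complete a
  bypass.\<close>

lemma unmated_path:
  assumes P: "distinct P" "successively A P" "P \<noteq> []" "set P = V - {b}" "b \<in> V" "unmated b" "A (hd P) (last P)"
    and L: "P = L1 @ d # M @ f # L2"
  shows "\<not> (A d b \<and> A b f)"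
proof
  assume "A d b \<and> A b f"
  then obtain A1 p B q A2 where B: "P = A1 @ p # B @ q # A2" "A p b" "A b q" "\<forall>x\<in>set B. \<not> A x b \<and> \<not> A b x"
    using closest_pair[OF L, where P = "\<lambda>x. A x b" and R = "A b"] by blast
  have "B = []"
  proof (rule ccontr)
    assume "B \<noteq> []"
    then obtain x where x: "x \<in> set B" by (cases B) auto
    then have "x \<in> set P" using B(1) by simp
    then have "x \<in> V" "x \<noteq> b" unfolding P(4) by blast+
    then show False using unmated_adjacent[OF P(6,5)] B(4) x by blast
  qed
  then have "slot A b P" using B by (auto simp: slot_def)
  moreover have "b \<notin> set P" unfolding P(4) by blast
  ultimately obtain P' where P': "distinct P'" "successively A P'" "hd P' = hd P" "last P' = last P" "set P' = insert b (set P)"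
    using slot_insert[OF _ P(1,2)] by metis
  have "set P' = V" unfolding P'(5) P(4) using P(5) by (rule insert_Diff)
  then show False using no_bypass P' P(7) by metis
qed

text \<open>Otherwise \<open>no_skip\<close> shows that \<open>c\<close> dominates \<open>a\<close>,
  and likewise that the vertex \<open>d\<close> two steps after \<open>b\<close> dominates
  \<open>b\<close> and that \<open>b\<close> dominates the vertex \<open>f\<close> two steps before
  it. With \<open>y\<close> inserted, the path from \<open>c\<close> round to \<open>a\<close> meets
  \<open>d\<close> before \<open>f\<close>, against \<open>unmated_path\<close>. The cases only
  differ in the position of \<open>y\<close>.\<close>

lemma unmated_neighbours:
  assumes C: "cyc A (a # b # c # D)" "set (a # b # c # D) = V - {y}" and y: "y \<in> V" "unmated y"
    and l: "length (a # b # c # D) \<ge> 6" and b: "unmated b"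
  shows "mate a c"
proof (rule ccontr)
  assume nm: "\<not> mate a c"
  obtain d e g0 T0 where "D = d # e # g0 # T0" by (rule length_ge_6E_tail[OF l])
  then obtain T where D0: "D = d # e # T" "T \<noteq> []" by simp
  obtain T' f where T: "T = T' @ [f]" using D0(2) by (metis append_butlast_last_id)
  have dist: "distinct (a # b # c # D)" using C(1) by (simp add: cyc_def)
  have inV: "a \<in> V" "b \<in> V" "c \<in> V" "d \<in> V" "f \<in> V" "b \<noteq> y"
    using arg_cong[OF C(2), of "\<lambda>X. a \<in> X"] arg_cong[OF C(2), of "\<lambda>X. b \<in> X"] arg_cong[OF C(2), of "\<lambda>X. c \<in> X"]
      arg_cong[OF C(2), of "\<lambda>X. d \<in> X"] arg_cong[OF C(2), of "\<lambda>X. f \<in> X"] D0 T by simp_all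
  have "\<not> A a c" by (rule no_skip[OF C y l])
  then have ca: "A c a" using nm nonadjacent_mate[OF inV(1,3)] dist by (auto simp: adjacent_def)
  have C1: "cyc A (b # c # d # (e # T @ [a]))" "set (b # c # d # (e # T @ [a])) = V - {y}"
  proof -
    show "cyc A (b # c # d # (e # T @ [a]))" using cyc_rotate[of A "[a]" "b # c # D"] C(1) D0 by simp
    show "set (b # c # d # (e # T @ [a])) = V - {y}" unfolding C(2)[symmetric] D0 by auto
  qed
  have "\<not> A b d" by (rule no_skip[OF C1 y]) (use l D0 in simp)
  then have db: "A d b" using unmated_adjacent[OF b inV(2,4)] dist D0 by auto
  have C2: "cyc A (f # a # b # (c # d # e # T'))" "set (f # a # b # (c # d # e # T')) = V - {y}"
  proof -
    show "cyc A (f # a # b # (c # d # e # T'))" using cyc_rotate[of A "a # b # c # d # e # T'" "[f]"] C(1) D0 T by simp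
    show "set (f # a # b # (c # d # e # T')) = V - {y}" unfolding C(2)[symmetric] D0 T by auto
  qed
  have "\<not> A f b" by (rule no_skip[OF C2 y]) (use l D0 T in simp)
  then have bf: "A b f" using unmated_adjacent[OF b inV(2,5)] dist D0 T by auto
  have "c \<in> V - {y}" unfolding C(2)[symmetric] by simp
  then consider "A c y" | "A y c" using unmated_adjacent[OF y(2,1)] by blast
  then show False
  proof cases
    case 1
    then have "A y d" using alternate(1)[of "[b]" c d "e # T @ [a]" y] C1 y by simp
    then have H: "cyc A (b # c # y # d # e # T @ [a])" "set (b # c # y # d # e # T @ [a]) = V"
      using omitting_hamiltonian[of "[b]" c d "e # T @ [a]" y] C1 y 1 by simp_all
    define P where "P = c # y # d # e # T @ [a]"
    have "cyc A (b # P)" "set (b # P) = V" using H by (simp_all add: P_def)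
    then have "distinct P" "successively A P" "set P = V - {b}" by (auto simp: cyc_def successively_Cons P_def)
    moreover have "P \<noteq> []" "A (hd P) (last P)" using ca by (simp_all add: P_def)
    moreover have "P = [c, y] @ d # (e # T') @ f # [a]" by (simp add: P_def T)
    ultimately show False using unmated_path[of P b "[c, y]" d "e # T'" f "[a]"] inV(2) b db bf by blast
  next
    case 2
    then have "A d y" using alternate(2)[of "[b]" c d "e # T @ [a]" y] C1 y by simp
    moreover have "A y e" using alternate(1)[of "[b, c]" d e "T @ [a]" y] C1 y calculation by simp
    ultimately have H: "cyc A (b # c # d # y # e # T @ [a])" "set (b # c # d # y # e # T @ [a]) = V"
      using omitting_hamiltonian[of "[b, c]" d e "T @ [a]" y] C1 y by simp_all
    define P where "P = c # d # y # e # T @ [a]"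
    have "cyc A (b # P)" "set (b # P) = V" using H by (simp_all add: P_def)
    then have "distinct P" "successively A P" "set P = V - {b}" by (auto simp: cyc_def successively_Cons P_def)
    moreover have "P \<noteq> []" "A (hd P) (last P)" using ca by (simp_all add: P_def)
    moreover have "P = [c] @ d # (y # e # T') @ f # [a]" by (simp add: P_def T)
    ultimately show False using unmated_path[of P b "[c]" d "y # e # T'" f "[a]"] inV(2) b db bf by blast
  qed
qed

text \<open>Otherwise out-degrees would increase from \<open>c\<close> to \<open>a\<close>, from
  \<open>a\<close> to \<open>b\<close>, and, if \<open>b\<close> or \<open>c\<close> has a mate,
  from \<open>b\<close> back to \<open>c\<close>. So \<open>b\<close> has no mate, and
  \<open>unmated_neighbours\<close> gives the claim after all.\<close>

lemma mated_second_successor: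
  assumes C: "cyc A (a # b # c # D)" "set (a # b # c # D) = V - {y}" and y: "y \<in> V" "unmated y"
    and l: "length (a # b # c # D) \<ge> 6" and a: "\<not> unmated a"
  shows "mate a c"
proof (rule ccontr)
  assume nac: "\<not> mate a c"
  obtain z where z: "mate a z" using a by (auto simp: unmated_def)
  obtain d e g0 T0 where "D = d # e # g0 # T0" by (rule length_ge_6E_tail[OF l])
  then obtain T where D0: "D = d # e # T" by simp
  have dist: "distinct (a # b # c # D)" using C(1) by (simp add: cyc_def)
  have ab: "A a b" "A b c" using C(1) by (auto simp: cyc_def)
  have inV: "a \<in> V" "b \<in> V" "c \<in> V" using ab arcV by blast+
  have nba: "\<not> A b a" by (rule omitting_no_back[OF C y]) (simp add: D0)
  have C1: "cyc A (b # c # d # (e # T @ [a]))" "set (b # c # d # (e # T @ [a])) = V - {y}"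
  proof -
    show "cyc A (b # c # d # (e # T @ [a]))" using cyc_rotate[of A "[a]" "b # c # D"] C(1) D0 by simp
    show "set (b # c # d # (e # T @ [a])) = V - {y}" unfolding C(2)[symmetric] D0 by auto
  qed
  have ncb: "\<not> A c b" by (rule omitting_no_back[OF C1 y]) simp
  have "outdeg V A c < outdeg V A a"
    by (rule mate_outdeg_greater[OF z]) (use inV dist nac z no_skip[OF C y l] in auto)
  moreover have "outdeg V A a < outdeg V A b" using one_way_outdeg_less[of a z b] z ab nba by blast
  moreover have "outdeg V A b < outdeg V A c" if "\<not> unmated b \<or> \<not> unmated c"
    using one_way_outdeg_less[of b _ c] that ab ncb by (auto simp: unmated_def)
  ultimately have "unmated b" by fastforce
  then show False using unmated_neighbours[OF C y l] nac by blast
qed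

text \<open>On a longer cycle a mated vertex would have its mate two steps ahead, which again would
  have its mate two steps ahead. So \<open>a\<close> and \<open>b\<close> have no mates, although
  \<open>unmated_neighbours\<close> at \<open>b\<close> provides one for \<open>a\<close>. The bound
  6 is what \<open>no_skip_aux\<close> needs.\<close>

lemma unmated_omitted_short:
  assumes C: "cyc A C" "set C = V - {y}" and y: "y \<in> V" "unmated y"
  shows "length C < 6"
proof (rule ccontr)
  assume "\<not> length C < 6"
  then have l: "length C \<ge> 6" by simp
  obtain a b c d e g T where C6: "C = a # b # c # d # e # g # T" by (rule length_ge_6E[OF l])
  have dist: "distinct C" using C(1) by (simp add: cyc_def)
  have step: "mate v z" if v: "\<not> unmated v" and r: "C = X @ v # w # z # Y" for v w z X Y
  proof -
    have "cyc A (v # w # z # (Y @ X))" using cyc_rotate[of A X "v # w # z # Y"] C(1) r by simp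
    moreover have "set (v # w # z # (Y @ X)) = V - {y}" unfolding C(2)[symmetric] r by auto
    ultimately show ?thesis by (rule mated_second_successor) (use y v l r in auto)
  qed
  have unm: "unmated v" if r: "C = X @ v # w # z # w' # z' # Y" for v w z w' z' X Y
  proof (rule ccontr)
    assume v: "\<not> unmated v"
    have m: "mate v z" by (rule step[OF v r])
    then have "\<not> unmated z" using mate_sym by (auto simp: unmated_def)
    then have "mate z z'" using step[of z "X @ [v, w]" w' z' Y] r by simp
    then have "v = z'" using m mate_sym mate_unique by blast
    then show False using dist r by simp
  qed
  have "unmated a" "unmated b" using unm[of "[]" a b c d e "g # T"] unm[of "[a]" b c d e g T] C6 by simp_all
  moreover have "mate a c"
    by (rule unmated_neighbours[of a b c "d # e # g # T" y]) (use C C6 y l \<open>unmated b\<close> in auto)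
  ultimately show False by (simp add: unmated_def)
qed

end

section \<open>The exceptional tournament\<close>

lemma T5_iso:
  assumes V: "V = {y, x0, x1, x2, x3}" and d: "distinct [y, x0, x1, x2, x3]"
    and yes: "A x0 x1" "A x1 x2" "A x2 x3" "A x3 x0" "A x0 y" "A x2 y" "A y x1" "A y x3" "A x0 x2" "A x1 x3"
    and no: "\<not> A x1 x0" "\<not> A x2 x1" "\<not> A x3 x2" "\<not> A x0 x3" "\<not> A y x0" "\<not> A y x2" "\<not> A x1 y" "\<not> A x3 y"
      "\<not> A x2 x0" "\<not> A x3 x1" "\<And>x. \<not> A x x"
  shows "digraph_iso V A T5_vertices T5_arc"
proof -
  define f :: "'a \<Rightarrow> nat" where
    "f = (\<lambda>v. if v = x0 then 1 else if v = x1 then 2 else if v = x2 then 3 else if v = x3 then 4 else 0)"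
  have f: "f y = 0" "f x0 = 1" "f x1 = 2" "f x2 = 3" "f x3 = 4" using d by (auto simp: f_def)
  have "bij_betw f V T5_vertices"
    unfolding bij_betw_def V T5_vertices_def inj_on_def using f by auto
  moreover have "\<forall>x\<in>V. \<forall>z\<in>V. A x z \<longleftrightarrow> T5_arc (f x) (f z)"
    unfolding V T5_arc_def using yes no f by simp
  ultimately show ?thesis unfolding digraph_iso_def by blast
qed

context bypass_free
begin

text \<open>Alternation makes the length of the cycle even, hence 4, and n = 5. A0 makes opposite
  vertices of the cycle adjacent; of the four orientations of the two diagonals two give T(5) and
  two give a bypass.\<close>

lemma unmated_omitted_T5:
  assumes C: "cyc A C" "set C = V - {y}" and y: "y \<in> V" "unmated y"
  shows "digraph_iso V A T5_vertices T5_arc"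
proof -
  obtain a where a: "A a y" using indeg_pos[OF y(1)] unfolding indeg_def
    by (metis (mono_tags, lifting) Collect_empty_eq card.empty not_one_le_zero)
  then have "a \<in> set C" unfolding C(2) using arcV[OF a] irr[of y] by blast
  then obtain X Y where XY: "C = X @ a # Y" by (metis split_list)
  define D where "D = a # Y @ X"
  have D: "cyc A D" "set D = V - {y}"
  proof -
    show "cyc A D" using cyc_rotate[of A X "a # Y"] C(1) XY D_def by simp
    show "set D = V - {y}" unfolding C(2)[symmetric] XY D_def by auto
  qed
  have n: "length D + 1 = card V" by (rule card_cyc[OF D y(1)])
  have "length D < 6" by (rule unmated_omitted_short[OF D y])
  then have lD: "length D = 3 \<or> length D = 4 \<or> length D = 5" using n n4 by linarith
  have hD: "A (hd D) y" using a by (simp add: D_def)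
  have lastD: "\<not> A (last D) y" using omitted_cycle_ends(2)[OF D y(1)] hD by blast
  have "\<exists>x0 x1 x2 R. D = x0 # x1 # x2 # R"
  proof -
    have "Suc (Suc (Suc 0)) \<le> length D" using lD by auto
    then show ?thesis by (metis Suc_le_length_iff)
  qed
  then obtain x0 x1 x2 R where R: "D = x0 # x1 # x2 # R" by blast
  note DR = D[unfolded R]
  have y012: "A x0 y" "A y x1" "A x2 y"
    using hD R alternate(1)[where xs = "[]", unfolded append_Nil, OF DR y]
      alternate(2)[where xs = "[x0]", unfolded append_Cons append_Nil, OF DR y] by auto
  have "R \<noteq> []" using lastD R y012 by auto
  then obtain x3 R' where R': "R = x3 # R'" by (cases R) auto
  note DR' = DR[unfolded R']
  have y3: "A y x3"
    using alternate(1)[where xs = "[x0, x1]", unfolded append_Cons append_Nil, OF DR' y] y012 by auto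
  have "R' = []"
  proof (rule ccontr)
    assume "R' \<noteq> []"
    then obtain x4 where x4: "R' = [x4]" using lD R R' by (cases R'; cases "tl R'") auto
    then have "A x4 y"
      using alternate(2)[where xs = "[x0, x1, x2]", unfolded append_Cons append_Nil, OF DR'[unfolded x4] y] y3 by auto
    then show False using lastD R R' x4 by simp
  qed
  then have Deq: "D = [x0, x1, x2, x3]" using R R' by simp
  note D4 = D[unfolded Deq]
  have arcs4: "A x0 x1" "A x1 x2" "A x2 x3" "A x3 x0" using D4(1) by (auto simp: cyc_def)
  have rot: "cyc A [x1, x2, x3, x0]" "cyc A [x2, x3, x0, x1]" "cyc A [x3, x0, x1, x2]"
    "set [x1, x2, x3, x0] = V - {y}" "set [x2, x3, x0, x1] = V - {y}" "set [x3, x0, x1, x2] = V - {y}"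
    unfolding D4(2)[symmetric] using D4(1) by (auto simp: cyc_def)
  have nb: "\<not> A x1 x0" "\<not> A x2 x1" "\<not> A x3 x2" "\<not> A x0 x3"
    using omitting_no_back[OF D4 y] omitting_no_back[OF rot(1,4) y] omitting_no_back[OF rot(2,5) y]
      omitting_no_back[OF rot(3,6) y] by simp_all
  have ny: "\<not> A y x0" "\<not> A y x2" "\<not> A x1 y" "\<not> A x3 y" using unmated_single[OF y(2)] y012 y3 by blast+
  have V: "V = {y, x0, x1, x2, x3}" using D4(2) y(1) by auto
  have "y \<notin> set [x0, x1, x2, x3]" unfolding D4(2) by blast
  then have d: "distinct [y, x0, x1, x2, x3]" using D4(1) by (auto simp: cyc_def)
  have n5: "card V = 5" unfolding V using d by simp
  have inV: "x0 \<in> V" "x1 \<in> V" "x2 \<in> V" "x3 \<in> V" by (auto simp: V)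
  have deg: "deg V A x0 = 3 + of_bool (A x0 x2) + of_bool (A x2 x0)" "deg V A x2 = 3 + of_bool (A x0 x2) + of_bool (A x2 x0)"
    "deg V A x1 = 3 + of_bool (A x1 x3) + of_bool (A x3 x1)" "deg V A x3 = 3 + of_bool (A x1 x3) + of_bool (A x3 x1)"
    "outdeg V A x0 = 2 + of_bool (A x0 x2)" "outdeg V A x1 = 1 + of_bool (A x1 x3)"
    "indeg V A x3 = 2 + of_bool (A x1 x3)" "indeg V A x0 = 1 + of_bool (A x2 x0)"
    unfolding deg_conv outdeg_conv indeg_conv unfolding V
    using d arcs4 nb ny y012 y3 by (simp_all add: arcs_insert arcs_in_insert arcs_out_insert)
  have a02: "A x0 x2 \<or> A x2 x0"
  proof (rule ccontr)
    assume na: "\<not> (A x0 x2 \<or> A x2 x0)"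
    have "3 * card V \<le> deg V A x0 + deg V A x2 + outdeg V A x0 + indeg V A x3 + 2"
      by (rule A0_out) (use inV d na nb in \<open>auto simp: adjacent_def\<close>)
    then show False using na n5 unfolding deg by (cases "A x1 x3") auto
  qed
  have a13: "A x1 x3 \<or> A x3 x1"
  proof (rule ccontr)
    assume na: "\<not> (A x1 x3 \<or> A x3 x1)"
    have "3 * card V \<le> deg V A x1 + deg V A x3 + outdeg V A x1 + indeg V A x0 + 2"
      by (rule A0_out) (use inV d na nb in \<open>auto simp: adjacent_def\<close>)
    then show False using na n5 unfolding deg by (cases "A x2 x0") auto
  qed
  have single: "\<not> (A x0 x2 \<and> A x2 x0)" "\<not> (A x1 x3 \<and> A x3 x1)"
    using deg_less[OF inV(1)] deg_less[OF inV(2)] n5 unfolding deg by auto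
  consider "A x0 x2" "A x1 x3" | "A x2 x0" "A x3 x1" | "A x0 x2" "A x3 x1" | "A x2 x0" "A x1 x3"
    using a02 a13 by blast
  then show ?thesis
  proof cases
    case 1
    show ?thesis by (rule T5_iso[of V y x0 x1 x2 x3]) (use V d arcs4 nb ny y012 y3 1 single in auto)
  next
    case 2
    \<comment> \<open>Rotating the cycle by two positions reverses both diagonals and keeps the arcs
      at \<open>y\<close>.\<close>
    show ?thesis by (rule T5_iso[of V y x2 x3 x0 x1]) (use V d arcs4 nb ny y012 y3 2 single in auto)
  next
    case 3
    then show ?thesis using no_bypass[of "[x0, y, x3, x1, x2]"] V d arcs4 y012 y3 by auto
  next
    case 4
    then show ?thesis using no_bypass[of "[x1, x2, x0, y, x3]"] V d arcs4 y012 y3 by auto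
  qed
qed

section \<open>Existence of an omitted vertex without a mate\<close>

lemma consecutive_unmated:
  assumes no: "\<And>C y. cyc A C \<Longrightarrow> set C = V - {y} \<Longrightarrow> y \<in> V \<Longrightarrow> \<not> unmated y"
    and H: "cyc A (a # b # c # d # D)" "set (a # b # c # d # D) = V" and u: "unmated b" "unmated c"
  shows "A c a" "A b x \<Longrightarrow> x = c"
proof -
  have dist: "distinct (a # b # c # d # D)" using H(1) by (simp add: cyc_def)
  have inV: "a \<in> V" "b \<in> V" "c \<in> V" "d \<in> V" unfolding H(2)[symmetric] by auto
  have "\<not> A a c"
  proof
    assume "A a c"
    then have "cyc A (a # c # d # D)" using H(1) by (auto simp: cyc_def)
    moreover have "set (a # c # d # D) = V - {b}" unfolding H(2)[symmetric] using dist by auto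
    ultimately show False using no inV(2) u(1) by blast
  qed
  then show ca: "A c a" using unmated_adjacent[OF u(2) inV(3,1)] dist by auto
  have "\<not> A b d"
  proof
    assume "A b d"
    then have "cyc A (a # b # d # D)" using H(1) by (auto simp: cyc_def)
    moreover have "set (a # b # d # D) = V - {c}" unfolding H(2)[symmetric] using dist by auto
    ultimately show False using no inV(3) u(2) by blast
  qed
  then have db: "A d b" using unmated_adjacent[OF u(1) inV(2,4)] dist by auto
  have "\<not> A b a" using no_back_consec[of "[]" a b "c # d # D"] H by simp
  show "x = c" if bx: "A b x"
  proof (rule ccontr)
    assume "x \<noteq> c"
    have "x \<in> set (a # b # c # d # D)" unfolding H(2) using arcV bx by blast
    then have "x \<in> set D" using \<open>x \<noteq> c\<close> bx \<open>\<not> A b d\<close> \<open>\<not> A b a\<close> irr by auto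
    then obtain M N where MN: "D = M @ x # N" by (metis split_list)
    define P where "P = c # d # D @ [a]"
    have "cyc A ((b # c # d # D) @ [a])" using cyc_rotate[of A "[a]" "b # c # d # D"] H(1) by simp
    then have P: "distinct P" "successively A P" by (auto simp: cyc_def P_def)
    have sP: "set P = V - {b}" unfolding H(2)[symmetric] P_def using dist by auto
    have cl: "P \<noteq> []" "A (hd P) (last P)" using ca by (simp_all add: P_def)
    have "P = [c] @ d # M @ x # (N @ [a])" by (simp add: P_def MN)
    then have "\<not> (A d b \<and> A b x)" by (rule unmated_path[OF P cl(1) sP inV(2) u(1) cl(2)])
    then show False using db bx by blast
  qed
qed

text \<open>A vertex \<open>v\<close> of maximal out-degree and its successor on a Hamiltonian cycle
  have no mates. If nobody has a mate, \<open>consecutive_unmated\<close> gives \<open>c\<close>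
  only one out-neighbour \<open>d\<close>, although \<open>c\<close> dominates \<open>v\<close>.
  Otherwise a last mated vertex \<open>a\<close> before a pair of unmated vertices \<open>b\<close>,
  \<open>c\<close> is considered: \<open>b\<close> has out-degree at most 1, and that of
  \<open>a\<close> is smaller, so \<open>a\<close> has no out-arc.\<close>

lemma ex_unmated_omitted: "\<exists>C y. cyc A C \<and> set C = V - {y} \<and> y \<in> V \<and> unmated y"
proof (rule ccontr)
  assume neg: "\<nexists>C y. cyc A C \<and> set C = V - {y} \<and> y \<in> V \<and> unmated y"
  then have no: "\<And>C y. cyc A C \<Longrightarrow> set C = V - {y} \<Longrightarrow> y \<in> V \<Longrightarrow> \<not> unmated y" by blast
  obtain H where H: "cyc A H" "set H = V" using hamiltonian by blast
  have lH: "length H = card V" using H distinct_card[of H] by (simp add: cyc_def)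
  have "V \<noteq> {}" using n4 by auto
  then have "Max (outdeg V A ` V) \<in> outdeg V A ` V" using fin by (intro Max_in) auto
  then obtain v where v: "v \<in> V" "outdeg V A v = Max (outdeg V A ` V)" by (metis imageE)
  have max: "outdeg V A x \<le> outdeg V A v" if "x \<in> V" for x
    unfolding v(2) using fin that by (intro Max_ge) auto
  obtain X Y where XY: "H = X @ v # Y" using split_list[of v H] v(1) unfolding H(2)[symmetric] by blast
  define G where "G = v # Y @ X"
  have G: "cyc A G" "set G = V" "length G = card V"
    using cyc_rotate[of A X "v # Y"] H lH XY by (auto simp: G_def)
  then obtain w Z where Z: "G = v # w # Z" using n4 G_def by (cases "Y @ X") auto
  have vw: "A v w" "\<not> A w v" using G Z no_back_consec[of "[]" v w Z] by (auto simp: cyc_def)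
  have "w \<in> V" using vw arcV by blast
  then have "\<not> outdeg V A v < outdeg V A w" using max by (simp add: not_less)
  then have uvw: "unmated v" "unmated w" using one_way_outdeg_less[of v _ w] vw by (auto simp: unmated_def)
  show False
  proof (cases "\<forall>x\<in>V. unmated x")
    case True
    obtain c d e R where R: "G = v # w # c # d # R"
    proof -
      have "Suc (Suc (Suc (Suc 0))) \<le> length G" using G(3) n4 by simp
      then show ?thesis using that Z by (metis Suc_le_length_iff list.inject)
    qed
    have inV: "c \<in> V" "d \<in> V" "w \<in> V" using G(2) R by auto
    have dist: "distinct G" using G(1) by (simp add: cyc_def)
    have cv: "A c v" by (rule consecutive_unmated(1)[OF no G(1)[unfolded R] G(2)[unfolded R]]) (use True inV in blast)+
    show False
    proof (cases R)
      case Nil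
      \<comment> \<open>For n = 4 the four consecutive vertices starting at \<open>w\<close> wrap
        around and end with \<open>v\<close>.\<close>
      have c1: "cyc A [w, c, d, v]" using cyc_rotate[of A "[v]" "[w, c, d]"] G(1) R Nil by simp
      have s1: "set [w, c, d, v] = V" unfolding G(2)[symmetric] R Nil by auto
      have "v = d" by (rule consecutive_unmated(2)[OF no c1 s1 _ _ cv]) (use True inV in blast)+
      then show False using dist R by simp
    next
      case (Cons e R')
      have c1: "cyc A (w # c # d # e # R' @ [v])" using cyc_rotate[of A "[v]" "w # c # d # e # R'"] G(1) R Cons by simp
      have s1: "set (w # c # d # e # R' @ [v]) = V" unfolding G(2)[symmetric] R Cons by auto
      have "v = d" by (rule consecutive_unmated(2)[OF no c1 s1 _ _ cv]) (use True inV in blast)+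
      then show False using dist R by simp
    qed
  next
    case False
    then have "\<exists>x\<in>set G. \<not> unmated x" using G(2) by blast
    then obtain S a R where S: "G = S @ a # R" "\<not> unmated a" "\<forall>x\<in>set R. unmated x"
      using split_list_last_prop[of G "\<lambda>x. \<not> unmated x"] by blast
    have "S \<noteq> []" using S(1,2) Z uvw by auto
    then obtain S' where S': "S = v # S'" using S(1) Z by (cases S) auto
    have K: "cyc A (a # R @ S)" "set (a # R @ S) = V"
      using cyc_rotate[of A S "a # R"] G S(1) by auto
    have "length (a # R @ S) = card V" using G(3) S(1) by simp
    then have "Suc (Suc (Suc 0)) \<le> length (R @ S)" using n4 by simp
    then obtain b c d D where D: "R @ S = b # c # d # D" by (metis Suc_le_length_iff)
    have ub: "unmated b"
      using D S(3) S' uvw by (cases R) auto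
    have uc: "unmated c"
    proof (cases R)
      case Nil
      have "S' \<noteq> []" using D S' Nil by auto
      then have "hd S' = w" using S(1) S' Z by (cases S') auto
      then show ?thesis using D S' Nil uvw by auto
    next
      case (Cons r R')
      then show ?thesis using D S(3) S' uvw by (cases R') auto
    qed
    have K': "cyc A (a # b # c # d # D)" "set (a # b # c # d # D) = V" using K D by simp_all
    have inV: "a \<in> V" "b \<in> V" unfolding K'(2)[symmetric] by auto
    have only: "x = c" if "A b x" for x by (rule consecutive_unmated(2)[OF no K' ub uc that])
    have "outdeg V A b \<le> card {c}" unfolding outdeg_def by (rule card_mono) (use only in auto)
    moreover have ab: "A a b" using K'(1) by (auto simp: cyc_def)
    moreover have "\<not> A b a" using no_back_consec[of "[]" a b "c # d # D"] K' by simp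
    then have "outdeg V A a < outdeg V A b" using one_way_outdeg_less[of a _ b] S(2) ab by (auto simp: unmated_def)
    ultimately show False using outdeg_pos[OF inV(1)] by simp
  qed
qed

lemma T5: "digraph_iso V A T5_vertices T5_arc"
  using ex_unmated_omitted unmated_omitted_T5 by blast

end

theorem theorem12:
  fixes V :: "'a set" and A :: "'a \<Rightarrow> 'a \<Rightarrow> bool"
  assumes "digraph V A"
    and "card V \<ge> 4"
    and "strongly_connected V A"
    and "cond_A0 V A"
    and "\<not> digraph_iso V A T5_vertices T5_arc"
  shows "has_hamiltonian_bypass V A"
proof (rule ccontr)
  assume "\<not> has_hamiltonian_bypass V A"
  then interpret bypass_free V A using assms by unfold_locales
  show False using T5 assms(5) by blast
qed

end
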